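(* Let $V$ be the poset on $\{A,B,C\}$ with cover relations $A\lessdot B$ and $A\lessdot C$. For every integer $q\ge 3$, the order of piecewise-linear rowmotion $\mathrm{Row}$ acting on the order polytope $\mathcal{O}(V\times[q-2])$ divides $2q$.
   Context: $[m]=\{1,\dots,m\}$ is a chain with its usual order, and $V\times[m]$ has the product order. For a finite poset $P$, let $\hat P$ be $P$ with a new minimum $\hat 0$ and a new maximum $\hat 1$ adjoined. The order polytope $\mathcal{O}(P)$ is the set of functions $f:\hat P\to[0,1]$ (real unit interval) such that $p\le p'$ implies $f(p)\le f(p')$, $f(\hat 0)=0$ and $f(\hat 1)=1$. For $p\in P$, the toggle $\tau_p:\mathcal{O}(P)\to\mathcal{O}(P)$ is given by $\tau_p(f)(p')=f(p')$ for $p'\neq p$ and $$\tau_p(f)(p)=\min\{f(r): p\lessdot r\}+\max\{f(r): r\lessdot p\}-f(p),$$ where covers are taken in $\hat P$. Piecewise-linear rowmotion is $\mathrm{Row}=\tau_{p_1}\circ\tau_{p_2}\circ\cdots\circ\tau_{p_m}$, where $(p_1,\dots,p_m)$ is any linear extension of $P$ (elements listed so that smaller elements come first; $\tau_{p_m}$ is applied first). This does not depend on the chosen linear extension. *)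

theory Defs
  imports
    Complex_Main
    "HOL-Library.FuncSet"
    "HOL-Library.Product_Order"
    "HOL-Library.Extended"
    "HOL-Algebra.Bij"
    "HOL-Algebra.Multiplicative_Group"
begin

text \<open>
  A finite poset is a finite set \<open>P\<close> of elements of a partially ordered type, with the induced order.
\<close>

definition covered_by :: "'a::order set \<Rightarrow> 'a \<Rightarrow> 'a \<Rightarrow> bool" where
  "covered_by S x y \<longleftrightarrow> x \<in> S \<and> y \<in> S \<and> x < y \<and> \<not> (\<exists>z\<in>S. x < z \<and> z < y)"

text \<open>
  The new minimum is \<^term>\<open>Minf\<close> and the new maximum is \<^term>\<open>Pinf\<close>.
\<close>

definition hat :: "'a::order set \<Rightarrow> 'a extended set" where
  "hat P = insert Minf (insert Pinf (Fin ` P))"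

text \<open>
  Points of the order polytope are extensional functions (\<^term>\<open>undefined\<close> off \<^term>\<open>hat P\<close>), so
  that equality of points is equality of functions on \<^term>\<open>hat P\<close>.
\<close>

definition order_polytope :: "'a::order set \<Rightarrow> ('a extended \<Rightarrow> real) set" where
  "order_polytope P =
     {f \<in> hat P \<rightarrow>\<^sub>E {0..1}.
        (\<forall>p\<in>hat P. \<forall>p'\<in>hat P. p \<le> p' \<longrightarrow> f p \<le> f p') \<and> f Minf = 0 \<and> f Pinf = 1}"

definition toggle :: "'a::order set \<Rightarrow> 'a \<Rightarrow> ('a extended \<Rightarrow> real) \<Rightarrow> ('a extended \<Rightarrow> real)" where
  "toggle P p f =
     f(Fin p := Min {f r | r. covered_by (hat P) (Fin p) r}
              + Max {f r | r. covered_by (hat P) r (Fin p)} - f (Fin p))"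

definition linear_extension :: "'a::order set \<Rightarrow> 'a list \<Rightarrow> bool" where
  "linear_extension P ps \<longleftrightarrow>
     distinct ps \<and> set ps = P \<and>
     (\<forall>i<length ps. \<forall>j<length ps. ps ! i < ps ! j \<longrightarrow> i < j)"

text \<open>
  Rowmotion computed along the list \<open>ps\<close>, whose last element is toggled first. It is restricted to
  the order polytope so that it can be an element of the group \<^term>\<open>BijGroup (order_polytope P)\<close>,
  which consists of extensional bijections.
\<close>

definition rowmotion ::
    "'a::order set \<Rightarrow> 'a list \<Rightarrow> ('a extended \<Rightarrow> real) \<Rightarrow> ('a extended \<Rightarrow> real)" where
  "rowmotion P ps = restrict (foldr (toggle P) ps) (order_polytope P)"

datatype vee = VA | VB | VC

instantiation vee :: order
begin

definition less_eq_vee :: "vee \<Rightarrow> vee \<Rightarrow> bool" where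
  "less_eq_vee x y \<longleftrightarrow> x = y \<or> x = VA"

definition less_vee :: "vee \<Rightarrow> vee \<Rightarrow> bool" where
  "less_vee x y \<longleftrightarrow> x \<le> y \<and> \<not> y \<le> (x::vee)"

instance
  by standard (auto simp: less_eq_vee_def less_vee_def)

end

lemma covered_by_vee: "covered_by UNIV x y \<longleftrightarrow> x = VA \<and> (y = VB \<or> y = VC)"
  by (cases x; cases y) (auto simp: covered_by_def less_vee_def less_eq_vee_def)

text \<open>
  The product order on pairs is the componentwise one of \<^theory>\<open>HOL-Library.Product_Order\<close>.
\<close>

definition vee_times_chain :: "nat \<Rightarrow> (vee \<times> nat) set" where
  "vee_times_chain m = UNIV \<times> {1..m}"

lemma ex_linear_extension:
  assumes "finite P"
  shows "\<exists>ps. linear_extension P ps"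
  using assms
proof (induction "card P" arbitrary: P)
  case 0
  then show ?case by (auto simp: linear_extension_def)
next
  case (Suc n)
  then have "P \<noteq> {}" by auto
  with Suc.prems obtain m where m: "m \<in> P" "\<And>x. x \<in> P \<Longrightarrow> \<not> m < x"
    using finite_has_maximal[of P] by (metis less_le)
  have "n = card (P - {m})" using Suc m by simp
  then obtain ps where "linear_extension (P - {m}) ps"
    using Suc.hyps(1)[of "P - {m}"] Suc.prems by auto
  then have "linear_extension P (ps @ [m])"
    unfolding linear_extension_def
  proof (intro conjI allI impI)
    fix i j
    assume ps: "distinct ps \<and> set ps = P - {m} \<and>
                (\<forall>i<length ps. \<forall>j<length ps. ps ! i < ps ! j \<longrightarrow> i < j)"
      and i: "i < length (ps @ [m])" and j: "j < length (ps @ [m])"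
      and ij: "(ps @ [m]) ! i < (ps @ [m]) ! j"
    have "(ps @ [m]) ! j \<in> set (ps @ [m])" using j by (rule nth_mem)
    then have "(ps @ [m]) ! j \<in> P" using ps m(1) by auto
    then have "i \<noteq> length ps" using m(2) ij by auto
    then have "i < length ps" using i by simp
    then show "i < j"
      using ps j ij by (cases "j < length ps") (auto simp: nth_append)
  qed (use m(1) in auto)
  then show ?case by blast
qed

end

theory Submission
  imports Defs
begin

text \<open>
  Toggles are Lipschitz, so it suffices to treat a point \<open>f\<close> with values in the multiples of \<open>1 / N\<close>.
  Such a point is encoded by \<open>N\<close> tokens of each of the letters A, B, C, placed in \<open>q\<close> consecutive slots:
  the value of \<open>f\<close> at \<open>(v, j)\<close> is read off from the number of \<open>v\<close>-tokens in an initial segment of the slots.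
  Each A is joined by a noncrossing system of arcs to a later B, and by another one to a later C.
  Rowmotion becomes promotion of this Kreweras word: each A in the first slot turns the nearer end of
  its two arcs into an A and reappears, \<open>q\<close> slots later, as the letter that was used up. (An A whose
  two arcs end at the same place uses up both letters and reappears as both.)

  As for webs, the superposition of the two arc systems has a trip permutation, defined by
  walking along the arcs and turning at every crossing. One step of promotion rotates the
  diagram and does not change the trips. The trip of an A is the position of the letter that it will turn
  into an A, so the trips determine which positions carry an A. Hence after one full turn the
  A's are back where they were, and each B has become a C and vice versa: the \<open>q\<close>-th power of rowmotion
  interchanges the two branches.
\<close>

text \<open>A point \<open>f\<close> alone does not give a Kreweras word. The A-row is read from
  \<open>f\<close>, but the B- and C-rows from \<open>R f\<close>: the inequality
  \<open>f (node VA j) <= R f (node v j)\<close> is what puts enough A's before every B and every C.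
  Rowmotion and promotion are then never compared as maps. Both are described by arrays of counts
  whose recurrences determine row \<open>t + 1\<close> from row \<open>t\<close>, so it suffices to
  realise one initial row by an arc diagram. The obstacle is that a start moves while most ends
  stay, so arcs must be reattached and no single arc can be followed. The trip survives: the arcs
  over a point are nested, hence their starts and their ends, as two sets per system, already
  determine the walk, and reattaching changes these sets only slightly. Many tokens may share a
  slot. Each token gets its own position there, and the ends in a slot are ordered oppositely to
  their starts. This keeps arcs into one slot nested, and the two arcs of an A share an end exactly
  if they reach the same slot.\<close>

section \<open>The zigzag walk on lists of nested arcs\<close>

text \<open>The lists run from the innermost arc outward: starts and ends of one system, then starts
  and ends of the other. The first list is one longer than the second, because it begins with the
  arc that ends at the starting point itself. If \<open>x < l\<close>, the walk gets down to
  \<open>l\<close> before any crossing; otherwise it turns up towards \<open>y\<close> and leaves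
  there unless the next arc of the first system is met. Ties, at a shared start or a shared end,
  count as crossings.\<close>

fun zig :: "int \<Rightarrow> int list \<Rightarrow> int list \<Rightarrow> int list \<Rightarrow> int list \<Rightarrow> int" where
  "zig M (l # ls) ps (x # xs) (y # ys) =
     (if x < l then l + M else if ps = [] \<or> y < hd ps then y else zig M ls (tl ps) xs ys)"
| "zig M (l # ls) ps _ _ = l + M"
| "zig M [] _ _ _ = 0"

text \<open>The starting point lies between \<open>t\<close> and \<open>i\<close>. Up to
  \<open>Y1\<close> all comparisons with ends are unchanged. From \<open>y\<close> on every end is
  at least \<open>i\<close> and hence beyond all of \<open>P\<close>, so the walk goes on crossing;
  the additional crossing with the arc from \<open>t\<close> to \<open>i\<close> is made up for by
  the additional end \<open>y\<close>.\<close>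

lemma zig_inside_hit:
  assumes "L \<noteq> []" "length L = Suc (length P)" "length X = length Y1 + length Y2"
    and "\<forall>l\<in>set L. t < l" "\<forall>x\<in>set X. t < x" "\<forall>p\<in>set P. p < i"
    and "\<forall>y\<in>set Y1. y < i" "i \<le> y" "\<forall>y\<in>set Y2. i \<le> y"
  shows "zig M (L @ [t]) (P @ [i]) (X @ [t]) (Y1 @ y # Y2) = zig M L P X (Y1 @ Y2)"
  using assms
proof (induction L arbitrary: P X Y1 y Y2)
  case (Cons l L)
  show ?case
  proof (cases X)
    case Nil then show ?thesis using Cons.prems by simp
  next
    case X: (Cons x X')
    show ?thesis
    proof (cases Y1)
      case Nil
      with X Cons.prems obtain y2 Y2' where Y2: "Y2 = y2 # Y2'" by (cases Y2) auto
      show ?thesis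
      proof (cases P)
        case Nil
        with Cons.prems have "L = []" by simp
        then show ?thesis using Nil X Y2 \<open>Y1 = []\<close> Cons.prems
          by (cases X') auto
      next
        case P: (Cons p P')
        have "L \<noteq> []" using Cons.prems P by auto
        then show ?thesis using P X Y2 \<open>Y1 = []\<close> Cons.prems Cons.IH[of P' X' "[]" Y2' y2] by auto
      qed
    next
      case Y1: (Cons y1 Y1')
      show ?thesis
      proof (cases P)
        case Nil
        then show ?thesis using X Y1 Cons.prems by auto
      next
        case P: (Cons p P')
        have "L \<noteq> []" using Cons.prems P by auto
        then show ?thesis using P X Y1 Cons.prems Cons.IH[of P' X' Y1' Y2 y] by auto
      qed
    qed
  qed
qed simp

text \<open>All of \<open>Y\<close> lies before \<open>i\<close>, so a walk that gets as far as
  \<open>p\<close> leaves there, just as it does at the first end of \<open>P2\<close> or when the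
  ends are exhausted. The additional start \<open>t\<close> of the other system is below every start
  in \<open>L\<close> and is therefore met too late.\<close>

lemma zig_inside_slid:
  assumes "L \<noteq> []" "length L = Suc (length P1 + length P2)" "length X = length Y"
    and "\<forall>l\<in>set L. t < l" "\<forall>x\<in>set X. t < x" "\<forall>p\<in>set P1. p < i" "i < p" "\<forall>p\<in>set P2. i < p"
    and "\<forall>y\<in>set Y. y < i"
  shows "zig M (L @ [t]) (P1 @ p # P2) (X @ [t]) (Y @ [i]) = zig M L (P1 @ P2) X Y"
  using assms
proof (induction L arbitrary: P1 X Y)
  case (Cons l L)
  show ?case
  proof (cases X)
    case Nil then show ?thesis using Cons.prems by simp
  next
    case X: (Cons x X')
    with Cons.prems obtain y Y' where Y: "Y = y # Y'" by (cases Y) auto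
    show ?thesis
    proof (cases P1)
      case Nil
      then show ?thesis using X Y Cons.prems by (cases P2) auto
    next
      case P1: (Cons p1 P1')
      have "L \<noteq> []" using Cons.prems P1 by auto
      then show ?thesis using P1 X Y Cons.prems Cons.IH[of P1' X' Y'] by auto
    qed
  qed
qed simp

text \<open>The starting point lies beyond \<open>i\<close>. All starts in \<open>L\<close> are
  above \<open>i\<close>, so the walk leaves at a start as soon as the other system offers only
  starts up to \<open>i\<close>; what is in \<open>X2\<close>, \<open>X3\<close> and
  \<open>Y3\<close> does not matter.\<close>

lemma zig_outside_hit:
  assumes "L \<noteq> []" "length L = Suc (length P)" "length X1 + length X2 = length Y"
    and "length X1 + length X3 = length Y + length Y3"
    and "\<forall>y\<in>set Y. y < T" "\<forall>l\<in>set L. i < l" "\<forall>x\<in>set X2. x \<le> i" "\<forall>x\<in>set X3. x \<le> i"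
  shows "zig M (L @ [i]) (P @ [T]) (X1 @ X3) (Y @ Y3) = zig M L P (X1 @ X2) Y"
  using assms
proof (induction L arbitrary: P X1 Y)
  case (Cons l L)
  show ?case
  proof (cases X1)
    case Nil
    have "zig M ((l # L) @ [i]) (P @ [T]) X3 (Y @ Y3) = l + M"
      using Cons.prems Nil by (cases X3; cases "Y @ Y3") auto
    moreover have "zig M (l # L) P X2 Y = l + M"
      using Cons.prems Nil by (cases X2; cases Y) auto
    ultimately show ?thesis using Nil by simp
  next
    case X: (Cons x X')
    with Cons.prems obtain y Y' where Y: "Y = y # Y'" by (cases Y) auto
    show ?thesis
    proof (cases P)
      case Nil
      then show ?thesis using X Y Cons.prems by auto
    next
      case P: (Cons p P')
      have "L \<noteq> []" using Cons.prems P by auto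
      then show ?thesis using P X Y Cons.prems Cons.IH[of P' X' Y'] by auto
    qed
  qed
qed simp

lemma zig_outside_free:
  assumes "length L = Suc (length P)" "length X = length Y" "\<forall>l\<in>set L. i < l"
  shows "zig M L P (X @ [i]) (Y @ [T]) = zig M L P X Y"
  using assms
proof (induction L arbitrary: P X Y)
  case (Cons l L)
  show ?case
  proof (cases X)
    case Nil then show ?thesis using Cons.prems by simp
  next
    case X: (Cons x X')
    with Cons.prems obtain y Y' where Y: "Y = y # Y'" by (cases Y) auto
    show ?thesis using X Y Cons.prems Cons.IH[of "tl P" X' Y'] by (cases P) auto
  qed
qed simp

text \<open>This is where counting a start \<open>l\<close> as \<open>l + M\<close> pays off: a walk
  that used to leave at the start \<open>t\<close> now leaves at the new end \<open>t + M\<close>.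
  All starts of the first system are at most \<open>i\<close> and those in \<open>X\<close> are
  above \<open>i\<close>, so until \<open>X\<close> is exhausted only the number of starts matters,
  and the crossing at \<open>i\<close> then corrects the shift by one.\<close>

lemma zig_outside_shift:
  assumes "length L = length P" "length X = length Y" "c \<le> i" "\<forall>l\<in>set L. l \<le> i" "t \<le> i"
    and "\<forall>x\<in>set X. i < x" "\<forall>p\<in>set P. p < t + M"
  shows "zig M (c # L) P (X @ [i]) (Y @ [t + M]) = zig M (L @ [t]) P X Y"
  using assms
proof (induction X arbitrary: c L P Y)
  case Nil
  then show ?case by (cases L; cases P) auto
next
  case (Cons x X)
  then obtain y Y' where Y: "Y = y # Y'" by (cases Y) auto
  show ?case
  proof (cases L)
    case Nil
    then show ?thesis using Cons.prems Y by auto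
  next
    case L: (Cons l L')
    then obtain p P' where P: "P = p # P'" using Cons.prems by (cases P) auto
    show ?thesis using L P Y Cons.prems Cons.IH[of L' P' Y' l] by auto
  qed
qed

lemma zig_outside_slid:
  assumes "length L1 + length L2 = length P" "length X = length Y" "c \<le> i" "\<forall>l\<in>set L2. l \<le> i"
    and "t \<le> i" "\<forall>l\<in>set L1. i < l" "\<forall>x\<in>set X. i < x" "\<forall>p\<in>set P. p < t + M"
  shows "zig M (L1 @ c # L2) P (X @ [i]) (Y @ [t + M]) = zig M (L1 @ L2 @ [t]) P X Y"
  using assms
proof (induction L1 arbitrary: P X Y)
  case Nil
  then show ?case using zig_outside_shift[of L2 P X Y c i t M] by simp
next
  case (Cons l L1)
  then obtain p P' where P: "P = p # P'" by (cases P) auto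
  show ?case
  proof (cases X)
    case Nil then show ?thesis using Cons.prems by simp
  next
    case X: (Cons x X')
    with Cons.prems obtain y Y' where Y: "Y = y # Y'" by (cases Y) auto
    show ?thesis using P X Y Cons.prems Cons.IH[of P' X' Y'] by auto
  qed
qed

abbreviation asc :: "int set \<Rightarrow> int list" where
  "asc A \<equiv> sorted_list_of_set A"

abbreviation desc :: "int set \<Rightarrow> int list" where
  "desc A \<equiv> rev (sorted_list_of_set A)"

lemma asc_Un:
  assumes "finite A" "finite B" "\<And>a b. a \<in> A \<Longrightarrow> b \<in> B \<Longrightarrow> a < b"
  shows "asc (A \<union> B) = asc A @ asc B"
proof (rule sorted_distinct_set_unique)
  show "sorted (asc A @ asc B)" using assms by (auto simp: sorted_append less_imp_le)
  show "distinct (asc A @ asc B)" using assms by fastforce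
qed (use assms in auto)

lemma asc_min:
  assumes "finite A" "t \<in> A" "\<And>x. x \<in> A \<Longrightarrow> t \<le> x"
  shows "asc A = t # asc (A - {t})"
proof -
  have "asc ({t} \<union> (A - {t})) = asc {t} @ asc (A - {t})"
    using assms by (intro asc_Un) (auto simp: less_le)
  then show ?thesis using assms by (simp add: insert_absorb)
qed

lemma asc_insert_max:
  assumes "finite A" "\<And>x. x \<in> A \<Longrightarrow> x < t"
  shows "asc (insert t A) = asc A @ [t]"
  using asc_Un[of A "{t}"] assms by simp

lemma asc_insert_min:
  assumes "finite A" "\<And>x. x \<in> A \<Longrightarrow> t < x"
  shows "asc (insert t A) = t # asc A"
  using asc_Un[of "{t}" A] assms by simp

lemma asc_max:
  assumes "finite A" "t \<in> A" "\<And>x. x \<in> A \<Longrightarrow> x \<le> t"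
  shows "asc A = asc (A - {t}) @ [t]"
proof -
  have "asc (insert t (A - {t})) = asc (A - {t}) @ [t]"
    using assms by (intro asc_insert_max) (auto simp: less_le)
  then show ?thesis using assms by (simp add: insert_absorb)
qed

section \<open>Noncrossing arc systems and the sliding of the first start\<close>

text \<open>With \<open>p' \<le> b p\<close> instead of \<open>p' < b p\<close> the condition also
  forbids a start at the end of an arc, since \<open>b p' < b p = p'\<close> would follow. The
  strict conclusion makes \<open>b\<close> injective.\<close>

definition noncrossing :: "int set \<Rightarrow> (int \<Rightarrow> int) \<Rightarrow> bool" where
  "noncrossing S b \<longleftrightarrow> (\<forall>p\<in>S. p < b p \<and> (\<forall>p'\<in>S. p < p' \<longrightarrow> p' \<le> b p \<longrightarrow> b p' < b p))"

definition over :: "int set \<Rightarrow> (int \<Rightarrow> int) \<Rightarrow> int \<Rightarrow> int set" where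
  "over S b r = {p \<in> S. p < r \<and> r < b p}"

definition upto_over :: "int set \<Rightarrow> (int \<Rightarrow> int) \<Rightarrow> int \<Rightarrow> int set" where
  "upto_over S b r = {p \<in> S. p < r \<and> r \<le> b p}"

lemma noncrossing_less: "noncrossing S b \<Longrightarrow> p \<in> S \<Longrightarrow> p < b p"
  by (auto simp: noncrossing_def)

lemma noncrossing_nested:
  "noncrossing S b \<Longrightarrow> p \<in> S \<Longrightarrow> p' \<in> S \<Longrightarrow> p < p' \<Longrightarrow> p' \<le> b p \<Longrightarrow> b p' < b p"
  by (auto simp: noncrossing_def)

lemma noncrossing_inj:
  assumes "noncrossing S b" "p \<in> S" "p' \<in> S" "b p = b p'"
  shows "p = p'"
  using noncrossing_nested[OF assms(1), of p p'] noncrossing_nested[OF assms(1), of p' p]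
    noncrossing_less[OF assms(1), of p] noncrossing_less[OF assms(1), of p'] assms
  by (cases p p' rule: linorder_cases) auto

lemma noncrossing_inj_on: "noncrossing S b \<Longrightarrow> inj_on b S"
  by (auto intro!: inj_onI dest: noncrossing_inj)

lemma noncrossing_not_end: "noncrossing S b \<Longrightarrow> p \<in> S \<Longrightarrow> p' \<in> S \<Longrightarrow> b p \<noteq> p'"
  using noncrossing_less[of S b p] noncrossing_less[of S b p'] noncrossing_nested[of S b p p'] by force

text \<open>
  The start \<open>t\<close> moves to \<open>i\<close>. If the arc of \<open>t\<close> does not end there, every end beyond \<open>i\<close> of an arc over \<open>i\<close> is handed to the next inner
  start, which keeps the set of ends and the absence of crossings.
\<close>

definition slide :: "int set \<Rightarrow> int \<Rightarrow> int \<Rightarrow> int \<Rightarrow> (int \<Rightarrow> int) \<Rightarrow> int \<Rightarrow> int" where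
  "slide S t i T b =
     (if b t = i then b(i := T)
      else (\<lambda>p. if p \<in> insert i (over S b i) - {t} then b (Max {c \<in> over S b i. c < p}) else b p))"

text \<open>Here \<open>i\<close> stands for the nearer of the two ends belonging to the first start
  \<open>t\<close>. The assumptions about \<open>b\<close> hold for either of the two arc systems,
  whether or not its own arc ends at \<open>i\<close>, so each lemma below can be applied to
  both.\<close>

locale moved =
  fixes S :: "int set" and t i T :: int and b :: "int \<Rightarrow> int"
  assumes fin: "finite S" and nc: "noncrossing S b" and tS: "t \<in> S"
    and t_min: "p \<in> S \<Longrightarrow> t \<le> p" and ends: "p \<in> S \<Longrightarrow> b p < T"
    and ti: "t < i" and i_le: "i \<le> b t" and iS: "i \<notin> S" and i_end: "p \<in> S \<Longrightarrow> b p = i \<Longrightarrow> p = t"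
begin

abbreviation S' where "S' \<equiv> insert i (S - {t})"
abbreviation b' where "b' \<equiv> slide S t i T b"

lemma i_T: "i < T" using i_le ends[OF tS] by simp

lemma finite_over[simp]: "finite (over S b r)" using fin by (simp add: over_def)
lemma finite_upto_over[simp]: "finite (upto_over S b r)" using fin by (simp add: upto_over_def)

lemma inside_end: "p \<in> S \<Longrightarrow> p \<noteq> t \<Longrightarrow> p < i \<Longrightarrow> b t = i \<Longrightarrow> b p < i"
  using noncrossing_nested[OF nc tS, of p] t_min[of p] by auto

lemma slide_hit: "b t = i \<Longrightarrow> b' = b(i := T)" by (simp add: slide_def)

abbreviation "pr p \<equiv> Max {c \<in> over S b i. c < p}"

lemma slide_slid: "i < b t \<Longrightarrow> b' p = (if p \<in> insert i (over S b i) - {t} then b (pr p) else b p)"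
  by (simp add: slide_def)

lemma t_over: "i < b t \<Longrightarrow> t \<in> over S b i" using tS ti by (simp add: over_def)

lemma pr_props:
  assumes "i < b t" "p \<in> insert i (over S b i) - {t}"
  shows "pr p \<in> over S b i" "pr p < p" "\<And>c. c \<in> over S b i \<Longrightarrow> c < p \<Longrightarrow> c \<le> pr p"
proof -
  have f: "finite {c \<in> over S b i. c < p}" by simp
  have "t \<in> {c \<in> over S b i. c < p}"
    using t_over[OF assms(1)] assms(2) ti t_min[of p] by (auto simp: over_def)
  then have "pr p \<in> {c \<in> over S b i. c < p}" using Max_in[OF f] by blast
  then show "pr p \<in> over S b i" "pr p < p" by auto
  show "c \<le> pr p" if "c \<in> over S b i" "c < p" for c using Max_ge[OF f, of c] that by simp
qed

lemma pr_Max: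
  assumes "i < b t" "p \<in> insert i (over S b i) - {t}" "c \<in> over S b i" "c < p"
    "\<And>c'. c' \<in> over S b i \<Longrightarrow> c' < p \<Longrightarrow> c' \<le> c"
  shows "pr p = c"
  using pr_props[OF assms(1,2)] assms(3-5) by (meson order_antisym)

lemma slide_beyond: "i < b t \<Longrightarrow> p \<in> insert i (over S b i) - {t} \<Longrightarrow> i < b' p"
  using pr_props[of p] by (simp add: slide_slid over_def)

lemma slide_eq: "p \<in> S \<Longrightarrow> p \<notin> over S b i \<Longrightarrow> b' p = b p"
  using iS by (auto simp: slide_def)

lemma slide_in: assumes "p \<in> S'" shows "b' p \<in> insert T (b ` S)"
proof (cases "b t = i")
  case True then show ?thesis using assms by (auto simp: slide_hit)
next
  case False
  then show ?thesis using assms pr_props(1)[of p] i_le ti by (auto simp: slide_slid over_def)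
qed

lemma not_over_less: "p \<in> S \<Longrightarrow> p \<noteq> t \<Longrightarrow> p < i \<Longrightarrow> p \<notin> over S b i \<Longrightarrow> b p < i"
  using i_end[of p] by (force simp: over_def)

text \<open>In the slid case the arcs over \<open>i\<close> form a nested chain whose ends move one
  start inward, \<open>i\<close> being the new innermost start, so the chain stays nested. An
  unchanged arc inside the new arc of \<open>p\<close> was already inside the old arc of
  \<open>pr p\<close>; an unchanged arc that starts before \<open>i\<close> at a start other than
  \<open>t\<close> ends before \<open>i\<close>.\<close>

lemma noncrossing_slide: "noncrossing S' b'"
proof (cases "b t = i")
  case True
  show ?thesis unfolding noncrossing_def
  proof (intro ballI conjI impI)
    fix p assume p: "p \<in> S'"
    show "p < b' p" using p True noncrossing_less[OF nc, of p] i_T by (auto simp: slide_hit)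
    fix p' assume p': "p' \<in> S'" "p < p'" "p' \<le> b' p"
    show "b' p' < b' p"
      using p p' True noncrossing_nested[OF nc, of p p'] ends[of p'] inside_end[of p] iS
      by (auto simp: slide_hit split: if_splits)
  qed
next
  case False
  then have lt: "i < b t" using i_le by simp
  note sl = slide_slid[OF lt]
  show ?thesis unfolding noncrossing_def
  proof (intro ballI conjI impI)
    fix p assume p: "p \<in> S'"
    show "p < b' p"
    proof (cases "p \<in> insert i (over S b i) - {t}")
      case True
      then have "p \<le> i" by (auto simp: over_def)
      then show ?thesis using slide_beyond[OF lt True] by simp
    next
      case False
      then show ?thesis using p sl ti noncrossing_less[OF nc, of p] by auto
    qed
    fix p' assume p': "p' \<in> S'" "p < p'" "p' \<le> b' p"
    show "b' p' < b' p"
    proof (cases "p \<in> insert i (over S b i) - {t}")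
      case C: True
      show ?thesis
      proof (cases "p' \<in> insert i (over S b i) - {t}")
        case C': True
        have "p \<in> over S b i" using C C' p' by (auto simp: over_def)
        then have "pr p < pr p'" using pr_props(3)[OF lt C', of p] pr_props(2)[OF lt C] p' by linarith
        moreover have "pr p' < i" "i < b (pr p)" "pr p \<in> S" "pr p' \<in> S"
          using pr_props(1)[OF lt C'] pr_props(1)[OF lt C] by (auto simp: over_def)
        ultimately have "b (pr p') < b (pr p)" using noncrossing_nested[OF nc, of "pr p" "pr p'"] by simp
        then show ?thesis using C C' sl by simp
      next
        case C': False
        have "p' \<in> S" "pr p \<in> S" using p' C' ti pr_props(1)[OF lt C] by (auto simp: over_def)
        moreover have "pr p < p'" "p' \<le> b (pr p)" using pr_props(2)[OF lt C] p' C sl by auto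
        ultimately have "b p' < b (pr p)" using noncrossing_nested[OF nc, of "pr p" p'] by simp
        then show ?thesis using C C' sl by auto
      qed
    next
      case C: False
      then have pS: "p \<in> S" "p \<noteq> t" "b' p = b p" "p \<noteq> i" using p sl ti by auto
      show ?thesis
      proof (cases "p' \<in> insert i (over S b i) - {t}")
        case C': True
        then have "p' \<le> i" by (auto simp: over_def)
        then have "p < i" using p' by simp
        then have bi: "b p < i" using not_over_less[of p] pS C by auto
        then have "p' \<noteq> i" using p' pS by auto
        then have "p' \<in> S" "i < b p'" using C' by (auto simp: over_def)
        then have "b p' < b p" using noncrossing_nested[OF nc, of p p'] p' pS by auto
        then show ?thesis using bi \<open>i < b p'\<close> by simp
      next
        case C': False
        then show ?thesis using noncrossing_nested[OF nc, of p p'] p' pS sl ti by auto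
      qed
    qed
  qed
qed

subsection \<open>Arcs over a point inside the moved arc\<close>

text \<open>Sliding only replaces ends from \<open>i\<close> on by ends beyond \<open>i\<close>, so
  for \<open>r\<close> before \<open>i\<close> it cannot change whether a remaining arc passes over
  \<open>r\<close>.\<close>

lemma over_inside:
  assumes r: "t < r" "r < i"
  shows "over S' b' r = over S b r - {t}" "upto_over S' b' r = upto_over S b r - {t}"
    "t \<in> over S b r" "t \<in> upto_over S b r"
proof -
  have "r < b' p \<longleftrightarrow> r < b p" "r \<le> b' p \<longleftrightarrow> r \<le> b p" if "p \<in> S" "p \<noteq> t" for p
  proof -
    have "(i < b p \<and> i < b' p) \<or> b' p = b p"
    proof (cases "p \<in> over S b i")
      case True
      then show ?thesis using slide_beyond[of p] inside_end[of p] that i_le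
        by (cases "b t = i") (auto simp: over_def)
    qed (use that slide_eq in auto)
    then show "r < b' p \<longleftrightarrow> r < b p" "r \<le> b' p \<longleftrightarrow> r \<le> b p" using r by auto
  qed
  then show "over S' b' r = over S b r - {t}" "upto_over S' b' r = upto_over S b r - {t}"
    using r by (auto simp: over_def upto_over_def)
  show "t \<in> over S b r" "t \<in> upto_over S b r" using r tS i_le by (auto simp: over_def upto_over_def)
qed

text \<open>The innermost arc that passes over both \<open>r\<close> and \<open>i\<close> hands its
  end to a start that is not before \<open>r\<close>. By nesting, this end is the smallest one from
  \<open>i\<close> on, and it is the only end that gets lost.\<close>

lemma ends_over_inside:
  assumes r: "t < r" "r < i"
  shows "{y \<in> b ` over S b r. i \<le> y} \<noteq> {}"
    "b' ` over S' b' r = b ` over S b r - {Min {y \<in> b ` over S b r. i \<le> y}}"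
proof -
  have t: "t \<in> over S b r" using over_inside[OF r] by simp
  then show "{y \<in> b ` over S b r. i \<le> y} \<noteq> {}" using i_le by auto
  have inj: "inj_on b S" by (rule noncrossing_inj_on[OF nc])
  show "b' ` over S' b' r = b ` over S b r - {Min {y \<in> b ` over S b r. i \<le> y}}"
  proof (cases "b t = i")
    case True
    have "Min {y \<in> b ` over S b r. i \<le> y} = i"
      using True t by (intro Min_eqI) auto
    moreover have "b' ` (over S b r - {t}) = b ` (over S b r - {t})"
      by (rule image_cong) (use True iS in \<open>auto simp: slide_hit over_def\<close>)
    moreover have "b ` (over S b r - {t}) = b ` over S b r - {i}"
      using inj True tS by (auto simp: over_def inj_on_def)
    ultimately show ?thesis using over_inside[OF r] by simp
  next
    case False
    then have lt: "i < b t" using i_le by simp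
    \<comment> \<open>The arc from \<open>m\<close> is the innermost one over \<open>i\<close> that
      starts before \<open>r\<close>; its end is the one lost over \<open>r\<close>.\<close>
    define m where "m = Max {c \<in> over S b i. c < r}"
    have f: "finite {c \<in> over S b i. c < r}" by simp
    have "m \<in> {c \<in> over S b i. c < r}" unfolding m_def
      using t_over[OF lt] r by (intro Max_in) auto
    then have m: "m \<in> over S b i" "m < r" by auto
    have m_ge: "c \<le> m" if "c \<in> over S b i" "c < r" for c using Max_ge[OF f, of c] that by (simp add: m_def)
    have mS: "m \<in> S" and mr: "m \<in> over S b r" and im: "i < b m" using m r by (auto simp: over_def)
    have Min: "Min {y \<in> b ` over S b r. i \<le> y} = b m"
    proof (rule Min_eqI)
      show "b m \<in> {y \<in> b ` over S b r. i \<le> y}" using mr im by auto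
      fix y assume "y \<in> {y \<in> b ` over S b r. i \<le> y}"
      then obtain c where c: "y = b c" "c \<in> over S b r" "i \<le> b c" by auto
      then have "c \<in> S" "c < r" by (auto simp: over_def)
      then have "i < b c" using c i_end[of c] lt by (metis order.not_eq_order_implies_strict less_irrefl)
      then have "c \<in> over S b i" using \<open>c < r\<close> r \<open>c \<in> S\<close> by (auto simp: over_def)
      then have "c \<le> m" using m_ge \<open>c < r\<close> by simp
      then show "b m \<le> y" using noncrossing_nested[OF nc \<open>c \<in> S\<close> mS] c m r by (cases "c = m") auto
    qed simp
    have "b' ` (over S b r - {t}) = b ` (over S b r - {m})"
    proof (intro Set.set_eqI iffI)
      fix y assume "y \<in> b' ` (over S b r - {t})"
      then obtain p where p: "p \<in> over S b r" "p \<noteq> t" "y = b' p" by auto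
      then have pS: "p \<in> S" "p < r" by (auto simp: over_def)
      show "y \<in> b ` (over S b r - {m})"
      proof (cases "p \<in> over S b i")
        case True
        then have C: "p \<in> insert i (over S b i) - {t}" using p by simp
        have "y = b (pr p)" using p C slide_slid[OF lt] by simp
        moreover have "pr p \<in> over S b r" using pr_props[OF lt C] pS r by (auto simp: over_def)
        moreover have "pr p \<noteq> m" using pr_props[OF lt C] m_ge[OF True] pS by auto
        ultimately show ?thesis by auto
      next
        case False
        then show ?thesis using p pS slide_eq[of p] m(1) by (intro image_eqI[of _ _ p]) auto
      qed
    next
      fix y assume "y \<in> b ` (over S b r - {m})"
      then obtain c where c: "c \<in> over S b r" "c \<noteq> m" "y = b c" by auto
      then have cS: "c \<in> S" "c < r" by (auto simp: over_def)
      show "y \<in> b' ` (over S b r - {t})"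
      proof (cases "c \<in> over S b i")
        case True
        have cm: "c < m" using m_ge[OF True] cS c by auto
        define p where "p = Min {p \<in> over S b i. c < p}"
        have f: "finite {p \<in> over S b i. c < p}" by simp
        have "p \<in> {p \<in> over S b i. c < p}" unfolding p_def using m(1) cm by (intro Min_in) auto
        then have p: "p \<in> over S b i" "c < p" by auto
        have p_le: "p \<le> p'" if "p' \<in> over S b i" "c < p'" for p'
          using Min_le[OF f, of p'] that by (simp add: p_def)
        have "p \<noteq> t" using p t_min[OF cS(1)] by auto
        then have C: "p \<in> insert i (over S b i) - {t}" using p by simp
        have "pr p = c" using p p_le by (intro pr_Max[OF lt C True]) (auto simp: not_less[symmetric])
        then have "b' p = y" using slide_slid[OF lt] C c by simp
        moreover have "p \<in> over S b r" using p_le[OF m(1) cm] m p r by (auto simp: over_def)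
        ultimately show ?thesis using \<open>p \<noteq> t\<close> by auto
      next
        case False
        then show ?thesis using c cS slide_eq[of c] t_over[OF lt] by (intro image_eqI[of _ _ c]) auto
      qed
    qed
    also have "\<dots> = b ` over S b r - {b m}"
      using inj mS by (auto simp: over_def inj_on_def)
    finally show ?thesis using over_inside[OF r] Min by simp
  qed
qed

subsection \<open>Arcs over a point outside the moved arc\<close>

lemma over_outside_hit:
  assumes "b t = i" "i < r"
  shows "r < T \<Longrightarrow> over S' b' r = insert i (over S b r)" "r \<le> T \<Longrightarrow> upto_over S' b' r = insert i (upto_over S b r)"
    "r < T \<Longrightarrow> b' ` over S' b' r = insert T (b ` over S b r)"
proof -
  have t: "t \<notin> over S b r" "t \<notin> upto_over S b r" using assms by (auto simp: over_def upto_over_def)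
  show 1: "over S' b' r = insert i (over S b r)" if "r < T"
    using assms iS that t by (auto simp: over_def slide_hit)
  show "upto_over S' b' r = insert i (upto_over S b r)" if "r \<le> T"
    using assms iS that t by (auto simp: upto_over_def slide_hit)
  have "b' ` over S b r = b ` over S b r"
    by (rule image_cong) (use assms iS in \<open>auto simp: slide_hit over_def\<close>)
  then show "b' ` over S' b' r = insert T (b ` over S b r)" if "r < T"
    unfolding 1[OF that] image_insert using assms by (simp add: slide_hit)
qed

lemma outside_hit_greater:
  assumes "b t = i" "i < r"
  shows "x \<in> over S b r \<Longrightarrow> i < x" "x \<in> upto_over S b r \<Longrightarrow> i < x"
proof -
  have "x \<in> S \<Longrightarrow> r \<le> b x \<Longrightarrow> i < x"
    using assms inside_end[of x] iS by (cases "x = t"; cases x i rule: linorder_cases) auto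
  then show "x \<in> over S b r \<Longrightarrow> i < x" "x \<in> upto_over S b r \<Longrightarrow> i < x"
    by (auto simp: over_def upto_over_def)
qed

lemma beyond_outside:
  assumes "i < r"
  shows "{x \<in> over S' b' r. i < x} = {x \<in> over S b r. i < x}"
    "{x \<in> upto_over S' b' r. i < x} = {x \<in> upto_over S b r. i < x}"
proof -
  have "b' p = b p" if "p \<in> S" "i < p" for p using slide_eq[of p] that by (auto simp: over_def)
  then show "{x \<in> over S' b' r. i < x} = {x \<in> over S b r. i < x}"
    "{x \<in> upto_over S' b' r. i < x} = {x \<in> upto_over S b r. i < x}"
    using ti by (auto simp: over_def upto_over_def)
qed

text \<open>Ends change hands only among starts up to \<open>i\<close>, all of them before
  \<open>r\<close>. So an end beyond \<open>r\<close> may get a new owner but still belongs to an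
  arc over \<open>r\<close>.\<close>

lemma slide_image:
  assumes lt: "i < b t" and "i < r"
  shows "b' ` {p \<in> S'. p < r \<and> r < b' p} = b ` {p \<in> S. p < r \<and> r < b p}"
proof (intro Set.set_eqI iffI)
  fix y assume "y \<in> b' ` {p \<in> S'. p < r \<and> r < b' p}"
  then obtain p where p: "p \<in> S'" "p < r" "r < y" "y = b' p" by auto
  show "y \<in> b ` {p \<in> S. p < r \<and> r < b p}"
  proof (cases "p \<in> insert i (over S b i) - {t}")
    case True
    then have "y = b (pr p)" using slide_slid[OF lt] p by simp
    then show ?thesis using pr_props[OF lt True] p by (intro image_eqI[of _ _ "pr p"]) (auto simp: over_def)
  next
    case False
    then show ?thesis using p ti slide_slid[OF lt, of p] by auto
  qed
next
  fix y assume "y \<in> b ` {p \<in> S. p < r \<and> r < b p}"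
  then obtain c where c: "c \<in> S" "c < r" "r < y" "y = b c" by auto
  show "y \<in> b' ` {p \<in> S'. p < r \<and> r < b' p}"
  proof (cases "c \<in> over S b i")
    case True
    define p where "p = Min {p \<in> insert i (over S b i). c < p}"
    have f: "finite {p \<in> insert i (over S b i). c < p}" by simp
    have "p \<in> {p \<in> insert i (over S b i). c < p}" unfolding p_def
      using True by (intro Min_in[OF f]) (auto simp: over_def)
    then have p: "p \<in> insert i (over S b i)" "c < p" by auto
    have p_le: "p \<le> p'" if "p' \<in> over S b i" "c < p'" for p'
      using Min_le[OF f, of p'] that by (simp add: p_def)
    have "p \<noteq> t" using p t_min[OF c(1)] by auto
    then have C: "p \<in> insert i (over S b i) - {t}" using p by simp
    have "pr p = c" using p p_le by (intro pr_Max[OF lt C True]) (auto simp: not_less[symmetric])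
    then have "b' p = y" using slide_slid[OF lt] C c by simp
    moreover have "p \<in> S'" "p < r" using p \<open>i < r\<close> \<open>p \<noteq> t\<close> by (auto simp: over_def)
    ultimately show ?thesis using c by (intro image_eqI[of _ _ p]) auto
  next
    case False
    then show ?thesis using c slide_eq[of c] t_over[OF lt] by (intro image_eqI[of _ _ c]) auto
  qed
qed

lemma ends_over_outside_slid: "i < b t \<Longrightarrow> i < r \<Longrightarrow> b' ` over S' b' r = b ` over S b r"
  using slide_image by (simp add: over_def)

text \<open>Among the nested arcs over \<open>i\<close>, those that reach \<open>r\<close> are the
  outermost ones, beginning with the arc of \<open>t\<close>. When every end moves one start inward,
  this initial segment loses \<open>t\<close> and gains the next start inward, which may be
  \<open>i\<close> itself. If the arc of \<open>t\<close> does not reach \<open>r\<close>, none of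
  them does.\<close>

lemma upto_over_outside_slid:
  assumes lt: "i < b t" and r: "i < r"
  shows "(upto_over S' b' r = upto_over S b r \<and> (\<forall>x\<in>upto_over S b r. i < x)) \<or>
    (t \<in> upto_over S b r \<and> (\<exists>c\<le>i. c \<notin> upto_over S b r \<and>
      (\<forall>x\<in>upto_over S b r. x \<le> i \<longrightarrow> x < c) \<and>
      upto_over S' b' r = insert c (upto_over S b r - {t})))"
proof (cases "r \<le> b t")
  case False
  have "b p < r" if "p \<in> S" "p \<le> i" for p
    using noncrossing_nested[OF nc tS, of p] that t_min[of p] i_le False by (cases "p = t") auto
  then have 1: "\<forall>x\<in>upto_over S b r. i < x" by (force simp: upto_over_def)
  have "b' p < r" if p: "p \<in> S'" "p \<le> i" for p
  proof (cases "p \<in> insert i (over S b i) - {t}")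
    case True
    have "pr p \<in> S" "pr p \<le> i" using pr_props(1)[OF lt True] by (auto simp: over_def)
    then show ?thesis using slide_slid[OF lt] True \<open>\<And>p. p \<in> S \<Longrightarrow> p \<le> i \<Longrightarrow> b p < r\<close> by simp
  next
    case False
    then show ?thesis using ti slide_slid[OF lt] p \<open>\<And>p. p \<in> S \<Longrightarrow> p \<le> i \<Longrightarrow> b p < r\<close> by auto
  qed
  then have "\<forall>x\<in>upto_over S' b' r. i < x" by (force simp: upto_over_def)
  then show ?thesis using 1 beyond_outside(2)[OF r] by blast
next
  case True
  \<comment> \<open>The outer part of the chain over \<open>i\<close>: the arcs that reach
    \<open>r\<close>.\<close>
  define D where "D = {c \<in> over S b i. r \<le> b c}"
  have tD: "t \<in> D" using True t_over[OF lt] by (simp add: D_def)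
  define m where "m = Max D"
  have fD: "finite D" by (simp add: D_def)
  have mD: "m \<in> D" unfolding m_def using fD tD by (intro Max_in) auto
  have m_ge: "c \<le> m" if "c \<in> D" for c using fD that by (simp add: m_def)
  have DS: "c \<in> S" "c < i" "i < b c" "r \<le> b c" "c \<in> over S b i" if "c \<in> D" for c
    using that by (auto simp: D_def over_def)
  have down: "c' \<in> D" if "c \<in> D" "c' \<in> over S b i" "c' \<le> c" for c c'
  proof -
    have "b c \<le> b c'" using noncrossing_nested[OF nc, of c' c] that DS[OF that(1)]
      by (cases "c = c'") (auto simp: over_def)
    then show ?thesis using that DS[OF that(1)] by (simp add: D_def)
  qed
  \<comment> \<open>The first start of the chain inward from \<open>D\<close>, or \<open>i\<close>
    if there is none; it inherits the end of the innermost arc in \<open>D\<close>.\<close>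
  define c where "c = Min {p \<in> insert i (over S b i). m < p}"
  have f: "finite {p \<in> insert i (over S b i). m < p}" by simp
  have "c \<in> {p \<in> insert i (over S b i). m < p}" unfolding c_def
    using DS(2)[OF mD] by (intro Min_in) auto
  then have c: "c \<in> insert i (over S b i)" "m < c" by auto
  have c_le: "c \<le> p'" if "p' \<in> insert i (over S b i)" "m < p'" for p'
    using Min_le[OF f, of p'] that by (simp add: c_def)
  have "c \<noteq> t" using c m_ge[OF tD] by auto
  then have C: "c \<in> insert i (over S b i) - {t}" using c by simp
  have prc: "pr c = m" using c c_le DS(5)[OF mD]
    by (intro pr_Max[OF lt C]) (auto simp: not_less[symmetric])
  have c_le_i: "c \<le> i" using c by (auto simp: over_def)
  have L: "x \<le> i \<Longrightarrow> x \<in> upto_over S b r \<longleftrightarrow> x \<in> D" for x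
    using r iS by (auto simp: upto_over_def D_def over_def order_less_le)
  have L': "x \<in> upto_over S' b' r \<longleftrightarrow> x = c \<or> x \<in> D - {t}" if "x \<le> i" for x
  proof (cases "x \<in> insert i (over S b i) - {t}")
    case X: True
    have "x \<in> upto_over S' b' r \<longleftrightarrow> r \<le> b (pr x)"
      using X that r slide_slid[OF lt, of x] by (auto simp: upto_over_def over_def)
    also have "\<dots> \<longleftrightarrow> pr x \<in> D" using pr_props(1)[OF lt X] by (simp add: D_def)
    also have "\<dots> \<longleftrightarrow> x = c \<or> x \<in> D"
    proof
      assume p: "pr x \<in> D"
      show "x = c \<or> x \<in> D"
      proof (rule ccontr)
        assume n: "\<not> (x = c \<or> x \<in> D)"
        have "m < x"
        proof (rule ccontr)
          assume "\<not> m < x"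
          then have "x \<noteq> i" using DS(2)[OF mD] by auto
          then show False using down[OF mD, of x] X n \<open>\<not> m < x\<close> by auto
        qed
        then have "c < x" using c_le[of x] X n by auto
        then have "c \<in> over S b i" using c that by auto
        then have "c \<le> pr x" using pr_props(3)[OF lt X] \<open>c < x\<close> by simp
        then show False using m_ge[OF p] c by simp
      qed
    next
      assume "x = c \<or> x \<in> D"
      then show "pr x \<in> D"
      proof
        assume "x \<in> D"
        then show ?thesis using down[of x "pr x"] pr_props(1,2)[OF lt X] by simp
      qed (use prc mD in simp)
    qed
    finally show ?thesis using X by auto
  next
    case X: False
    then have "x \<notin> D - {t}" "x \<noteq> c" using DS(5) C by auto
    moreover have "x \<notin> upto_over S' b' r"
    proof
      assume x: "x \<in> upto_over S' b' r"
      then have "x \<in> S" "x \<noteq> t" "x \<noteq> i" "r \<le> b x" "x \<notin> over S b i"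
        using X ti slide_slid[OF lt, of x] by (auto simp: upto_over_def)
      then show False using not_over_less[of x] that r by simp
    qed
    ultimately show ?thesis by auto
  qed
  have "upto_over S' b' r = insert c (upto_over S b r - {t})"
  proof (rule Set.set_eqI)
    fix x show "x \<in> upto_over S' b' r \<longleftrightarrow> x \<in> insert c (upto_over S b r - {t})"
      using L[of x] L'[of x] beyond_outside(2)[OF r] c_le_i ti by (cases "x \<le> i") (auto simp: not_le)
  qed
  moreover have "t \<in> upto_over S b r" using L[of t] tD ti by simp
  moreover have "c \<notin> upto_over S b r" using L[OF c_le_i] c m_ge by force
  moreover have "\<forall>x\<in>upto_over S b r. x \<le> i \<longrightarrow> x < c" using L m_ge c by force
  ultimately show ?thesis using c_le_i by blast
qed

lemma over_at_hit:
  assumes "b t = i" shows "upto_over S b i = {t}" "over S b i = {}"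
  using inside_end assms tS ti by (force simp: upto_over_def over_def)+

end

section \<open>Trips and their invariance under one move\<close>

lemma asc_remove:
  assumes "finite Y" "{y \<in> Y. i \<le> y} \<noteq> {}"
  defines "m \<equiv> Min {y \<in> Y. i \<le> (y::int)}"
  shows "asc Y = asc {y \<in> Y. y < i} @ m # asc ({y \<in> Y. i \<le> y} - {m})"
    "asc (Y - {m}) = asc {y \<in> Y. y < i} @ asc ({y \<in> Y. i \<le> y} - {m})"
    "m \<in> Y" "i \<le> m"
proof -
  have f: "finite {y \<in> Y. i \<le> y}" using assms by simp
  have m: "m \<in> {y \<in> Y. i \<le> y}" unfolding m_def by (rule Min_in[OF f assms(2)])
  then show "m \<in> Y" "i \<le> m" by auto
  have le: "m \<le> x" if "x \<in> {y \<in> Y. i \<le> y}" for x using f that by (simp add: m_def)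
  have "{y \<in> Y. y < i} \<union> {y \<in> Y. i \<le> y} = Y" by auto
  moreover have "asc ({y \<in> Y. y < i} \<union> {y \<in> Y. i \<le> y}) = asc {y \<in> Y. y < i} @ asc {y \<in> Y. i \<le> y}"
    by (rule asc_Un) (use assms(1) in auto)
  ultimately have "asc Y = asc {y \<in> Y. y < i} @ asc {y \<in> Y. i \<le> y}" by simp
  then show "asc Y = asc {y \<in> Y. y < i} @ m # asc ({y \<in> Y. i \<le> y} - {m})"
    using asc_min[OF f m le] by simp
  have "{y \<in> Y. y < i} \<union> ({y \<in> Y. i \<le> y} - {m}) = Y - {m}" using m by auto
  moreover have "asc ({y \<in> Y. y < i} \<union> ({y \<in> Y. i \<le> y} - {m})) = asc {y \<in> Y. y < i} @ asc ({y \<in> Y. i \<le> y} - {m})"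
    by (rule asc_Un) (use assms(1) in auto)
  ultimately show "asc (Y - {m}) = asc {y \<in> Y. y < i} @ asc ({y \<in> Y. i \<le> y} - {m})" by simp
qed

lemma asc_cut: "finite Y \<Longrightarrow> asc Y = asc {y \<in> Y. y \<le> i} @ asc {y \<in> Y. (i::int) < y}"
proof -
  assume f: "finite Y"
  have "{y \<in> Y. y \<le> i} \<union> {y \<in> Y. i < y} = Y" by auto
  moreover have "asc ({y \<in> Y. y \<le> i} \<union> {y \<in> Y. i < y}) = asc {y \<in> Y. y \<le> i} @ asc {y \<in> Y. i < y}"
    by (rule asc_Un) (use f in auto)
  ultimately show ?thesis by simp
qed

text \<open>
  The trip through the arc diagram that starts at the end \<open>r\<close> of a \<open>b\<close>-arc and turns at every
  crossing: it runs down the innermost \<open>b\<close>-arc, up the first \<open>g\<close>-arc that it meets, and so on.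
  Only arcs over \<open>r\<close> are used. Arriving at a start \<open>l\<close> counts as arriving at \<open>l + M\<close>.
\<close>

definition trip :: "int \<Rightarrow> int set \<Rightarrow> (int \<Rightarrow> int) \<Rightarrow> (int \<Rightarrow> int) \<Rightarrow> int \<Rightarrow> int" where
  "trip M S b g r =
     zig M (desc (upto_over S b r)) (asc (b ` over S b r)) (desc (over S g r)) (asc (g ` over S g r))"

lemma card_upto_over:
  assumes "finite S" "noncrossing S b" "r \<in> b ` S"
  shows "card (upto_over S b r) = Suc (card (over S b r))" "card (b ` over S b r) = card (over S b r)"
proof -
  obtain p where p: "p \<in> S" "r = b p" using assms by auto
  have "upto_over S b r = insert p (over S b r)"
    using p noncrossing_less[OF assms(2)] noncrossing_inj[OF assms(2)]
    by (auto simp: upto_over_def over_def order_le_less)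
  moreover have "p \<notin> over S b r" "finite (over S b r)" using p assms by (auto simp: over_def)
  ultimately show "card (upto_over S b r) = Suc (card (over S b r))" by simp
  show "card (b ` over S b r) = card (over S b r)"
    using noncrossing_inj_on[OF assms(2)] by (intro card_image) (auto simp: over_def inj_on_def)
qed

lemma card_ends_over:
  assumes "finite S" "noncrossing S b"
  shows "card (b ` over S b r) = card (over S b r)"
  using noncrossing_inj_on[OF assms(2)] by (intro card_image) (auto simp: over_def inj_on_def)

text \<open>Treats trips that begin in a system whose arc from \<open>t\<close> ends at
  \<open>i\<close>, whatever happens in the other one. Before \<open>i\<close> both systems lose
  \<open>t\<close> and one end; beyond \<open>i\<close> the first gains an outermost arc from
  \<open>i\<close> to \<open>t + M\<close>, and the other changes only in starts up to
  \<open>i\<close> and in a possible last end.\<close>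

lemma trip_hit:
  assumes mb: "moved S t i (t + M) b" and mg: "moved S t i (t + M) g"
    and hit: "b t = i" and r: "r \<in> b ` S" "r \<noteq> i"
  shows "trip M (insert i (S - {t})) (slide S t i (t + M) b) (slide S t i (t + M) g) r = trip M S b g r"
proof -
  interpret B: moved S t i "t + M" b by (rule mb)
  interpret G: moved S t i "t + M" g by (rule mg)
  note cb = card_upto_over[OF B.fin B.nc r(1)]
  note cg = card_ends_over[OF G.fin G.nc, of r]
  obtain p0 where p0: "p0 \<in> S" "r = b p0" using r by auto
  have tr: "t < r" and rT: "r < t + M"
    using p0 B.t_min[of p0] noncrossing_less[OF B.nc, of p0] B.ends[of p0] by auto
  have finb: "finite (b ` over S b r)" and fing: "finite (g ` over S g r)" by auto
  show ?thesis
  proof (cases "r < i")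
    case True
    note inb = B.over_inside[OF tr True] B.ends_over_inside[OF tr True]
    note ing = G.over_inside[OF tr True] G.ends_over_inside[OF tr True]
    have le_i: "y \<le> i" if "y \<in> b ` over S b r" for y
      using that B.inside_end[OF _ _ _ hit] hit True by (force simp: over_def)
    have iP: "i \<in> b ` over S b r" using inb(3) hit by auto
    have "Min {y \<in> b ` over S b r. i \<le> y} = i" using iP finb by (intro Min_eqI) auto
    note P' = inb(6)[unfolded this]
    let ?m = "Min {y \<in> g ` over S g r. i \<le> y}"
    note Y = asc_remove[OF fing ing(5)]
    have "upto_over S b r - {t} \<noteq> {}"
      using p0 r tr True hit noncrossing_less[OF B.nc p0(1)] by (auto simp: upto_over_def)
    moreover have cL: "card (upto_over S b r - {t}) = Suc (card (b ` over S b r - {i}))"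
    proof -
      have "card (over S b r) > 0" using inb(3) by (auto simp: card_gt_0_iff)
      then show ?thesis using cb inb(4) iP by simp
    qed
    moreover have "length (asc (g ` over S g r)) = card (over S g r)" using cg by simp
    then have "card (over S g r - {t}) = card {y \<in> g ` over S g r. y < i} + card ({y \<in> g ` over S g r. i \<le> y} - {?m})"
      using ing(3) unfolding Y(1) by simp
    moreover have "\<forall>l\<in>upto_over S b r - {t}. t < l" "\<forall>x\<in>over S g r - {t}. t < x"
      using B.t_min by (force simp: upto_over_def over_def order_le_less)+
    moreover have "\<forall>p\<in>b ` over S b r - {i}. p < i" using le_i by (force simp: order_le_less)
    ultimately have "zig M (desc (upto_over S b r - {t}) @ [t]) (asc (b ` over S b r - {i}) @ [i])
        (desc (over S g r - {t}) @ [t]) (asc {y \<in> g ` over S g r. y < i} @ ?m # asc ({y \<in> g ` over S g r. i \<le> y} - {?m}))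
      = zig M (desc (upto_over S b r - {t})) (asc (b ` over S b r - {i}))
        (desc (over S g r - {t})) (asc {y \<in> g ` over S g r. y < i} @ asc ({y \<in> g ` over S g r. i \<le> y} - {?m}))"
      using Y(4) by (intro zig_inside_hit) auto
    moreover have "asc (upto_over S b r) = t # asc (upto_over S b r - {t})"
      using inb(4) B.t_min by (intro asc_min) (auto simp: upto_over_def B.fin)
    moreover have "asc (over S g r) = t # asc (over S g r - {t})"
      using ing(3) B.t_min by (intro asc_min) (auto simp: over_def B.fin)
    moreover have "asc (b ` over S b r) = asc (b ` over S b r - {i}) @ [i]"
      using iP le_i finb by (intro asc_max)
    ultimately show ?thesis unfolding trip_def P' ing(6) unfolding inb(2) ing(1) Y(2) Y(1) by simp
  next
    case False
    then have ir: "i < r" using r by simp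
    note o = B.over_outside_hit[OF hit ir] B.outside_hit_greater[OF hit ir]
    have b': "upto_over B.S' B.b' r = insert i (upto_over S b r)" "B.b' ` over B.S' B.b' r = insert (t + M) (b ` over S b r)"
      using o rT by auto
    have TY: "\<forall>y\<in>b ` over S b r. y < t + M" "\<forall>y\<in>g ` over S g r. y < t + M"
      using B.ends G.ends by (auto simp: over_def)
    \<comment> \<open>\<open>Y3\<close> is \<open>[t + M]\<close> if the arc of \<open>g\<close>
      also ends at \<open>i\<close>, and empty otherwise.\<close>
    obtain Y3 where Y3: "asc (G.b' ` over B.S' G.b' r) = asc (g ` over S g r) @ Y3"
    proof (cases "g t = i")
      case True
      have "asc (insert (t + M) (g ` over S g r)) = asc (g ` over S g r) @ [t + M]"
        using TY by (intro asc_insert_max) auto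
      then show ?thesis using that G.over_outside_hit(3)[OF True ir rT] by simp
    next
      case False
      then show ?thesis using that[of "[]"] G.ends_over_outside_slid[OF _ ir] G.i_le by simp
    qed
    have finX': "finite (over B.S' G.b' r)" using G.fin by (simp add: over_def)
    have card': "card (over B.S' G.b' r) = card (over S g r) + length Y3"
      using arg_cong[OF Y3, of length] card_ends_over[OF _ G.noncrossing_slide, of r] G.fin cg by simp
    let ?X = "over S g r" and ?X' = "over B.S' G.b' r"
    have X: "desc ?X = desc {x \<in> ?X. i < x} @ desc {x \<in> ?X. x \<le> i}" using asc_cut[of ?X i] by simp
    have X': "desc ?X' = desc {x \<in> ?X. i < x} @ desc {x \<in> ?X'. x \<le> i}"
      using asc_cut[OF finX', of i] G.beyond_outside(1)[OF ir] by simp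
    have "zig M (desc (upto_over S b r) @ [i]) (asc (b ` over S b r) @ [t + M])
        (desc {x \<in> ?X. i < x} @ desc {x \<in> ?X'. x \<le> i}) (asc (g ` over S g r) @ Y3)
      = zig M (desc (upto_over S b r)) (asc (b ` over S b r))
        (desc {x \<in> ?X. i < x} @ desc {x \<in> ?X. x \<le> i}) (asc (g ` over S g r))"
    proof (rule zig_outside_hit)
      show "length (desc {x \<in> ?X. i < x}) + length (desc {x \<in> ?X. x \<le> i}) = length (asc (g ` over S g r))"
        using arg_cong[OF X, of length] cg by simp
      show "length (desc {x \<in> ?X. i < x}) + length (desc {x \<in> ?X'. x \<le> i}) = length (asc (g ` over S g r)) + length Y3"
        using arg_cong[OF X', of length] card' cg by simp
      show "desc (upto_over S b r) \<noteq> []" using cb by (auto simp: card_eq_0_iff)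
    qed (use cb TY o finX' in auto)
    moreover have "asc (insert i (upto_over S b r)) = i # asc (upto_over S b r)"
      using o by (intro asc_insert_min) auto
    moreover have "asc (insert (t + M) (b ` over S b r)) = asc (b ` over S b r) @ [t + M]"
      using TY by (intro asc_insert_max) auto
    ultimately show ?thesis unfolding trip_def b' Y3 X X' by simp
  qed
qed

text \<open>The remaining combination: the trip begins in the slid system while the other one is
  hit. Beyond \<open>i\<close>, the two cases are those of \<open>upto_over_outside_slid\<close>:
  either the new arc of \<open>g\<close> is never reached, or the starts up to \<open>i\<close>
  shift by one.\<close>

lemma trip_slid:
  assumes mb: "moved S t i (t + M) b" and mg: "moved S t i (t + M) g"
    and slid: "i < b t" and hit: "g t = i" and r: "r \<in> b ` S"
  shows "trip M (insert i (S - {t})) (slide S t i (t + M) b) (slide S t i (t + M) g) r = trip M S b g r"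
proof -
  interpret B: moved S t i "t + M" b by (rule mb)
  interpret G: moved S t i "t + M" g by (rule mg)
  note cb = card_upto_over[OF B.fin B.nc r(1)]
  note cg = card_ends_over[OF G.fin G.nc, of r]
  obtain p0 where p0: "p0 \<in> S" "r = b p0" using r by auto
  have ri: "r \<noteq> i" using p0 B.i_end[of p0] slid by auto
  have tr: "t < r" and rT: "r < t + M"
    using p0 B.t_min[of p0] noncrossing_less[OF B.nc, of p0] B.ends[of p0] by auto
  have finb: "finite (b ` over S b r)" and fing: "finite (g ` over S g r)" by auto
  have TY: "\<forall>y\<in>b ` over S b r. y < t + M" "\<forall>y\<in>g ` over S g r. y < t + M"
    using B.ends G.ends by (auto simp: over_def)
  show ?thesis
  proof (cases "r < i")
    case True
    note inb = B.over_inside[OF tr True] B.ends_over_inside[OF tr True]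
    note ing = G.over_inside[OF tr True] G.ends_over_inside[OF tr True]
    have le_i: "y \<le> i" if "y \<in> g ` over S g r" for y
      using that G.inside_end[OF _ _ _ hit] hit True by (force simp: over_def)
    have iY: "i \<in> g ` over S g r" using ing(3) hit by auto
    have "Min {y \<in> g ` over S g r. i \<le> y} = i" using iY fing by (intro Min_eqI) auto
    note Y' = ing(6)[unfolded this]
    let ?m = "Min {y \<in> b ` over S b r. i \<le> y}"
    note P = asc_remove[OF finb inb(5)]
    have iP: "i \<notin> b ` over S b r" using B.i_end slid by (auto simp: over_def)
    have "upto_over S b r - {t} \<noteq> {}"
      using p0 r tr True slid noncrossing_less[OF B.nc p0(1)] by (auto simp: upto_over_def)
    moreover have "length (asc (b ` over S b r)) = card (over S b r)" using cb by simp
    then have "card (upto_over S b r - {t}) = Suc (card {y \<in> b ` over S b r. y < i} + card ({y \<in> b ` over S b r. i \<le> y} - {?m}))"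
      using inb(4) cb(1) unfolding P(1) by simp
    moreover have "card (over S g r - {t}) = card (g ` over S g r - {i})"
      using cg ing(3) iY by simp
    moreover have "\<forall>l\<in>upto_over S b r - {t}. t < l" "\<forall>x\<in>over S g r - {t}. t < x"
      using B.t_min by (force simp: upto_over_def over_def order_le_less)+
    moreover have "\<forall>p\<in>g ` over S g r - {i}. p < i" using le_i by (force simp: order_le_less)
    moreover have "i < ?m" using P(3,4) iP by (cases "?m = i") auto
    moreover have "\<forall>y\<in>{y \<in> b ` over S b r. i \<le> y} - {?m}. i < y" using iP by (metis DiffD1 mem_Collect_eq order_le_less)
    ultimately have "zig M (desc (upto_over S b r - {t}) @ [t])
        (asc {y \<in> b ` over S b r. y < i} @ ?m # asc ({y \<in> b ` over S b r. i \<le> y} - {?m}))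
        (desc (over S g r - {t}) @ [t]) (asc (g ` over S g r - {i}) @ [i])
      = zig M (desc (upto_over S b r - {t}))
        (asc {y \<in> b ` over S b r. y < i} @ asc ({y \<in> b ` over S b r. i \<le> y} - {?m}))
        (desc (over S g r - {t})) (asc (g ` over S g r - {i}))"
      by (intro zig_inside_slid) auto
    moreover have "asc (upto_over S b r) = t # asc (upto_over S b r - {t})"
      using inb(4) B.t_min by (intro asc_min) (auto simp: upto_over_def B.fin)
    moreover have "asc (over S g r) = t # asc (over S g r - {t})"
      using ing(3) B.t_min by (intro asc_min) (auto simp: over_def B.fin)
    moreover have "asc (g ` over S g r) = asc (g ` over S g r - {i}) @ [i]"
      using iY le_i fing by (intro asc_max)
    ultimately show ?thesis unfolding trip_def Y' inb(6) unfolding inb(2) ing(1) P(2) P(1) by simp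
  next
    case False
    then have ir: "i < r" using ri by simp
    note o = G.over_outside_hit[OF hit ir] G.outside_hit_greater[OF hit ir]
    have g': "over B.S' G.b' r = insert i (over S g r)" "G.b' ` over B.S' G.b' r = insert (t + M) (g ` over S g r)"
      using o rT by auto
    have b': "B.b' ` over B.S' B.b' r = b ` over S b r" by (rule B.ends_over_outside_slid[OF slid ir])
    have X: "desc (insert i (over S g r)) = desc (over S g r) @ [i]"
      using asc_insert_min[of "over S g r" i] o by simp
    have Y: "asc (insert (t + M) (g ` over S g r)) = asc (g ` over S g r) @ [t + M]"
      using TY by (intro asc_insert_max) auto
    let ?L = "upto_over S b r"
    from B.upto_over_outside_slid[OF slid ir] show ?thesis
    proof
      assume a: "upto_over B.S' B.b' r = upto_over S b r \<and> (\<forall>x\<in>upto_over S b r. i < x)"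
      have "zig M (desc ?L) (asc (b ` over S b r)) (desc (over S g r) @ [i]) (asc (g ` over S g r) @ [t + M])
        = zig M (desc ?L) (asc (b ` over S b r)) (desc (over S g r)) (asc (g ` over S g r))"
        using cb cg a by (intro zig_outside_free) auto
      then show ?thesis using a unfolding trip_def b' g'(2) unfolding g'(1) X Y by simp
    next
      assume a: "t \<in> ?L \<and> (\<exists>c\<le>i. c \<notin> ?L \<and> (\<forall>x\<in>?L. x \<le> i \<longrightarrow> x < c) \<and>
        upto_over B.S' B.b' r = insert c (?L - {t}))"
      then obtain c where c: "c \<le> i" "c \<notin> ?L" "\<forall>x\<in>?L. x \<le> i \<longrightarrow> x < c"
        "upto_over B.S' B.b' r = insert c (?L - {t})" and tL: "t \<in> ?L" by auto
      let ?L1 = "desc {x \<in> ?L. i < x}" and ?L2 = "desc ({x \<in> ?L. x \<le> i} - {t})"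
      have "asc {x \<in> ?L. x \<le> i} = t # asc ({x \<in> ?L. x \<le> i} - {t})"
        using tL B.ti B.t_min by (intro asc_min) (auto simp: upto_over_def B.fin)
      then have L: "desc ?L = ?L1 @ ?L2 @ [t]" using asc_cut[of ?L i] by simp
      have "{x \<in> insert c (?L - {t}). x \<le> i} = insert c ({x \<in> ?L. x \<le> i} - {t})"
        "{x \<in> insert c (?L - {t}). i < x} = {x \<in> ?L. i < x}"
        using c(1) B.ti by auto
      moreover have "asc (insert c ({x \<in> ?L. x \<le> i} - {t})) = asc ({x \<in> ?L. x \<le> i} - {t}) @ [c]"
        using c(3) by (intro asc_insert_max) auto
      ultimately have L': "desc (insert c (?L - {t})) = ?L1 @ c # ?L2"
        using asc_cut[of "insert c (?L - {t})" i] by simp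
      have "zig M (?L1 @ c # ?L2) (asc (b ` over S b r)) (desc (over S g r) @ [i]) (asc (g ` over S g r) @ [t + M])
        = zig M (?L1 @ ?L2 @ [t]) (asc (b ` over S b r)) (desc (over S g r)) (asc (g ` over S g r))"
      proof (rule zig_outside_slid)
        show "length ?L1 + length ?L2 = length (asc (b ` over S b r))"
          using arg_cong[OF L, of length] cb by simp
      qed (use c cg TY o B.ti in auto)
      then show ?thesis unfolding trip_def b' g'(2) unfolding g'(1) X Y c(4) L L' by simp
    qed
  qed
qed

section \<open>Webs and their invariants under one turn\<close>

text \<open>Extends the trips to the starts, where the value is the letter that is going to be used
  up. At a common end of both systems the case distinction favours \<open>b\<close>;
  \<open>trip_common_end\<close> shows that this choice is immaterial.\<close>

definition target :: "int \<Rightarrow> int set \<Rightarrow> (int \<Rightarrow> int) \<Rightarrow> (int \<Rightarrow> int) \<Rightarrow> int \<Rightarrow> int" where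
  "target M S b g r =
     (if r \<in> S then min (b r) (g r) else if r \<in> b ` S then trip M S b g r else trip M S g b r)"

text \<open>
  Decides the letter that \<open>p\<close> carries, or carried before it became an A, or, for an A of the initial
  diagram, will not carry afterwards.
\<close>

definition hue :: "int set \<Rightarrow> (int \<Rightarrow> int) \<Rightarrow> (int \<Rightarrow> int) \<Rightarrow> int \<Rightarrow> bool" where
  "hue S b g p \<longleftrightarrow> (if p \<in> S then g p \<le> b p else p \<in> b ` S)"

definition occupied :: "int set \<Rightarrow> (int \<Rightarrow> int) \<Rightarrow> (int \<Rightarrow> int) \<Rightarrow> int set" where
  "occupied S b g = S \<union> b ` S \<union> g ` S"

text \<open>By the last condition a position can be a B and a C at once only if a single A owns both
  arcs; such an A uses up both letters in one turn.\<close>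

definition web :: "int \<Rightarrow> int \<Rightarrow> int set \<Rightarrow> (int \<Rightarrow> int) \<Rightarrow> (int \<Rightarrow> int) \<Rightarrow> bool" where
  "web M t S b g \<longleftrightarrow> finite S \<and> noncrossing S b \<and> noncrossing S g \<and>
     (\<forall>p\<in>S. t \<le> p \<and> b p < t + M \<and> g p < t + M) \<and> (\<forall>p\<in>S. \<forall>p'\<in>S. b p = g p' \<longrightarrow> p = p')"

lemma web_flip: "web M t S b g \<Longrightarrow> web M t S g b"
  unfolding web_def by metis

lemma occupied_flip: "occupied S g b = occupied S b g"
  by (auto simp: occupied_def)

text \<open>Both arcs into \<open>r\<close> come from one start \<open>p\<close>. Any other arc over
  \<open>r\<close> encloses one of these two and so starts before \<open>p\<close>; either trip
  therefore runs straight down to \<open>p\<close> and equals \<open>p + M\<close>.\<close>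

lemma trip_common_end:
  assumes w: "web M t S b g" and r: "r \<in> b ` S" "r \<in> g ` S"
  shows "trip M S b g r = trip M S g b r"
proof -
  obtain p where p: "p \<in> S" "r = b p" using r by auto
  obtain p' where p': "p' \<in> S" "r = g p'" using r by auto
  have eq: "p' = p" using w p p' unfolding web_def by metis
  have *: "trip M S b g r = p + M"
    if w: "web M t S b g" and p: "r = b p" "r = g p" "p \<in> S" for b g
  proof -
    have f: "finite S" and nb: "noncrossing S b" and ng: "noncrossing S g" using w by (auto simp: web_def)
    have less: "c < p" if "c \<in> over S b r \<or> c \<in> over S g r" for c
      using that p noncrossing_nested[OF nb, of p c] noncrossing_nested[OF ng, of p c]
      by (cases c p rule: linorder_cases) (auto simp: over_def)
    have fin: "finite (over S b r)" "finite (over S g r)" using f by (auto simp: over_def)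
    have "upto_over S b r = insert p (over S b r)"
      using p noncrossing_less[OF nb] noncrossing_inj[OF nb]
      by (auto simp: upto_over_def over_def order_le_less)
    then have L: "desc (upto_over S b r) = p # desc (over S b r)"
    proof -
      have "asc (insert p (over S b r)) = asc (over S b r) @ [p]"
        by (rule asc_insert_max) (use fin less in auto)
      then show "desc (upto_over S b r) = p # desc (over S b r)"
        using \<open>upto_over S b r = insert p (over S b r)\<close> by simp
    qed
    have X: "\<forall>x\<in>set (desc (over S g r)). x < p" using less fin by auto
    show ?thesis
    proof (cases "desc (over S g r)")
      case Nil
      then show ?thesis unfolding trip_def L by simp
    next
      case (Cons x X')
      then show ?thesis unfolding trip_def L using X by (cases "asc (g ` over S g r)") auto
    qed
  qed
  show ?thesis using *[OF w] *[OF web_flip[OF w]] p p' eq by simp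
qed

lemma target_flip:
  assumes "web M t S b g" "r \<in> occupied S b g"
  shows "target M S g b r = target M S b g r"
  using assms trip_common_end[OF assms(1), of r]
  by (auto simp: target_def occupied_def min.commute)

context moved begin

lemma ends_hit: "b t = i \<Longrightarrow> b' ` S' = insert T (b ` S - {i})"
proof -
  assume hit: "b t = i"
  have "b' ` S' = insert T (b ` (S - {t}))"
    unfolding image_insert using hit iS by (auto simp: slide_hit)
  also have "b ` (S - {t}) = b ` S - {i}"
    using noncrossing_inj_on[OF nc] hit tS by (auto simp: inj_on_def)
  finally show ?thesis .
qed

lemma slide_in_slid: assumes "i < b t" "p \<in> S'" shows "b' p \<in> b ` S"
  using assms pr_props(1)[of p] ti by (auto simp: slide_slid over_def)

lemma ends_slid: "i < b t \<Longrightarrow> b' ` S' = b ` S"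
proof (rule card_subset_eq)
  assume lt: "i < b t"
  show "finite (b ` S)" using fin by simp
  show "b' ` S' \<subseteq> b ` S" using slide_in_slid[OF lt] by blast
  have "card (b' ` S') = card S'" by (rule card_image[OF noncrossing_inj_on[OF noncrossing_slide]])
  also have "\<dots> = card S" using card_Suc_Diff1[OF fin tS] fin iS by simp
  also have "\<dots> = card (b ` S)" using card_image[OF noncrossing_inj_on[OF nc]] by simp
  finally show "card (b' ` S') = card (b ` S)" .
qed

lemma slide_le_T: "p \<in> S' \<Longrightarrow> b' p \<le> T"
proof -
  assume "p \<in> S'"
  then have "b' p = T \<or> (\<exists>c\<in>S. b' p = b c)" using slide_in by auto
  then show ?thesis using ends by (metis less_imp_le order_refl)
qed

lemma slide_less_T: "i < b t \<Longrightarrow> p \<in> S' \<Longrightarrow> b' p < T"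
proof -
  assume "i < b t" "p \<in> S'"
  then obtain c where "c \<in> S" "b' p = b c" using slide_in_slid by blast
  then show ?thesis using ends by simp
qed

end

lemma web_moved:
  assumes w: "web M t S b g" and t: "t \<in> S" and i: "i = min (b t) (g t)"
  shows "moved S t i (t + M) b" "moved S t i (t + M) g"
proof -
  have *: "moved S t i (t + M) b" if w: "web M t S b g" and i: "i = min (b t) (g t)" for b g
  proof
    show "finite S" "noncrossing S b" "t \<in> S" using w t by (auto simp: web_def)
    show "p \<in> S \<Longrightarrow> t \<le> p" "p \<in> S \<Longrightarrow> b p < t + M" for p using w by (auto simp: web_def)
    have n: "noncrossing S b" "noncrossing S g" using w by (auto simp: web_def)
    show "t < i" "i \<le> b t" using i noncrossing_less[OF n(1) t] noncrossing_less[OF n(2) t] by auto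
    show "i \<notin> S" using i noncrossing_not_end[OF n(1) t, of i] noncrossing_not_end[OF n(2) t, of i]
      by (metis min_def)
    show "p = t" if "p \<in> S" "b p = i" for p
    proof (cases "b t \<le> g t")
      case True
      then show ?thesis using that i noncrossing_inj[OF n(1), of p t] t by auto
    next
      case False
      then have "b p = g t" using i that by auto
      then show ?thesis using w t \<open>p \<in> S\<close> unfolding web_def by metis
    qed
  qed
  show "moved S t i (t + M) b" using *[OF w i] .
  show "moved S t i (t + M) g" using *[OF web_flip[OF w]] i by (simp add: min.commute)
qed

text \<open>The symmetry \<open>web_flip\<close> allows the assumption that the arc of
  \<open>b\<close> is the one with the nearer end.\<close>

locale web_hit =
  fixes M t S b g
  assumes w: "web M t S b g" and t: "t \<in> S" and bg: "b t \<le> g t"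
begin

sublocale B: moved S t "b t" "t + M" b
  using web_moved[OF w t refl] bg by (simp add: min_def)

sublocale G: moved S t "b t" "t + M" g
  using web_moved[OF w t refl] bg by (simp add: min_def)

abbreviation i where "i \<equiv> b t"
abbreviation "S1 \<equiv> insert i (S - {t})"
abbreviation "b1 \<equiv> slide S t i (t + M) b"
abbreviation "g1 \<equiv> slide S t i (t + M) g"

lemma b1_eq: "p \<in> S \<Longrightarrow> b1 p = b p" using B.iS by (auto simp: slide_def)
lemma b1_i: "b1 i = t + M" by (simp add: slide_def)

text \<open>The end in \<open>g\<close> can change only for an arc over \<open>i\<close>. Its start
  lies strictly between \<open>t\<close> and \<open>i\<close>, so its end in \<open>b\<close> is
  nested under the arc of \<open>t\<close>, before \<open>i\<close>. Hence neither the nearer end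
  nor the comparison of the two ends is affected.\<close>

lemma g1_cases: "p \<in> S \<Longrightarrow> p \<noteq> t \<Longrightarrow> g1 p = g p \<or> (b p < i \<and> i < g p \<and> i < g1 p)"
proof -
  assume p: "p \<in> S" "p \<noteq> t"
  show ?thesis
  proof (cases "p \<in> over S g i")
    case True
    show ?thesis
    proof (cases "g t = i")
      case True
      then show ?thesis using G.slide_hit p B.iS by auto
    next
      case False
      then have lt: "i < g t" using bg by simp
      then show ?thesis using G.slide_beyond[OF lt, of p] True p B.inside_end[of p] by (auto simp: over_def)
    qed
  qed (use G.slide_eq p in auto)
qed

lemma g1_i: "g1 i = t + M \<longleftrightarrow> g t = i" "g1 i \<le> t + M"
proof -
  show "g1 i \<le> t + M" by (rule G.slide_le_T) simp
  show "g1 i = t + M \<longleftrightarrow> g t = i"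
    using G.slide_less_T[of i] bg by (cases "g t = i") (auto simp: slide_def)
qed

lemma end_less: "p \<in> S \<Longrightarrow> b p < t + M" "p \<in> S \<Longrightarrow> g p < t + M"
  using B.ends G.ends by auto

lemma web_next: "web M (t + 1) S1 b1 g1"
  unfolding web_def
proof (intro conjI ballI impI)
  show "finite S1" using B.fin by simp
  show "noncrossing S1 b1" by (rule B.noncrossing_slide)
  show "noncrossing S1 g1" by (rule G.noncrossing_slide)
  fix p assume p: "p \<in> S1"
  show "t + 1 \<le> p" using p B.t_min[of p] B.ti by auto
  show "b1 p < t + 1 + M" "g1 p < t + 1 + M" using B.slide_le_T[OF p] G.slide_le_T[OF p] by auto
  fix p' assume p': "p' \<in> S1" and eq: "b1 p = g1 p'"
  show "p = p'"
  proof (cases "p = i")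
    case True
    then have "g1 p' = t + M" using eq b1_i by simp
    then have "g t = i" using G.slide_less_T[of p'] p' bg by (cases "g t = i") auto
    then have "p' = i" using \<open>g1 p' = t + M\<close> p' end_less(2)[of p'] by (auto simp: slide_def split: if_splits)
    then show ?thesis using True by simp
  next
    case False
    then have pS: "p \<in> S" "p \<noteq> t" "b1 p = b p" using p b1_eq by auto
    show ?thesis
    proof (cases "g t = i")
      case True
      then have "p' \<noteq> i" using eq pS end_less(1)[of p] by (auto simp: slide_def)
      then have "g1 p' = g p'" "p' \<in> S" using p' True by (auto simp: slide_def)
      then show ?thesis using eq pS w unfolding web_def by metis
    next
      case False
      then have lt: "i < g t" using bg by simp
      show ?thesis
      proof (cases "p' \<in> insert i (over S g i) - {t}")
        case C: True
        let ?c = "Max {c \<in> over S g i. c < p'}"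
        have c: "?c \<in> S" "?c < i" "i < g ?c" using G.pr_props(1)[OF lt C] by (auto simp: over_def)
        have "b p = g ?c" using eq pS C G.slide_slid[OF lt] by simp
        then have "p = ?c" using w pS c unfolding web_def by metis
        then show ?thesis using B.inside_end[of p] pS c \<open>b p = g ?c\<close> by auto
      next
        case C: False
        then have "g1 p' = g p'" "p' \<in> S" using p' B.ti G.slide_slid[OF lt] by auto
        then show ?thesis using eq pS w unfolding web_def by metis
      qed
    qed
  qed
qed

lemma ends_b1: "b1 ` S1 = insert (t + M) (b ` S - {i})" by (rule B.ends_hit) simp

lemma ends_g1: "g1 ` S1 = (if g t = i then insert (t + M) (g ` S - {i}) else g ` S)"
  using G.ends_hit G.ends_slid bg by auto

lemma occupied_next: "occupied S1 b1 g1 = insert (t + M) (occupied S b g - {t})"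
proof -
  have "t \<notin> b ` S" "t \<notin> g ` S" using noncrossing_not_end[OF B.nc _ t] noncrossing_not_end[OF G.nc _ t] by auto
  moreover have "i \<in> b ` S" "i \<notin> S" "t \<noteq> i" using t B.iS B.ti by auto
  ultimately show ?thesis unfolding occupied_def ends_b1 ends_g1 by auto
qed

lemma occupied_less: "r \<in> occupied S b g \<Longrightarrow> r < t + M"
  using end_less noncrossing_less[OF B.nc] by (force simp: occupied_def)

text \<open>Only the arc from \<open>t\<close> ends at \<open>i\<close> in \<open>b\<close> and none
  passes over \<open>i\<close>, so the old trip runs down to \<open>t\<close>. If the arc of
  \<open>g\<close> also ends at \<open>i\<close>, it leaves there as \<open>t + M\<close>; otherwise
  it turns at the innermost arc of \<open>g\<close> over \<open>i\<close> and leaves at its end.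
  That is the end which sliding gives to \<open>i\<close>, and it is the nearer one because
  \<open>b1 i = t + M\<close> is the last position.\<close>

lemma target_i: "target M S1 b1 g1 i = target M S b g i"
proof -
  have "target M S1 b1 g1 i = g1 i" using b1_i g1_i by (simp add: target_def)
  also have "\<dots> = trip M S b g i"
  proof (cases "g t = i")
    case True
    then show ?thesis using B.over_at_hit[OF refl] G.over_at_hit[OF True] g1_i
      by (simp add: trip_def)
  next
    case False
    then have lt: "i < g t" using bg by simp
    let ?C = "over S g i"
    have tC: "t \<in> ?C" by (rule G.t_over[OF lt])
    have "{c \<in> ?C. c < i} = ?C" by (auto simp: over_def)
    then have g1i: "g1 i = g (Max ?C)" using G.slide_slid[OF lt, of i] B.ti by simp
    have m: "Max ?C \<in> ?C" using tC by (intro Max_in) auto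
    then have mS: "Max ?C \<in> S" "Max ?C < i" "i < g (Max ?C)" by (auto simp: over_def)
    have "asc ?C = asc (?C - {Max ?C}) @ [Max ?C]" using m by (intro asc_max) auto
    moreover have "asc (g ` ?C) = g (Max ?C) # asc (g ` ?C - {g (Max ?C)})"
    proof (rule asc_min)
      fix y assume "y \<in> g ` ?C"
      then obtain c where c: "c \<in> ?C" "y = g c" by auto
      then have "c \<le> Max ?C" by (intro Max_ge) auto
      then show "g (Max ?C) \<le> y"
        using c mS noncrossing_nested[OF G.nc, of c "Max ?C"] by (cases "c = Max ?C") (auto simp: over_def)
    qed (use m in auto)
    moreover have "t \<le> Max ?C" using mS B.t_min by simp
    ultimately show ?thesis using B.over_at_hit[OF refl] g1i by (simp add: trip_def)
  qed
  also have "\<dots> = target M S b g i" using B.iS t by (simp add: target_def)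
  finally show ?thesis .
qed

lemma target_next:
  assumes r: "r \<in> occupied S b g" "r \<noteq> t"
  shows "target M S1 b1 g1 r = target M S b g r"
proof (cases "r = i")
  case False
  show ?thesis
  proof (cases "r \<in> S")
    case True
    then show ?thesis using g1_cases[of r] b1_eq[of r] r by (auto simp: target_def)
  next
    case rS: False
    have rT: "r < t + M" using occupied_less r by simp
    show ?thesis
    proof (cases "r \<in> b ` S")
      case True
      then show ?thesis
        using trip_hit[OF B.moved_axioms G.moved_axioms refl True \<open>r \<noteq> i\<close>] rS \<open>r \<noteq> i\<close> ends_b1
        by (simp add: target_def)
    next
      case rb: False
      then have rg: "r \<in> g ` S" using r rS by (auto simp: occupied_def)
      have "trip M S1 g1 b1 r = trip M S g b r"
        using trip_hit[OF G.moved_axioms B.moved_axioms _ rg \<open>r \<noteq> i\<close>]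
          trip_slid[OF G.moved_axioms B.moved_axioms _ refl rg] bg by (cases "g t = i") auto
      then show ?thesis using rS \<open>r \<noteq> i\<close> ends_b1 rT rb by (simp add: target_def)
    qed
  qed
qed (use target_i in simp)

text \<open>No arc passes over the last position, so the trip from there runs down the new arc to
  its start \<open>i\<close>.\<close>

lemma target_wrap: "target M S1 b1 g1 (t + M) = target M S b g t + M"
proof -
  have iT: "i < t + M" by (rule B.i_T)
  have "upto_over S b (t + M) = {}" using end_less by (force simp: upto_over_def)
  then have "upto_over S1 b1 (t + M) = {i}" using B.over_outside_hit(2)[OF refl iT] by simp
  moreover have "over S1 b1 (t + M) = {}" "over S1 g1 (t + M) = {}"
    using B.slide_le_T G.slide_le_T by (force simp: over_def)+
  moreover have "t + M \<notin> S1"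
    using iT end_less noncrossing_less[OF B.nc] by force
  moreover have "t + M \<in> b1 ` S1" using ends_b1 by simp
  moreover have "M \<noteq> 0" using iT B.ti by simp
  ultimately have "target M S1 b1 g1 (t + M) = i + M" unfolding target_def trip_def by simp
  then show ?thesis using bg t by (simp add: target_def)
qed

text \<open>When \<open>i\<close> becomes an A, its arc in \<open>b1\<close> reaches the last
  position, so the comparison of its two ends remembers that it was a B; it remembers a C as well
  exactly if \<open>g t = i\<close>. For the other starts \<open>g1_cases\<close> applies.\<close>

lemma hue_next:
  assumes r: "r \<in> occupied S b g" "r \<noteq> t"
  shows "hue S1 b1 g1 r = hue S b g r" "hue S1 g1 b1 r = hue S g b r"
proof -
  have rT: "r < t + M" using occupied_less r by simp
  have "hue S1 b1 g1 r = hue S b g r \<and> hue S1 g1 b1 r = hue S g b r"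
  proof (cases "r = i")
    case True
    have "i \<in> g ` S \<longleftrightarrow> g t = i" using G.i_end t by force
    then show ?thesis using True B.iS t b1_i g1_i by (auto simp: hue_def)
  next
    case False
    then show ?thesis using g1_cases[of r] b1_eq[of r] r rT ends_b1 ends_g1 by (auto simp: hue_def)
  qed
  then show "hue S1 b1 g1 r = hue S b g r" "hue S1 g1 b1 r = hue S g b r" by auto
qed

lemma hue_wrap: "hue S1 b1 g1 (t + M) = hue S g b t" "hue S1 g1 b1 (t + M) = hue S b g t"
proof -
  have "t + M \<notin> S1" using B.i_T end_less noncrossing_less[OF B.nc] by force
  moreover have "t + M \<notin> g ` S" using end_less by force
  ultimately show "hue S1 b1 g1 (t + M) = hue S g b t" "hue S1 g1 b1 (t + M) = hue S b g t"
    using ends_b1 ends_g1 bg t by (auto simp: hue_def)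
qed

end

type_synonym tokens = "int set \<times> (int \<Rightarrow> int) \<times> (int \<Rightarrow> int)"

definition turn :: "int \<Rightarrow> int \<Rightarrow> tokens \<Rightarrow> tokens" where
  "turn M t = (\<lambda>(S, b, g). if t \<in> S
     then let i = min (b t) (g t) in (insert i (S - {t}), slide S t i (t + M) b, slide S t i (t + M) g)
     else (S, b, g))"

text \<open>
  One full turn shifts the trip permutation by \<open>M\<close> and interchanges the two letters, because a
  token that is an A with \<open>b t \<le> g t\<close> comes back as the end of a \<open>b\<close>-arc.
\<close>

lemma turn_invariants:
  assumes w: "web M t S b g" and t: "t \<in> S" and e: "turn M t (S, b, g) = (S1, b1, g1)"
  shows "web M (t + 1) S1 b1 g1"
    "S1 = insert (target M S b g t) (S - {t})"
    "occupied S1 b1 g1 = insert (t + M) (occupied S b g - {t})"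
    "b1 ` S1 = (if hue S g b t then insert (t + M) (b ` S - {target M S b g t}) else b ` S)"
    "g1 ` S1 = (if hue S b g t then insert (t + M) (g ` S - {target M S b g t}) else g ` S)"
    "\<And>r. r \<in> occupied S b g \<Longrightarrow> r \<noteq> t \<Longrightarrow> target M S1 b1 g1 r = target M S b g r"
    "target M S1 b1 g1 (t + M) = target M S b g t + M"
    "\<And>r. r \<in> occupied S b g \<Longrightarrow> r \<noteq> t \<Longrightarrow> hue S1 b1 g1 r = hue S b g r"
    "\<And>r. r \<in> occupied S b g \<Longrightarrow> r \<noteq> t \<Longrightarrow> hue S1 g1 b1 r = hue S g b r"
    "hue S1 b1 g1 (t + M) = hue S g b t" "hue S1 g1 b1 (t + M) = hue S b g t"
proof -
  let ?P = "\<lambda>b g b1 g1. web M (t + 1) S1 b1 g1 \<and> S1 = insert (target M S b g t) (S - {t}) \<and>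
    occupied S1 b1 g1 = insert (t + M) (occupied S b g - {t}) \<and>
    b1 ` S1 = (if hue S g b t then insert (t + M) (b ` S - {target M S b g t}) else b ` S) \<and>
    g1 ` S1 = (if hue S b g t then insert (t + M) (g ` S - {target M S b g t}) else g ` S) \<and>
    (\<forall>r. r \<in> occupied S b g \<longrightarrow> r \<noteq> t \<longrightarrow> target M S1 b1 g1 r = target M S b g r) \<and>
    target M S1 b1 g1 (t + M) = target M S b g t + M \<and>
    (\<forall>r. r \<in> occupied S b g \<longrightarrow> r \<noteq> t \<longrightarrow> hue S1 b1 g1 r = hue S b g r \<and> hue S1 g1 b1 r = hue S g b r) \<and>
    hue S1 b1 g1 (t + M) = hue S g b t \<and> hue S1 g1 b1 (t + M) = hue S b g t"
  have main: "?P b g b1 g1"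
    if w: "web M t S b g" and le: "b t \<le> g t" and e: "turn M t (S, b, g) = (S1, b1, g1)" for b g b1 g1
  proof -
    interpret web_hit M t S b g using w t le by unfold_locales
    have "S1 = insert (b t) (S - {t})" "b1 = slide S t (b t) (t + M) b" "g1 = slide S t (b t) (t + M) g"
      using e t le by (auto simp: turn_def Let_def min_def)
    moreover have "target M S b g t = b t" "hue S g b t" "hue S b g t \<longleftrightarrow> g t = b t"
      using t le by (auto simp: target_def hue_def min_def)
    ultimately show ?thesis
      using web_next occupied_next ends_b1 ends_g1 target_next target_wrap hue_next hue_wrap by auto
  qed
  have "?P b g b1 g1"
  proof (cases "b t \<le> g t")
    case True
    then show ?thesis using main w e by blast
  next
    case False
    \<comment> \<open>A turn takes the minimum of both ends and slides both systems, so it commutes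
      with the exchange of the two letters.\<close>
    have e': "turn M t (S, g, b) = (S1, g1, b1)" using e t by (auto simp: turn_def Let_def min.commute)
    have P: "?P g b g1 b1" by (rule main[OF web_flip[OF w] _ e']) (use False in simp)
    have tt: "target M S g b r = target M S b g r" if "r \<in> occupied S b g" for r
      using target_flip[OF w that] .
    have w1: "web M (t + 1) S1 b1 g1" using P web_flip by blast
    have tt1: "target M S1 g1 b1 r = target M S1 b1 g1 r" if "r \<in> occupied S1 b1 g1" for r
      using target_flip[OF w1 that] .
    have to: "t \<in> occupied S b g" using t by (simp add: occupied_def)
    have o1: "occupied S1 b1 g1 = insert (t + M) (occupied S b g - {t})"
      using P by (metis occupied_flip)
    note p = P[THEN conjunct2] P[THEN conjunct2, THEN conjunct2, THEN conjunct2]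
    have t1: "t + M \<in> occupied S1 b1 g1" using o1 by simp
    have q1: "S1 = insert (target M S b g t) (S - {t})" using p(1) tt[OF to] by metis
    have q2: "b1 ` S1 = (if hue S g b t then insert (t + M) (b ` S - {target M S b g t}) else b ` S)"
      using p(2) tt[OF to] by metis
    have q3: "g1 ` S1 = (if hue S b g t then insert (t + M) (g ` S - {target M S b g t}) else g ` S)"
      using p(2) tt[OF to] by metis
    have q4: "target M S1 b1 g1 r = target M S b g r" if r: "r \<in> occupied S b g" "r \<noteq> t" for r
    proof -
      have "target M S1 g1 b1 r = target M S g b r" using p(2) r by (metis occupied_flip)
      then show ?thesis using tt[OF r(1)] tt1[of r] r o1 by auto
    qed
    have q5: "target M S1 b1 g1 (t + M) = target M S b g t + M"
      using p(2) tt[OF to] tt1[OF t1] by metis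
    have q6: "hue S1 b1 g1 r = hue S b g r \<and> hue S1 g1 b1 r = hue S g b r"
      if r: "r \<in> occupied S b g" "r \<noteq> t" for r
      using p(2) r by (metis occupied_flip)
    have q7: "hue S1 b1 g1 (t + M) = hue S g b t \<and> hue S1 g1 b1 (t + M) = hue S b g t"
      using p(2) by metis
    show ?thesis using w1 q1 o1 q2 q3 q4 q5 q6 q7 by blast
  qed
  then show "web M (t + 1) S1 b1 g1"
    "S1 = insert (target M S b g t) (S - {t})"
    "occupied S1 b1 g1 = insert (t + M) (occupied S b g - {t})"
    "b1 ` S1 = (if hue S g b t then insert (t + M) (b ` S - {target M S b g t}) else b ` S)"
    "g1 ` S1 = (if hue S b g t then insert (t + M) (g ` S - {target M S b g t}) else g ` S)"
    "\<And>r. r \<in> occupied S b g \<Longrightarrow> r \<noteq> t \<Longrightarrow> target M S1 b1 g1 r = target M S b g r"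
    "target M S1 b1 g1 (t + M) = target M S b g t + M"
    "\<And>r. r \<in> occupied S b g \<Longrightarrow> r \<noteq> t \<Longrightarrow> hue S1 b1 g1 r = hue S b g r"
    "\<And>r. r \<in> occupied S b g \<Longrightarrow> r \<noteq> t \<Longrightarrow> hue S1 g1 b1 r = hue S g b r"
    "hue S1 b1 g1 (t + M) = hue S g b t" "hue S1 g1 b1 (t + M) = hue S b g t"
    by blast+
qed

section \<open>A full turn of the web\<close>

fun run :: "int \<Rightarrow> tokens \<Rightarrow> nat \<Rightarrow> tokens" where
  "run M \<sigma> 0 = \<sigma>"
| "run M \<sigma> (Suc n) = turn M (int n) (run M \<sigma> n)"

lemma web_skip: "web M t S b g \<Longrightarrow> t \<notin> S \<Longrightarrow> web M (t + 1) S b g"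
proof -
  assume w: "web M t S b g" and "t \<notin> S"
  have "t + 1 \<le> p \<and> b p < t + 1 + M \<and> g p < t + 1 + M" if p: "p \<in> S" for p
  proof -
    have "t \<le> p" "b p < t + M" "g p < t + M" using w p by (auto simp: web_def)
    moreover have "p \<noteq> t" using p \<open>t \<notin> S\<close> by auto
    ultimately show ?thesis by simp
  qed
  then show ?thesis using w by (simp add: web_def)
qed

lemma web_occupied_ge: "web M t S b g \<Longrightarrow> r \<in> occupied S b g \<Longrightarrow> t \<le> r \<and> r < t + M"
proof -
  assume w: "web M t S b g" and "r \<in> occupied S b g"
  then obtain p where p: "p \<in> S" "r = p \<or> r = b p \<or> r = g p" by (auto simp: occupied_def)
  have "noncrossing S b" "noncrossing S g" using w by (auto simp: web_def)
  then have "p < b p" "p < g p" using noncrossing_less p(1) by auto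
  moreover have "t \<le> p" "b p < t + M" "g p < t + M" using w p(1) by (auto simp: web_def)
  ultimately show ?thesis using p(2) by auto
qed

lemma web_first: "web M t S b g \<Longrightarrow> t \<in> occupied S b g \<Longrightarrow> t \<in> S"
proof (rule ccontr)
  assume w: "web M t S b g" and "t \<in> occupied S b g" "t \<notin> S"
  then obtain p where p: "p \<in> S" "t = b p \<or> t = g p" by (auto simp: occupied_def)
  have "noncrossing S b" "noncrossing S g" using w by (auto simp: web_def)
  then have "p < b p" "p < g p" using noncrossing_less p(1) by auto
  moreover have "t \<le> p" using w p(1) by (auto simp: web_def)
  ultimately show False using p(2) by auto
qed

lemma web_end_notin: "web M t S b g \<Longrightarrow> b ` S \<inter> S = {}" "web M t S b g \<Longrightarrow> g ` S \<inter> S = {}"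
  using noncrossing_not_end by (auto simp: web_def)

lemma zig_cases:
  assumes "length L = Suc (length P)"
  shows "zig M L P X Y \<in> set Y \<union> (\<lambda>l. l + M) ` set L"
  using assms
proof (induction M L P X Y rule: zig.induct)
  case (1 M l ls ps x xs y ys)
  then show ?case by (cases ps) auto
qed auto

lemma trip_notin:
  assumes w: "web M t S b g" and r: "r \<in> b ` S"
  shows "trip M S b g r \<notin> S"
proof -
  have fin: "finite S" and n: "noncrossing S b" using w by (auto simp: web_def)
  have f: "finite (upto_over S b r)" "finite (over S g r)" "finite (over S b r)"
    using fin by (auto simp: upto_over_def over_def)
  have "length (desc (upto_over S b r)) = Suc (length (asc (b ` over S b r)))"
    using card_upto_over[OF fin n r] by simp
  then have "trip M S b g r \<in> g ` over S g r \<union> (\<lambda>l. l + M) ` upto_over S b r"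
    using zig_cases[of "desc (upto_over S b r)" "asc (b ` over S b r)" M "desc (over S g r)" "asc (g ` over S g r)"] f
    unfolding trip_def by auto
  then consider p where "p \<in> S" "trip M S b g r = g p" | l where "l \<in> S" "trip M S b g r = l + M"
    by (auto simp: over_def upto_over_def)
  then show ?thesis
  proof cases
    case 1
    then show ?thesis using web_end_notin(2)[OF w] by auto
  next
    case 2
    have "p < t + M" if "p \<in> S" for p
      using web_occupied_ge[OF w, of p] that by (simp add: occupied_def)
    then show ?thesis using 2 w by (force simp: web_def)
  qed
qed

text \<open>The nearer end of an A is not a start. A trip leaves either at an end or at
  \<open>l + M\<close>, which lies beyond every start in the current window. This is the means by
  which \<open>full_turn\<close> excludes unwanted A's.\<close>

lemma target_notin:
  assumes w: "web M t S b g" and r: "r \<in> occupied S b g"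
  shows "target M S b g r \<notin> S"
proof -
  consider "r \<in> S" | "r \<notin> S" "r \<in> b ` S" | "r \<notin> S" "r \<notin> b ` S" "r \<in> g ` S" using r by (auto simp: occupied_def)
  then show ?thesis
  proof cases
    case 1
    then have "target M S b g r \<in> b ` S \<union> g ` S" by (auto simp: target_def min_def)
    then show ?thesis using web_end_notin[OF w] by auto
  qed (use trip_notin[OF w] trip_notin[OF web_flip[OF w]] in \<open>auto simp: target_def\<close>)
qed

lemma web_turn:
  assumes "web M t S b g" "turn M t (S, b, g) = (S', b', g')"
  shows "web M (t + 1) S' b' g'"
  using assms turn_invariants(1)[OF assms(1) _ assms(2)] web_skip[OF assms(1)]
  by (cases "t \<in> S") (auto simp: turn_def)

lemma web_run: "web M 0 S b g \<Longrightarrow> run M (S, b, g) n = (S', b', g') \<Longrightarrow> web M (int n) S' b' g'"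
proof (induction n arbitrary: S' b' g')
  case (Suc n)
  obtain S1 b1 g1 where 1: "run M (S, b, g) n = (S1, b1, g1)" by (metis prod_cases3)
  then have "web M (int n + 1) S' b' g'" using Suc web_turn[of M "int n" S1 b1 g1] by simp
  then show ?case by (simp add: add.commute)
qed simp

text \<open>Hues are exchanged in the part that has already wrapped around. The last two conjuncts
  keep track of where an A can come from: either it was one initially or it is a target. Since a
  position is an A when its turn comes, this eventually covers every occupied position.\<close>

definition turned_upto ::
    "nat \<Rightarrow> int set \<Rightarrow> (int \<Rightarrow> int) \<Rightarrow> (int \<Rightarrow> int) \<Rightarrow> nat \<Rightarrow> int set \<Rightarrow> (int \<Rightarrow> int) \<Rightarrow> (int \<Rightarrow> int) \<Rightarrow> bool" where
  "turned_upto m S b g n S1 b1 g1 \<longleftrightarrow>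
    occupied S1 b1 g1 = {p \<in> occupied S b g. int n \<le> p} \<union> (\<lambda>p. p + int m) ` {p \<in> occupied S b g. p < int n} \<and>
    card S1 = card S \<and>
    (\<forall>p\<in>occupied S b g. int n \<le> p \<longrightarrow> target (int m) S1 b1 g1 p = target (int m) S b g p \<and>
       hue S1 b1 g1 p = hue S b g p \<and> hue S1 g1 b1 p = hue S g b p) \<and>
    (\<forall>p\<in>occupied S b g. p < int n \<longrightarrow>
       target (int m) S1 b1 g1 (p + int m) = target (int m) S b g p + int m \<and>
       hue S1 b1 g1 (p + int m) = hue S g b p \<and> hue S1 g1 b1 (p + int m) = hue S b g p) \<and>
    (\<forall>p\<in>S1. p < int m \<longrightarrow> p \<in> S \<union> target (int m) S b g ` occupied S b g) \<and>
    (\<forall>p\<in>occupied S b g. p < int n \<longrightarrow> p \<in> S \<union> target (int m) S b g ` occupied S b g)"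

lemma turned_upto_0:
  assumes w: "web (int m) 0 S b g"
  shows "turned_upto m S b g 0 S b g"
proof -
  have no: "\<not> p < int 0" "int 0 \<le> p" if "p \<in> occupied S b g" for p
    using web_occupied_ge[OF w that] by auto
  have "{p \<in> occupied S b g. int 0 \<le> p} = occupied S b g" "{p \<in> occupied S b g. p < int 0} = {}"
    using no by blast+
  then have o0: "occupied S b g =
      {p \<in> occupied S b g. int 0 \<le> p} \<union> (\<lambda>p. p + int m) ` {p \<in> occupied S b g. p < int 0}"
    by (simp only: image_empty Un_empty_right)
  have neg: "\<forall>p\<in>occupied S b g. p < int 0 \<longrightarrow> Q p" for Q using no(1) by blast
  show ?thesis unfolding turned_upto_def by (intro conjI o0 neg refl) simp_all
qed

lemma turned_upto_Suc:
  assumes w: "web (int m) 0 S b g" and w0: "web (int m) (int n) S0 b0 g0"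
    and I: "turned_upto m S b g n S0 b0 g0" and nm: "n < m"
    and e: "turn (int m) (int n) (S0, b0, g0) = (S1, b1, g1)"
  shows "turned_upto m S b g (Suc n) S1 b1 g1"
proof -
  let ?M = "int m"
  let ?O = "occupied S b g" and ?F = "target ?M S b g"
  have O: "p \<in> ?O \<Longrightarrow> 0 \<le> p \<and> p < ?M" for p using web_occupied_ge[OF w, of p] by simp
  have i1: "occupied S0 b0 g0 = {p \<in> ?O. int n \<le> p} \<union> (\<lambda>p. p + ?M) ` {p \<in> ?O. p < int n}"
    and i2: "card S0 = card S"
    and i3: "\<And>p. p \<in> ?O \<Longrightarrow> int n \<le> p \<Longrightarrow> target ?M S0 b0 g0 p = ?F p \<and> hue S0 b0 g0 p = hue S b g p \<and> hue S0 g0 b0 p = hue S g b p"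
    and i4: "\<And>p. p \<in> ?O \<Longrightarrow> p < int n \<Longrightarrow> target ?M S0 b0 g0 (p + ?M) = ?F p + ?M \<and>
     hue S0 b0 g0 (p + ?M) = hue S g b p \<and> hue S0 g0 b0 (p + ?M) = hue S b g p"
    and i5: "\<And>p. p \<in> S0 \<Longrightarrow> p < ?M \<Longrightarrow> p \<in> S \<union> ?F ` ?O"
    and i6: "\<And>p. p \<in> ?O \<Longrightarrow> p < int n \<Longrightarrow> p \<in> S \<union> ?F ` ?O"
    using I unfolding turned_upto_def by blast+
  \<comment> \<open>An occupied position at the front of the window must be an A, because an end has
    its start before it.\<close>
  have nO: "int n \<in> ?O \<longleftrightarrow> int n \<in> S0"
  proof
    assume "int n \<in> ?O"
    then have "int n \<in> occupied S0 b0 g0" unfolding i1 by simp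
    then show "int n \<in> S0" by (rule web_first[OF w0])
  next
    assume "int n \<in> S0"
    then have "int n \<in> occupied S0 b0 g0" by (simp add: occupied_def)
    then show "int n \<in> ?O" unfolding i1 using nm O by force
  qed
  have less_Suc: "p < int (Suc n) \<longleftrightarrow> p < int n \<or> p = int n" "int (Suc n) \<le> p \<longleftrightarrow> int n \<le> p \<and> p \<noteq> int n" for p
    by auto
  show ?thesis
  proof (cases "int n \<in> S0")
    case False
    then have "S1 = S0" "b1 = b0" "g1 = g0" using e by (auto simp: turn_def)
    moreover have "{p \<in> ?O. int (Suc n) \<le> p} = {p \<in> ?O. int n \<le> p}" "{p \<in> ?O. p < int (Suc n)} = {p \<in> ?O. p < int n}"
      using nO False unfolding less_Suc by metis+
    moreover have "p \<in> ?O \<Longrightarrow> p < int (Suc n) \<longleftrightarrow> p < int n" "p \<in> ?O \<Longrightarrow> int (Suc n) \<le> p \<longleftrightarrow> int n \<le> p" for p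
      using nO False unfolding less_Suc by metis+
    ultimately show ?thesis using I unfolding turned_upto_def by simp
  next
    case True
    note T = turn_invariants[OF w0 True e]
    have nn: "int n \<in> ?O" using nO True by simp
    have Fn: "target ?M S0 b0 g0 (int n) = ?F (int n)" using i3[OF nn] by simp
    have in0: "p \<in> occupied S0 b0 g0" if "p \<in> ?O" "int n \<le> p" for p
      unfolding i1 using that by blast
    have in0': "p + ?M \<in> occupied S0 b0 g0" "p + ?M \<noteq> int n" if "p \<in> ?O" "p < int n" for p
    proof -
      show "p + ?M \<in> occupied S0 b0 g0" unfolding i1 using that by blast
      show "p + ?M \<noteq> int n" using O[OF that(1)] nm by simp
    qed
    have c1: "occupied S1 b1 g1 = {p \<in> ?O. int (Suc n) \<le> p} \<union> (\<lambda>p. p + ?M) ` {p \<in> ?O. p < int (Suc n)}"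
    proof -
      have "{p \<in> ?O. int (Suc n) \<le> p} = {p \<in> ?O. int n \<le> p} - {int n}"
        "{p \<in> ?O. p < int (Suc n)} = insert (int n) {p \<in> ?O. p < int n}"
        using nn unfolding less_Suc by blast+
      note e1 = this
      have e2: "int n \<notin> (\<lambda>p. p + ?M) ` {p \<in> ?O. p < int n}"
      proof
        assume "int n \<in> (\<lambda>p. p + ?M) ` {p \<in> ?O. p < int n}"
        then obtain p where "p \<in> ?O" "p < int n" "int n = p + ?M" by blast
        then show False using in0'(2)[of p] by simp
      qed
      have "insert x (A \<union> C - {y}) = (A - {y}) \<union> insert x C" if "y \<notin> C" for x y :: int and A C
        using that by blast
      from this[OF e2] show ?thesis unfolding T(3) i1 e1 image_insert .
    qed
    have c2: "card S1 = card S"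
    proof -
      have "finite S0" using w0 by (simp add: web_def)
      moreover have "?F (int n) \<notin> S0" using target_notin[OF w0, of "int n"] Fn in0[OF nn] by simp
      ultimately show ?thesis using i2 card_Suc_Diff1[OF _ True] Fn unfolding T(2) by simp
    qed
    have c3: "target ?M S1 b1 g1 p = ?F p \<and> hue S1 b1 g1 p = hue S b g p \<and> hue S1 g1 b1 p = hue S g b p"
      if "p \<in> ?O" "int (Suc n) \<le> p" for p
    proof -
      have "int n \<le> p" "p \<noteq> int n" using that by auto
      then show ?thesis using that i3[of p] in0[of p] T(6,8,9)[of p] by metis
    qed
    have c4: "target ?M S1 b1 g1 (p + ?M) = ?F p + ?M \<and>
        hue S1 b1 g1 (p + ?M) = hue S g b p \<and> hue S1 g1 b1 (p + ?M) = hue S b g p"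
      if p: "p \<in> ?O" "p < int (Suc n)" for p
    proof (cases "p = int n")
      case True
      then show ?thesis using T(7,10,11) i3[OF nn] Fn by simp
    next
      case False
      then have "p < int n" using p by simp
      then show ?thesis using p i4[of p] in0'[of p] T(6,8,9)[of "p + ?M"] by metis
    qed
    have c5: "p \<in> S \<union> ?F ` ?O" if "p \<in> S1" "p < ?M" for p
      using that i5[of p] nn unfolding T(2) Fn by auto
    have c6: "p \<in> S \<union> ?F ` ?O" if "p \<in> ?O" "p < int (Suc n)" for p
      using that i6[of p] i5[OF True] nm by (cases "p = int n") auto
    show ?thesis unfolding turned_upto_def
      by (intro conjI ballI impI c1 c2 c5 c6) (simp_all only: c3 c4)
  qed
qed

lemma turned_upto_run:
  assumes w: "web (int m) 0 S b g" and "n \<le> m" "run (int m) (S, b, g) n = (S1, b1, g1)"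
  shows "turned_upto m S b g n S1 b1 g1"
  using assms(2,3)
proof (induction n arbitrary: S1 b1 g1)
  case 0
  then show ?case using turned_upto_0[OF w] by simp
next
  case (Suc n)
  obtain S0 b0 g0 where 0: "run (int m) (S, b, g) n = (S0, b0, g0)" by (metis prod_cases3)
  have "turned_upto m S b g n S0 b0 g0" using Suc.IH[OF _ 0] Suc.prems by simp
  moreover have "web (int m) (int n) S0 b0 g0" by (rule web_run[OF w 0])
  moreover have "turn (int m) (int n) (S0, b0, g0) = (S1, b1, g1)" using Suc.prems 0 by simp
  ultimately show ?case using turned_upto_Suc[OF w] Suc.prems by simp
qed

text \<open>Away from the starts \<open>hue\<close> is just membership in the ends, and starts are
  never ends. So the set of starts together with the hues determines the set of ends.\<close>

lemma shifted_ends: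
  fixes d :: int
  assumes S': "S' = (\<lambda>p. p + d) ` S"
    and h: "\<And>p. p \<in> Q \<Longrightarrow> hue S' b' g' (p + d) = hue S g b p"
    and sub: "g ` S \<subseteq> Q" "b' ` S' \<subseteq> (\<lambda>p. p + d) ` Q"
    and disj: "g ` S \<inter> S = {}" "b' ` S' \<inter> S' = {}"
  shows "b' ` S' = (\<lambda>p. p + d) ` g ` S"
proof -
  have *: "p + d \<in> b' ` S' \<longleftrightarrow> p \<in> g ` S" if "p \<in> Q" for p
  proof (cases "p \<in> S")
    case True
    then have "p + d \<in> S'" unfolding S' by (rule imageI)
    then show ?thesis using True disj by blast
  next
    case False
    then have "p + d \<notin> S'" unfolding S' by (simp add: image_iff)
    then show ?thesis using False h[OF that] by (simp add: hue_def)
  qed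
  show ?thesis
  proof (intro equalityI subsetI)
    fix x assume x: "x \<in> b' ` S'"
    then obtain p where p: "p \<in> Q" "x = p + d" using sub(2) by blast
    then have "p \<in> g ` S" using *[OF p(1)] x by simp
    then show "x \<in> (\<lambda>p. p + d) ` g ` S" using p(2) by blast
  next
    fix x assume "x \<in> (\<lambda>p. p + d) ` g ` S"
    then obtain p where p: "p \<in> g ` S" "x = p + d" by blast
    then show "x \<in> b' ` S'" using *[of p] sub(1) by blast
  qed
qed

text \<open>After the whole turn every occupied position is an initial A or a target, and targets
  have been shifted by \<open>m\<close>. A shifted target cannot carry an A, so all final A's are
  shifted initial ones, and equality follows by counting. The exchanged hues then determine the
  other letters.\<close>

lemma full_turn:
  assumes w: "web (int m) 0 S b g" and r: "run (int m) (S, b, g) m = (S', b', g')"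
  shows "S' = (\<lambda>p. p + int m) ` S" "b' ` S' = (\<lambda>p. p + int m) ` g ` S" "g' ` S' = (\<lambda>p. p + int m) ` b ` S"
proof -
  let ?M = "int m"
  let ?O = "occupied S b g" and ?F = "target ?M S b g"
  have O: "p \<in> ?O \<Longrightarrow> 0 \<le> p \<and> p < ?M" for p using web_occupied_ge[OF w, of p] by simp
  have I: "turned_upto m S b g m S' b' g'" using turned_upto_run[OF w _ r] by simp
  have w': "web ?M ?M S' b' g'" by (rule web_run[OF w r])
  have all: "{p \<in> ?O. ?M \<le> p} = {}" "{p \<in> ?O. p < ?M} = ?O" using O by force+
  have o': "occupied S' b' g' = (\<lambda>p. p + ?M) ` ?O"
    using I unfolding turned_upto_def all by (metis Un_empty_left)
  have F': "target ?M S' b' g' (p + ?M) = ?F p + ?M"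
    and h': "hue S' b' g' (p + ?M) = hue S g b p" "hue S' g' b' (p + ?M) = hue S b g p"
    and onto: "p \<in> S \<union> ?F ` ?O" if p: "p \<in> ?O" for p
  proof -
    have "p < ?M" using O[OF p] by simp
    then show "target ?M S' b' g' (p + ?M) = ?F p + ?M" "hue S' b' g' (p + ?M) = hue S g b p"
      "hue S' g' b' (p + ?M) = hue S b g p" "p \<in> S \<union> ?F ` ?O"
      using I p unfolding turned_upto_def by blast+
  qed
  show S': "S' = (\<lambda>p. p + ?M) ` S"
  proof (rule card_subset_eq)
    show "finite ((\<lambda>p. p + ?M) ` S)" using w by (simp add: web_def)
    have "card S' = card S" using I unfolding turned_upto_def by blast
    then show "card S' = card ((\<lambda>p. p + ?M) ` S)" by (simp add: card_image)
    show "S' \<subseteq> (\<lambda>p. p + ?M) ` S"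
    proof
      fix x assume x: "x \<in> S'"
      then have "x \<in> occupied S' b' g'" by (simp add: occupied_def)
      then obtain p where p: "p \<in> ?O" "x = p + ?M" unfolding o' by blast
      \<comment> \<open>Otherwise \<open>p\<close> would be a target, and \<open>x\<close> would be
        both a target and a start of the final web.\<close>
      have "p \<in> S"
      proof (rule ccontr)
        assume "p \<notin> S"
        then obtain r where r: "r \<in> ?O" "p = ?F r" using onto[OF p(1)] by blast
        then have "target ?M S' b' g' (r + ?M) = x" using F'[OF r(1)] p(2) by simp
        moreover have "r + ?M \<in> occupied S' b' g'" unfolding o' using r(1) by (rule imageI)
        ultimately show False using target_notin[OF w'] x by metis
      qed
      then show "x \<in> (\<lambda>p. p + ?M) ` S" unfolding p(2) by (rule imageI)
    qed
  qed
  have sub: "b ` S \<subseteq> ?O" "g ` S \<subseteq> ?O" by (simp_all add: occupied_def le_supI1 le_supI2)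
  have "b' ` S' \<subseteq> occupied S' b' g'" "g' ` S' \<subseteq> occupied S' b' g'"
    by (simp_all add: occupied_def le_supI1 le_supI2)
  note sub' = this[unfolded o']
  show "b' ` S' = (\<lambda>p. p + ?M) ` g ` S"
    by (rule shifted_ends[OF S' h'(1) sub(2) sub'(1) web_end_notin(2)[OF w] web_end_notin(1)[OF w']])
  show "g' ` S' = (\<lambda>p. p + ?M) ` b ` S"
    by (rule shifted_ends[OF S' h'(2) sub(1) sub'(2) web_end_notin(1)[OF w] web_end_notin(2)[OF w']])
qed

section \<open>Processing one slot of tokens\<close>

text \<open>
  Positions are grouped into slots of \<open>K\<close> consecutive integers; a slot stands for one value of the
  chain coordinate. The third condition makes two ends of one arc in the same slot coincide.
\<close>

definition slotted :: "int \<Rightarrow> int \<Rightarrow> int set \<Rightarrow> (int \<Rightarrow> int) \<Rightarrow> (int \<Rightarrow> int) \<Rightarrow> bool" where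
  "slotted K q S b g \<longleftrightarrow>
     (\<forall>p\<in>S. p div K < b p div K \<and> p div K < g p div K) \<and>
     (\<forall>p\<in>S. b p div K < p div K + q \<and> g p div K < p div K + q) \<and>
     (\<forall>p\<in>S. \<forall>p'\<in>S. b p div K = g p' div K \<longrightarrow>
        (p = p' \<longrightarrow> b p = g p') \<and> (p' < p \<longrightarrow> b p < g p') \<and> (p < p' \<longrightarrow> g p' < b p)) \<and>
     (\<forall>p\<in>S. \<forall>s\<in>S. s div K + q \<le> b p div K \<or> s div K + q \<le> g p div K \<longrightarrow> min (b s) (g s) < p)"

lemma slotted_flip:
  assumes "slotted K q S b g"
  shows "slotted K q S g b"
proof -
  note s = assms[unfolded slotted_def]
  show ?thesis unfolding slotted_def
  proof (intro conjI ballI impI)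
    fix p s assume "p \<in> S" "s \<in> S" "s div K + q \<le> g p div K \<or> s div K + q \<le> b p div K"
    then have "min (b s) (g s) < p" using s by blast
    then show "min (g s) (b s) < p" by (simp only: min.commute)
  next
    fix p p' assume p: "p \<in> S" "p' \<in> S" and e: "g p div K = b p' div K"
    from e have "b p' div K = g p div K" by (rule sym)
    then have c: "(p' = p \<longrightarrow> b p' = g p) \<and> (p < p' \<longrightarrow> b p' < g p) \<and> (p' < p \<longrightarrow> g p < b p')"
      using s p by blast
    show "p = p' \<Longrightarrow> g p = b p'" using c by simp
    show "p' < p \<Longrightarrow> g p < b p'" "p < p' \<Longrightarrow> b p' < g p" using c by simp_all
  qed (use s in blast)+
qed

lemma slotted_web:
  assumes K: "K > 0" and f: "finite S" and n: "noncrossing S b" "noncrossing S g"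
    and r: "\<And>p. p \<in> S \<Longrightarrow> t \<le> p \<and> b p < t + M \<and> g p < t + M" and s: "slotted K q S b g"
  shows "web M t S b g"
proof -
  have "p = p'" if "p \<in> S" "p' \<in> S" "b p = g p'" for p p'
  proof -
    have "b p div K = g p' div K" using that by simp
    then have "(p' < p \<longrightarrow> b p < g p') \<and> (p < p' \<longrightarrow> g p' < b p)"
      using s that unfolding slotted_def by blast
    then show ?thesis using that by (cases p p' rule: linorder_cases) auto
  qed
  then show ?thesis unfolding web_def using f n r by blast
qed

context web_hit begin

lemma g_owner:
  assumes "p' \<in> S1"
  shows "(p' = i \<and> g1 p' = t + M \<and> g t = i) \<or>
    (\<exists>p0\<in>S. g1 p' = g p0 \<and> ((p0 = p' \<and> p' \<noteq> t) \<or> (p0 < p' \<and> p' \<le> i \<and> p0 < i \<and> i < g p0)))"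
proof (cases "g t = i")
  case True
  then show ?thesis using assms B.iS by (auto simp: slide_def)
next
  case False
  then have lt: "i < g t" using bg by simp
  show ?thesis
  proof (cases "p' \<in> insert i (over S g i) - {t}")
    case C: True
    have "g1 p' = g (G.pr p')" using G.slide_slid[OF lt] C by simp
    moreover have "G.pr p' \<in> S" "G.pr p' < i" "i < g (G.pr p')" using G.pr_props(1)[OF lt C] by (auto simp: over_def)
    moreover have "G.pr p' < p'" using G.pr_props(2)[OF lt C] .
    moreover have "p' \<le> i" using C by (auto simp: over_def)
    ultimately show ?thesis by blast
  next
    case C: False
    then have "p' \<in> S" "p' \<noteq> t" "g1 p' = g p'" using assms G.slide_slid[OF lt, of p'] B.ti by auto
    then show ?thesis by blast
  qed
qed

lemma b_owner: "p' \<in> S1 \<Longrightarrow> (p' = i \<and> b1 p' = t + M) \<or> (p' \<in> S \<and> p' \<noteq> t \<and> p' \<noteq> i \<and> b1 p' = b p')"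
  using b1_eq b1_i B.iS by auto

text \<open>The fourth condition of \<open>slotted\<close> matters while a slot is only partly
  processed: new ends already lie \<open>q\<close> slots ahead of the starts still waiting. It says
  that a waiting start has its nearer end before the owner of such a new end. When it is turned, it
  thus creates a smaller start with a later end, as the opposite ordering within a slot
  requires.\<close>

lemma slotted_next:
  assumes K: "K > 0" and M: "M = q * K" and s: "slotted K q S b g"
  shows "slotted K q S1 b1 g1"
proof -
  have T: "(t + M) div K = t div K + q" using K M by simp
  have div_le: "x \<le> y \<Longrightarrow> x div K \<le> y div K" for x y using K by (simp add: zdiv_mono1)
  have s1: "p div K < b p div K" "p div K < g p div K" if "p \<in> S" for p
    using s that unfolding slotted_def by blast+
  have s2: "b p div K < p div K + q" "g p div K < p div K + q" if "p \<in> S" for p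
    using s that unfolding slotted_def by blast+
  have s3: "(p = p' \<longrightarrow> b p = g p') \<and> (p' < p \<longrightarrow> b p < g p') \<and> (p < p' \<longrightarrow> g p' < b p)"
    if "p \<in> S" "p' \<in> S" "b p div K = g p' div K" for p p'
    using s that unfolding slotted_def by blast
  have s4: "min (b s) (g s) < p" if "p \<in> S" "s \<in> S" "s div K + q \<le> b p div K \<or> s div K + q \<le> g p div K" for p s
    using s that unfolding slotted_def by blast
  have i_slot: "t div K < i div K" "i div K < t div K + q" using s1[OF t] s2[OF t] by auto
  \<comment> \<open>The fourth condition with \<open>s = t\<close>: every arc already reaching the
    slot of \<open>t + M\<close> starts after the new start \<open>i\<close>.\<close>
  have last: "i < p" if "p \<in> S" "b p div K = t div K + q \<or> g p div K = t div K + q" for p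
    using s4[OF that(1) t] that(2) bg by (auto simp: min_def)
  \<comment> \<open>Were the slots equal, the third condition with \<open>t \<le> p0\<close> would
    put the end of \<open>p0\<close> at \<open>i\<close> or before it.\<close>
  have far: "i div K < g p0 div K" if "p0 \<in> S" "p0 < i" "i < g p0" for p0
  proof (rule ccontr)
    assume "\<not> i div K < g p0 div K"
    then have "b t div K = g p0 div K" using div_le[of i "g p0"] that by simp
    from s3[OF t that(1) this] show False using that B.t_min[OF that(1)] by (cases "t = p0") auto
  qed
  have range: "b1 p div K \<le> t div K + q" "g1 p div K \<le> t div K + q" if "p \<in> S1" for p
    using div_le[OF B.slide_le_T[OF that]] div_le[OF G.slide_le_T[OF that]] T by auto
  have g_cases: "\<lbrakk>p' = i \<Longrightarrow> g1 p' = t + M \<Longrightarrow> Q; p' \<in> S \<Longrightarrow> p' \<noteq> t \<Longrightarrow> p' \<noteq> i \<Longrightarrow> g1 p' = g p' \<Longrightarrow> Q;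
     \<And>p0. p0 \<in> S \<Longrightarrow> g1 p' = g p0 \<Longrightarrow> p0 < p' \<Longrightarrow> p' \<le> i \<Longrightarrow> p0 < i \<Longrightarrow> i < g p0 \<Longrightarrow> Q\<rbrakk> \<Longrightarrow> Q"
    if "p' \<in> S1" for p' Q
    using g_owner[OF that] B.iS by blast
  show ?thesis unfolding slotted_def
  proof (intro conjI ballI impI)
    fix p assume p: "p \<in> S1"
    show "p div K < b1 p div K" using b_owner[OF p] T i_slot s1 by auto
    show "p div K < g1 p div K"
    proof (rule g_cases[OF p])
      fix p0 assume a: "p0 \<in> S" "g1 p = g p0" "p0 < p" "p \<le> i" "p0 < i" "i < g p0"
      then show ?thesis using far[OF a(1,5,6)] div_le[OF a(4)] by simp
    qed (use T i_slot s1 in auto)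
    show "b1 p div K < p div K + q" using b_owner[OF p] T i_slot s2 by auto
    show "g1 p div K < p div K + q"
    proof (rule g_cases[OF p])
      fix p0 assume a: "p0 \<in> S" "g1 p = g p0" "p0 < p"
      then show ?thesis using s2(2)[OF a(1)] div_le[of p0 p] by simp
    qed (use T i_slot s2 in auto)
  next
    fix p p' assume p: "p \<in> S1" and p': "p' \<in> S1" and eq: "b1 p div K = g1 p' div K"
    have "(p = p' \<longrightarrow> b1 p = g1 p') \<and> (p' < p \<longrightarrow> b1 p < g1 p') \<and> (p < p' \<longrightarrow> g1 p' < b1 p)"
      using b_owner[OF p]
    proof
      assume a: "p = i \<and> b1 p = t + M"
      then have e: "g1 p' div K = t div K + q" using eq T by metis
      show ?thesis
      proof (rule g_cases[OF p'])
        assume "p' \<in> S" "g1 p' = g p'"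
        then show ?thesis using last[of p'] e a end_less(2)[of p'] by auto
      next
        fix p0 assume a: "p0 \<in> S" "g1 p' = g p0" "p0 < i"
        then show ?thesis using last[of p0] e by auto
      qed (use a in auto)
    next
      assume a: "p \<in> S \<and> p \<noteq> t \<and> p \<noteq> i \<and> b1 p = b p"
      show ?thesis
      proof (rule g_cases[OF p'])
        assume w: "p' = i" "g1 p' = t + M"
        then have "i < p" using last[of p] a eq T by simp
        then show ?thesis using w a end_less(1)[of p] by auto
      next
        assume c: "p' \<in> S" "g1 p' = g p'"
        from a have bp: "p \<in> S" "b1 p = b p" by blast+
        show ?thesis using s3[OF bp(1) c(1)] eq unfolding bp(2) c(2) by blast
      next
        fix p0 assume c: "p0 \<in> S" "g1 p' = g p0" "p0 < p'" "p' \<le> i" "p0 < i" "i < g p0"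
        have e: "b p div K = g p0 div K" using a c eq by simp
        have "i < p"
        proof (rule ccontr)
          assume "\<not> i < p"
          then have "b p < i" using a B.inside_end[of p] by auto
          then have "b p div K \<le> i div K" using div_le by simp
          then show False using e far[OF c(1,5,6)] by simp
        qed
        moreover from a have bp: "p \<in> S" "b1 p = b p" by blast+
        ultimately show ?thesis using s3[OF bp(1) c(1) e] c unfolding bp(2) c(2) by auto
      qed
    qed
    then show "p = p' \<Longrightarrow> b1 p = g1 p'" "p' < p \<Longrightarrow> b1 p < g1 p'" "p < p' \<Longrightarrow> g1 p' < b1 p" by blast+
  next
    fix p s assume p: "p \<in> S1" and s: "s \<in> S1"
      and e: "s div K + q \<le> b1 p div K \<or> s div K + q \<le> g1 p div K"
    show "min (b1 s) (g1 s) < p"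
    proof (cases "s = i")
      case True
      then show ?thesis using range[OF p] e i_slot by auto
    next
      case False
      then have sS: "s \<in> S" "s \<noteq> t" using s by auto
      have "s \<in> occupied S b g" using sS by (simp add: occupied_def)
      then have F: "min (b1 s) (g1 s) = min (b s) (g s)"
        using target_next[of s] sS s by (simp add: target_def)
      have "(p = i \<and> s div K \<le> t div K) \<or> (\<exists>p0\<in>S. p0 \<le> p \<and> (s div K + q \<le> b p0 div K \<or> s div K + q \<le> g p0 div K))"
        using e
      proof
        assume e: "s div K + q \<le> b1 p div K"
        show ?thesis using b_owner[OF p] e T by auto
      next
        assume e: "s div K + q \<le> g1 p div K"
        show ?thesis by (rule g_cases[OF p]) (use e T in force)+
      qed
      then show ?thesis
      proof
        assume a: "p = i \<and> s div K \<le> t div K"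
        have "s < i"
        proof (rule ccontr)
          assume "\<not> s < i"
          then have "i div K \<le> s div K" using div_le by simp
          then show False using a i_slot by simp
        qed
        then have "b s < i" using B.inside_end sS by simp
        then show ?thesis unfolding F using a by simp
      next
        assume "\<exists>p0\<in>S. p0 \<le> p \<and> (s div K + q \<le> b p0 div K \<or> s div K + q \<le> g p0 div K)"
        then obtain p0 where "p0 \<in> S" "p0 \<le> p" "s div K + q \<le> b p0 div K \<or> s div K + q \<le> g p0 div K" by blast
        then have "min (b s) (g s) < p0" using s4 sS by blast
        then show ?thesis unfolding F using \<open>p0 \<le> p\<close> by simp
      qed
    qed
  qed
qed

end

lemma slotted_turn:
  assumes K: "K > 0" and w: "web (q * K) t S b g" and s: "slotted K q S b g"
    and e: "turn (q * K) t (S, b, g) = (S', b', g')"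
  shows "slotted K q S' b' g'"
proof (cases "t \<in> S")
  case False
  then show ?thesis using e s by (simp add: turn_def)
next
  case t: True
  show ?thesis
  proof (cases "b t \<le> g t")
    case True
    interpret web_hit "q * K" t S b g using w t True by unfold_locales
    have "S' = S1" "b' = b1" "g' = g1" using e t True by (simp_all add: turn_def Let_def min_def)
    then show ?thesis using slotted_next[OF K refl s] by simp
  next
    case False
    interpret web_hit "q * K" t S g b using web_flip[OF w] t False by unfold_locales auto
    have "S' = S1" "b' = g1" "g' = b1" using e t False by (simp_all add: turn_def Let_def min_def)
    then show ?thesis using slotted_flip[OF slotted_next[OF K refl slotted_flip[OF s]]] by simp
  qed
qed

lemma slotted_run:
  assumes K: "K > 0" and w: "web (q * K) 0 S b g" and s: "slotted K q S b g"
    and r: "run (q * K) (S, b, g) n = (S', b', g')"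
  shows "slotted K q S' b' g'"
  using r
proof (induction n arbitrary: S' b' g')
  case (Suc n)
  obtain S1 b1 g1 where 1: "run (q * K) (S, b, g) n = (S1, b1, g1)" by (metis prod_cases3)
  show ?case using slotted_turn[OF K web_run[OF w 1] Suc.IH[OF 1]] Suc.prems 1 by simp
qed (use s in simp)

text \<open>If the arcs starting in a block of positions all end beyond it, no A created meanwhile
  is processed within the block. Because targets and hues of the waiting starts do not change, the
  successive turns amount to one simultaneous replacement expressed by the initial \<open>b\<close>
  and \<open>g\<close>, although the arcs are reattached after every turn.\<close>

lemma block_run:
  fixes n0 k :: nat
  defines "F \<equiv> \<lambda>b g (p::int). min (b p) (g p :: int)"
  assumes w: "web M 0 S0 b0 g0" and r0: "run M (S0, b0, g0) n0 = (S, b, g)"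
    and far: "\<And>p. p \<in> S \<Longrightarrow> p < int (n0 + k) \<Longrightarrow> int (n0 + k) \<le> b p \<and> int (n0 + k) \<le> g p"
    and j: "j \<le> k" and r: "run M (S0, b0, g0) (n0 + j) = (S', b', g')"
  shows "S' = {p \<in> S. int (n0 + j) \<le> p} \<union> F b g ` {p \<in> S. p < int (n0 + j)} \<and>
    b' ` S' = (b ` S - F b g ` {p \<in> S. p < int (n0 + j) \<and> b p \<le> g p}) \<union> (\<lambda>p. p + M) ` {p \<in> S. p < int (n0 + j) \<and> b p \<le> g p} \<and>
    g' ` S' = (g ` S - F b g ` {p \<in> S. p < int (n0 + j) \<and> g p \<le> b p}) \<union> (\<lambda>p. p + M) ` {p \<in> S. p < int (n0 + j) \<and> g p \<le> b p} \<and>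
    (\<forall>p\<in>S. int (n0 + j) \<le> p \<longrightarrow> target M S' b' g' p = F b g p \<and>
       (hue S' g' b' p \<longleftrightarrow> b p \<le> g p) \<and> (hue S' b' g' p \<longleftrightarrow> g p \<le> b p))"
  using j r
proof (induction j arbitrary: S' b' g')
  case 0
  have w0: "web M (int n0) S b g" by (rule web_run[OF w r0])
  have e: "S' = S" "b' = b" "g' = g" using 0 r0 by auto
  have lt: "\<not> p < int (n0 + 0)" "int (n0 + 0) \<le> p" if "p \<in> S" for p
    using w0 that by (auto simp: web_def not_less)
  have "{p \<in> S. int (n0 + 0) \<le> p} = S" "\<And>Q. {p \<in> S. p < int (n0 + 0) \<and> Q p} = {}" "{p \<in> S. p < int (n0 + 0)} = {}"
    using lt by blast+
  note eqs = this
  show ?case unfolding e eqs image_empty Diff_empty Un_empty_right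
    by (simp add: target_def hue_def F_def)
next
  case (Suc j)
  obtain S1 b1 g1 where 1: "run M (S0, b0, g0) (n0 + j) = (S1, b1, g1)" by (metis prod_cases3)
  define t where "t = int (n0 + j)"
  have t1: "int (n0 + Suc j) = t + 1" by (simp add: t_def)
  note IH = Suc.IH[OF _ 1, folded t_def]
  have jk: "j \<le> k" and tk: "t < int (n0 + k)" using Suc.prems by (auto simp: t_def)
  note i1 = IH[OF jk, THEN conjunct1]
    and i2 = IH[OF jk, THEN conjunct2, THEN conjunct1]
    and i3 = IH[OF jk, THEN conjunct2, THEN conjunct2, THEN conjunct1]
    and i' = IH[OF jk, THEN conjunct2, THEN conjunct2, THEN conjunct2, rule_format]
  have i4: "target M S1 b1 g1 p = F b g p"
    and i5: "hue S1 g1 b1 p \<longleftrightarrow> b p \<le> g p" and i6: "hue S1 b1 g1 p \<longleftrightarrow> g p \<le> b p"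
    if "p \<in> S" "t \<le> p" for p
    using i'[OF that] by simp_all
  have w0: "web M (int n0) S b g" by (rule web_run[OF w r0])
  have w1: "web M t S1 b1 g1" unfolding t_def by (rule web_run[OF w 1])
  have e: "turn M t (S1, b1, g1) = (S', b', g')" using Suc.prems 1 by (simp add: t_def)
  have Ffar: "t < F b g p" if "p \<in> S" "p < t" for p
    using far[OF that(1)] that(2) tk unfolding F_def by linarith
  then have tF: "t \<notin> F b g ` {p \<in> S. p < t}" by force
  have tS: "t \<in> S1 \<longleftrightarrow> t \<in> S" using tF unfolding i1 by blast
  show ?case unfolding t1
  proof (cases "t \<in> S")
    case False
    then have e: "S' = S1" "b' = b1" "g' = g1" using e tS by (auto simp: turn_def)
    have le: "p < t + 1 \<longleftrightarrow> p < t" "t + 1 \<le> p \<longleftrightarrow> t \<le> p" if "p \<in> S" for p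
    proof -
      have "p \<noteq> t" using False that by auto
      then show "p < t + 1 \<longleftrightarrow> p < t" "t + 1 \<le> p \<longleftrightarrow> t \<le> p" by auto
    qed
    then have "{p \<in> S. t + 1 \<le> p} = {p \<in> S. t \<le> p}" "{p \<in> S. p < t + 1} = {p \<in> S. p < t}"
      "\<And>Q. {p \<in> S. p < t + 1 \<and> Q p} = {p \<in> S. p < t \<and> Q p}"
      by blast+
    note eqs = this
    show "S' = {p \<in> S. t + 1 \<le> p} \<union> F b g ` {p \<in> S. p < t + 1} \<and>
    b' ` S' = (b ` S - F b g ` {p \<in> S. p < t + 1 \<and> b p \<le> g p}) \<union> (\<lambda>p. p + M) ` {p \<in> S. p < t + 1 \<and> b p \<le> g p} \<and>
    g' ` S' = (g ` S - F b g ` {p \<in> S. p < t + 1 \<and> g p \<le> b p}) \<union> (\<lambda>p. p + M) ` {p \<in> S. p < t + 1 \<and> g p \<le> b p} \<and>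
    (\<forall>p\<in>S. t + 1 \<le> p \<longrightarrow> target M S' b' g' p = F b g p \<and>
       (hue S' g' b' p \<longleftrightarrow> b p \<le> g p) \<and> (hue S' b' g' p \<longleftrightarrow> g p \<le> b p))"
      unfolding eqs e using i2 i3 by (intro conjI ballI impI i1 i2 i3) (simp_all add: i4 i5 i6)
  next
    case True
    then have tS1: "t \<in> S1" using tS by simp
    note T = turn_invariants[OF w1 tS1 e]
    have Ft: "target M S1 b1 g1 t = F b g t" and ht: "hue S1 g1 b1 t \<longleftrightarrow> b t \<le> g t" "hue S1 b1 g1 t \<longleftrightarrow> g t \<le> b t"
      using i4[OF True] i5[OF True] i6[OF True] by auto
    have Z: "{p \<in> S. p < t + 1} = insert t {p \<in> S. p < t}" "{p \<in> S. t + 1 \<le> p} = {p \<in> S. t \<le> p} - {t}"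
      using True by auto
    have H: "{p \<in> S. p < t + 1 \<and> Q p} = (if Q t then insert t {p \<in> S. p < t \<and> Q p} else {p \<in> S. p < t \<and> Q p})" for Q
      using True unfolding zless_add1_eq by auto
    have FM: "F b g t \<notin> (\<lambda>p. p + M) ` {p \<in> S. p < t \<and> Q p}" for Q
    proof
      assume "F b g t \<in> (\<lambda>p. p + M) ` {p \<in> S. p < t \<and> Q p}"
      then obtain p where "p \<in> S" "F b g t = p + M" by blast
      moreover have "F b g t < int n0 + M" "int n0 \<le> p" using w0 True \<open>p \<in> S\<close> by (auto simp: web_def F_def min_def)
      ultimately show False by simp
    qed
    have set1: "insert y ((A \<union> B) - {x}) = (A - {x}) \<union> insert y B" if "x \<notin> B" for x y :: int and A B
      using that by blast
    have set2: "insert z (((A - B) \<union> C) - {y}) = (A - insert y B) \<union> insert z C" if "y \<notin> C" for y z :: int and A B C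
      using that by blast
    have c1: "S' = {p \<in> S. t + 1 \<le> p} \<union> F b g ` {p \<in> S. p < t + 1}"
      unfolding T(2) Ft unfolding i1 Z image_insert by (rule set1[OF tF])
    have c2: "b' ` S' = (b ` S - F b g ` {p \<in> S. p < t + 1 \<and> b p \<le> g p}) \<union> (\<lambda>p. p + M) ` {p \<in> S. p < t + 1 \<and> b p \<le> g p}"
    proof (cases "b t \<le> g t")
      case True
      then show ?thesis unfolding T(4) H ht(1) Ft i2 if_P[OF True] image_insert by (intro set2 FM)
    next
      case False
      then show ?thesis unfolding T(4) H ht(1) Ft if_not_P[OF False] by (rule_tac i2)
    qed
    have c3: "g' ` S' = (g ` S - F b g ` {p \<in> S. p < t + 1 \<and> g p \<le> b p}) \<union> (\<lambda>p. p + M) ` {p \<in> S. p < t + 1 \<and> g p \<le> b p}"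
    proof (cases "g t \<le> b t")
      case True
      then show ?thesis unfolding T(5) H ht(2) Ft i3 if_P[OF True] image_insert by (intro set2 FM)
    next
      case False
      then show ?thesis unfolding T(5) H ht(2) Ft if_not_P[OF False] by (rule_tac i3)
    qed
    have c4: "target M S' b' g' p = F b g p \<and> (hue S' g' b' p \<longleftrightarrow> b p \<le> g p) \<and> (hue S' b' g' p \<longleftrightarrow> g p \<le> b p)"
      if p: "p \<in> S" "t + 1 \<le> p" for p
    proof -
      have "p \<in> occupied S1 b1 g1" "p \<noteq> t" "t \<le> p" using p unfolding occupied_def i1 by auto
      then show ?thesis using T(6,8,9)[of p] i4[OF p(1)] i5[OF p(1)] i6[OF p(1)] by simp
    qed
    show "S' = {p \<in> S. t + 1 \<le> p} \<union> F b g ` {p \<in> S. p < t + 1} \<and>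
    b' ` S' = (b ` S - F b g ` {p \<in> S. p < t + 1 \<and> b p \<le> g p}) \<union> (\<lambda>p. p + M) ` {p \<in> S. p < t + 1 \<and> b p \<le> g p} \<and>
    g' ` S' = (g ` S - F b g ` {p \<in> S. p < t + 1 \<and> g p \<le> b p}) \<union> (\<lambda>p. p + M) ` {p \<in> S. p < t + 1 \<and> g p \<le> b p} \<and>
    (\<forall>p\<in>S. t + 1 \<le> p \<longrightarrow> target M S' b' g' p = F b g p \<and>
       (hue S' g' b' p \<longleftrightarrow> b p \<le> g p) \<and> (hue S' b' g' p \<longleftrightarrow> g p \<le> b p))"
      by (intro conjI c1 c2 c3 ballI impI c4)
  qed
qed

subsection \<open>Counting rules for one slot\<close>

text \<open>Two upper sets of a finite chain are comparable, so one contains the other.\<close>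

lemma upset_card:
  fixes U V Z :: "int set"
  assumes "finite Z" "U \<subseteq> Z" "V \<subseteq> Z"
    and "\<And>x y. x \<in> U \<Longrightarrow> y \<in> Z \<Longrightarrow> x < y \<Longrightarrow> y \<in> U" "\<And>x y. x \<in> V \<Longrightarrow> y \<in> Z \<Longrightarrow> x < y \<Longrightarrow> y \<in> V"
  shows "int (card (U \<union> V)) = max (int (card U)) (int (card V))"
    "int (card (U - V)) = max 0 (int (card U) - int (card V))"
proof -
  have f: "finite U" "finite V" using assms finite_subset by blast+
  have "U \<subseteq> V \<or> V \<subseteq> U"
  proof (rule ccontr)
    assume "\<not> (U \<subseteq> V \<or> V \<subseteq> U)"
    then obtain x y where "x \<in> U" "x \<notin> V" "y \<in> V" "y \<notin> U" by blast
    then show False using assms by (cases x y rule: linorder_cases) blast+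
  qed
  then have "int (card (U \<union> V)) = max (int (card U)) (int (card V)) \<and>
    int (card (U - V)) = max 0 (int (card U) - int (card V))"
  proof
    assume s: "U \<subseteq> V"
    then have "U - V = {}" by blast
    then have "card (U - V) = 0" by (simp only: card.empty)
    moreover from s have "U \<union> V = V" "card U \<le> card V" using f card_mono by auto
    ultimately show ?thesis by simp
  next
    assume s: "V \<subseteq> U"
    then have "U \<union> V = U" "card (U - V) = card U - card V" "card V \<le> card U" using f card_mono card_Diff_subset by auto
    then show ?thesis by simp
  qed
  then show "int (card (U \<union> V)) = max (int (card U)) (int (card V))"
    "int (card (U - V)) = max 0 (int (card U) - int (card V))" by auto
qed
lemma div_le_iff_less:
  fixes K :: int
  assumes "K > 0"
  shows "p div K \<le> T \<longleftrightarrow> p < (T + 1) * K"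
proof -
  obtain d m where dm: "d = p div K" "m = p mod K" by blast
  have p: "p = K * d + m" unfolding dm by (rule mult_div_mod_eq[symmetric])
  have m: "0 \<le> m" "m < K" unfolding dm using assms by (rule pos_mod_sign, rule pos_mod_bound)
  have e: "(T + 1) * K = K * T + K" "K * (T + 1) = K * T + K" by (simp_all add: algebra_simps)
  have "d \<le> T \<longleftrightarrow> p < (T + 1) * K"
  proof
    assume "d \<le> T"
    then have "K * d \<le> K * T" using assms by simp
    then have "p < K * T + K" using p m by linarith
    then show "p < (T + 1) * K" unfolding e .
  next
    assume a: "p < (T + 1) * K"
    show "d \<le> T"
    proof (rule ccontr)
      assume "\<not> d \<le> T"
      then have "K * (T + 1) \<le> K * d" using assms by simp
      then have "K * T + K \<le> K * d" unfolding e .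
      then show False using a[unfolded e] p m by linarith
    qed
  qed
  then show ?thesis unfolding dm .
qed

text \<open>
  \<open>A s\<close> and \<open>B s\<close> count the tokens in slots before \<open>s\<close>. A start in the current slot \<open>T\<close> whose arc ends
  in slot \<open>s\<close> lies below all other starts in slots before \<open>s\<close>, which forces their arcs to end by then.
\<close>

lemma slot_rules:
  fixes K q T :: int
  assumes K: "K > 0" and w: "web (q * K) (T * K) S b g" and s: "slotted K q S b g"
  defines "F \<equiv> \<lambda>p. min (b p) (g p)" and "Z \<equiv> {p \<in> S. p < (T + 1) * K}"
  assumes S': "S' = (S - Z) \<union> F ` Z"
    and BE': "BE' = (b ` S - F ` {p \<in> Z. b p \<le> g p}) \<union> (\<lambda>p. p + q * K) ` {p \<in> Z. b p \<le> g p}"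
    and cA: "\<And>s. A s = int (card {p \<in> S. p div K < s})" and cA': "\<And>s. A' s = int (card {p \<in> S'. p div K < s})"
    and cB: "\<And>s. B s = int (card {p \<in> b ` S. p div K < s})" and cB': "\<And>s. B' s = int (card {p \<in> BE'. p div K < s})"
    and cC: "\<And>s. C s = int (card {p \<in> g ` S. p div K < s})"
    and x: "T < x"
  shows "A' (x + 1) + A x = A (x + 1) + max (A' x) (max (B (x + 1)) (C (x + 1)))"
    "x + 1 \<le> T + q \<Longrightarrow> B' (x + 1) + B x = B' x + min (B (x + 1)) (A' x)"
proof -
  have fin: "finite S" and nb: "noncrossing S b" and ng: "noncrossing S g" using w by (auto simp: web_def)
  have s1: "p div K < b p div K" "p div K < g p div K" if "p \<in> S" for p
    using s that unfolding slotted_def by blast+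
  have s3: "b p = g p" if "p \<in> S" "b p div K = g p div K" for p
    using s that unfolding slotted_def by blast
  have div_le: "x \<le> y \<Longrightarrow> x div K \<le> y div K" for x y using K by (simp add: zdiv_mono1)
  have TK: "p < (T + 1) * K \<longleftrightarrow> p div K \<le> T" for p using div_le_iff_less[OF K] by simp
  have Sge: "T \<le> p div K" if "p \<in> S" for p
  proof -
    have "T * K \<le> p" using w that by (auto simp: web_def)
    then show ?thesis using div_le[of "T * K" p] K by simp
  qed
  have Z: "Z = {p \<in> S. p div K = T}" unfolding Z_def TK using Sge by force
  have fZ: "finite Z" and ZS: "Z \<subseteq> S" using fin by (auto simp: Z)
  \<comment> \<open>The starts of the current slot whose \<open>e\<close>-arc ends before slot
    \<open>y\<close>. Inner arcs end earlier, so this is an upper set of \<open>Z\<close>.\<close>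
  define N where "N = (\<lambda>(e :: int \<Rightarrow> int) y. {z \<in> Z. e z div K < y})"
  have NZ: "N e y \<subseteq> Z" for e y by (auto simp: N_def)
  have fN[simp]: "finite (N e y)" for e y using fZ by (simp add: N_def)
  let ?W = "\<lambda>y. {p \<in> S - Z. p div K < y}"
  have fW[simp]: "finite (?W y)" for y using fin by simp
  have after: "z < y" if "z \<in> Z" "y \<in> S - Z" for z y
  proof -
    have "z div K < y div K" using that Sge[of y] by (auto simp: Z)
    then show ?thesis using div_le[of y z] by linarith
  qed
  have nest: "e y < e z" if "noncrossing S e" "z \<in> S" "y \<in> S" "z < y" "y div K < e z div K" for e z y
    using noncrossing_nested[OF that(1-4)] div_le[of "e z" y] that(5) by linarith
  have A_W: "A y = int (card Z) + int (card (?W y))" if "T < y" for y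
  proof -
    have "{p \<in> S. p div K < y} = Z \<union> ?W y" using that by (auto simp: Z)
    moreover have "card (Z \<union> ?W y) = card Z + card (?W y)" by (intro card_Un_disjoint fZ fW) auto
    ultimately show ?thesis unfolding cA by simp
  qed
  have E_card: "card {p \<in> e ` S. p div K < y} = card {p \<in> S. e p div K < y}" if "noncrossing S e" for e y
  proof -
    have "{p \<in> e ` S. p div K < y} = e ` {p \<in> S. e p div K < y}" by auto
    then show ?thesis using noncrossing_inj_on[OF that] by (simp add: card_image inj_on_def)
  qed
  \<comment> \<open>Every end before slot \<open>x + 1\<close> belongs to \<open>N e (x + 1)\<close>
    or to a later start in a slot before \<open>x\<close>; this bounds their number. If some arc
    from \<open>Z\<close> ends in slot \<open>x\<close>, it encloses all those later starts, and the
    bound is attained; if none does, \<open>N\<close> does not grow.\<close>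
  have N_rule: "int (card (N e (x + 1))) = max (int (card (N e x))) (int (card {p \<in> e ` S. p div K < x + 1}) - int (card (?W x)))"
    if e: "noncrossing S e" "\<And>p. p \<in> S \<Longrightarrow> p div K < e p div K" for e
  proof -
    have sub: "{p \<in> S. e p div K < x + 1} \<subseteq> N e (x + 1) \<union> ?W x" using e(2) by (force simp: N_def)
    have disj: "card (N e (x + 1) \<union> ?W x) = card (N e (x + 1)) + card (?W x)"
      by (intro card_Un_disjoint fN fW) (auto simp: N_def)
    have mono: "card (N e x) \<le> card (N e (x + 1))" by (intro card_mono fN) (auto simp: N_def)
    have le: "card {p \<in> S. e p div K < x + 1} \<le> card (N e (x + 1)) + card (?W x)"
      using card_mono[OF finite_UnI[OF fN fW] sub] disj by simp
    show ?thesis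
    proof (cases "N e (x + 1) = N e x")
      case True
      then show ?thesis using le unfolding E_card[OF e(1)] True by linarith
    next
      case False
      then obtain z where z: "z \<in> Z" "e z div K = x" by (force simp: N_def)
      have "?W x \<subseteq> {p \<in> S. e p div K < x + 1}"
      proof
        fix y assume y: "y \<in> ?W x"
        then have "e y < e z" using nest[OF e(1), of z y] after[of z y] z ZS by auto
        then show "y \<in> {p \<in> S. e p div K < x + 1}" using div_le[of "e y" "e z"] z y by simp
      qed
      then have "{p \<in> S. e p div K < x + 1} = N e (x + 1) \<union> ?W x" using sub ZS by (auto simp: N_def)
      then have "card {p \<in> S. e p div K < x + 1} = card (N e (x + 1)) + card (?W x)" by (simp only: disj)
      then show ?thesis using mono unfolding E_card[OF e(1)] by linarith
    qed
  qed
  have N_up: "y' \<in> N e y" if "noncrossing S e" "\<And>p. p \<in> S \<Longrightarrow> p div K < e p div K" "z \<in> N e y" "y' \<in> Z" "z < y'" for e y z y'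
  proof -
    have "y' div K < e z div K" using that(2)[of z] that(3,4) by (auto simp: N_def Z)
    then have "e y' < e z" using nest[OF that(1), of z y'] that(3-5) ZS by (auto simp: N_def)
    then show ?thesis using div_le[of "e y'" "e z"] that(3,4) by (simp add: N_def)
  qed
  have F_less: "F y < F z" if "z \<in> Z" "y \<in> Z" "z < y" for z y
  proof -
    have zy: "z \<in> S" "y \<in> S" "y div K = z div K" using that by (auto simp: Z)
    have "b y < b z" "g y < g z"
      using nest[OF nb zy(1,2) that(3)] nest[OF ng zy(1,2) that(3)] s1[OF zy(1)] zy(3) by auto
    then show ?thesis by (auto simp: F_def)
  qed
  have F_inj: "inj_on F Z"
  proof (rule inj_onI)
    fix u v assume "u \<in> Z" "v \<in> Z" "F u = F v"
    then show "u = v" using F_less[of u v] F_less[of v u] by (cases u v rule: linorder_cases) auto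
  qed
  have F_notin: "F z \<notin> S" if "z \<in> S" for z
    using noncrossing_not_end[OF nb that, of "F z"] noncrossing_not_end[OF ng that, of "F z"]
    unfolding F_def min_def by metis
  have F_div: "F z div K < y \<longleftrightarrow> b z div K < y \<or> g z div K < y" for z y
    using div_le[of "b z" "g z"] div_le[of "g z" "b z"] by (auto simp: F_def min_def)
  have NF: "{z \<in> Z. F z div K < y} = N b y \<union> N g y" for y by (auto simp: N_def F_div)
  have NF_card: "int (card (N b y \<union> N g y)) = max (int (card (N b y))) (int (card (N g y)))" for y
    by (rule upset_card[OF fZ]) (use N_up[OF nb s1(1)] N_up[OF ng s1(2)] in \<open>auto simp: N_def\<close>)
  \<comment> \<open>New A's sit at nearer ends. One lies before slot \<open>y\<close> if either arc
    ends before \<open>y\<close>, which gives a union of two comparable sets and hence the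
    maximum.\<close>
  have A'_W: "A' y = int (card (?W y)) + max (int (card (N b y))) (int (card (N g y)))" for y
  proof -
    have "{p \<in> S'. p div K < y} = ?W y \<union> F ` {z \<in> Z. F z div K < y}" unfolding S' by auto
    moreover have "?W y \<inter> F ` {z \<in> Z. F z div K < y} = {}" using F_notin ZS by blast
    then have "card (?W y \<union> F ` {z \<in> Z. F z div K < y}) = card (?W y) + card (F ` {z \<in> Z. F z div K < y})"
      by (rule card_Un_disjoint[OF fW finite_imageI, rotated]) (use fZ in simp)
    moreover have "card (F ` {z \<in> Z. F z div K < y}) = card {z \<in> Z. F z div K < y}"
      using F_inj by (intro card_image) (auto simp: inj_on_def)
    ultimately have "card {p \<in> S'. p div K < y} = card (?W y) + card {z \<in> Z. F z div K < y}"
      by (simp only:)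
    then show ?thesis unfolding cA' NF using NF_card[of y] by simp
  qed
  have ruleB: "int (card (N b (x + 1))) = max (int (card (N b x))) (B (x + 1) - int (card (?W x)))"
    unfolding cB by (rule N_rule[OF nb s1(1)])
  have ruleC: "int (card (N g (x + 1))) = max (int (card (N g x))) (C (x + 1) - int (card (?W x)))"
    unfolding cC by (rule N_rule[OF ng s1(2)])
  show "A' (x + 1) + A x = A (x + 1) + max (A' x) (max (B (x + 1)) (C (x + 1)))"
    using A_W[of x] A_W[of "x + 1"] x A'_W[of x] A'_W[of "x + 1"] ruleB ruleC by linarith
  show "B' (x + 1) + B x = B' x + min (B (x + 1)) (A' x)" if xq: "x + 1 \<le> T + q"
  proof -
    define H where "H = {p \<in> Z. b p \<le> g p}"
    have HS: "H \<subseteq> S" using ZS by (auto simp: H_def)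
    have "F ` H = b ` H" by (rule image_cong) (auto simp: H_def F_def)
    then have BE: "BE' = (b ` (S - H)) \<union> (\<lambda>p. p + q * K) ` H"
      unfolding BE' H_def[symmetric] using inj_on_image_set_diff[OF noncrossing_inj_on[OF nb], of S H] HS by auto
    \<comment> \<open>The reborn letters are in slot \<open>T + q\<close>, so before that slot only
      the used-up ends make a difference.\<close>
    have B'_eq: "B' y = B y - int (card {z \<in> H. b z div K < y})" if "y \<le> T + q" for y
    proof -
      have "(z + q * K) div K = T + q" if "z \<in> H" for z using that K by (simp add: H_def Z)
      then have "{p \<in> BE'. p div K < y} = b ` {p \<in> S - H. b p div K < y}"
        unfolding BE using \<open>y \<le> T + q\<close> by auto
      then have "card {p \<in> BE'. p div K < y} = card {p \<in> S - H. b p div K < y}"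
        using noncrossing_inj_on[OF nb] by (simp add: card_image inj_on_def)
      also have "{p \<in> S - H. b p div K < y} = {p \<in> S. b p div K < y} - {z \<in> H. b z div K < y}" by auto
      also have "card \<dots> = card {p \<in> S. b p div K < y} - card {z \<in> H. b z div K < y}"
        using HS fin finite_subset[OF HS fin] by (intro card_Diff_subset) auto
      finally have "card {p \<in> BE'. p div K < y} = card {p \<in> S. b p div K < y} - card {z \<in> H. b z div K < y}" .
      moreover have "card {z \<in> H. b z div K < y} \<le> card {p \<in> S. b p div K < y}"
        using HS fin by (intro card_mono) auto
      ultimately show ?thesis unfolding cB cB' E_card[OF nb] by simp
    qed
    have "{z \<in> H. b z div K < x + 1} = {z \<in> H. b z div K < x} \<union> {z \<in> H. b z div K = x}" by auto
    moreover have "finite H" using fZ by (simp add: H_def)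
    ultimately have step: "card {z \<in> H. b z div K < x + 1} = card {z \<in> H. b z div K < x} + card {z \<in> H. b z div K = x}"
      by (simp add: card_Un_disjoint disjoint_iff)
    \<comment> \<open>The B's used up in slot \<open>x\<close> belong to A's whose C was not reached
      in an earlier slot. If both letters are in slot \<open>x\<close>, the third condition of
      \<open>slotted\<close> makes the ends equal, so the B is used up as well.\<close>
    have D: "{z \<in> H. b z div K = x} = N b (x + 1) - (N b x \<union> N g x)"
    proof (intro equalityI subsetI)
      fix z assume "z \<in> {z \<in> H. b z div K = x}"
      then show "z \<in> N b (x + 1) - (N b x \<union> N g x)"
        using div_le[of "b z" "g z"] by (auto simp: H_def N_def)
    next
      fix z assume z: "z \<in> N b (x + 1) - (N b x \<union> N g x)"
      then have e: "z \<in> Z" "b z div K = x" "x \<le> g z div K" by (auto simp: N_def)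
      have "b z \<le> g z"
      proof (rule ccontr)
        assume n: "\<not> b z \<le> g z"
        then have "b z div K = g z div K" using div_le[of "g z" "b z"] e by simp
        then show False using s3[of z] e ZS n by auto
      qed
      then show "z \<in> {z \<in> H. b z div K = x}" using e by (simp add: H_def)
    qed
    have "int (card (N b (x + 1) - (N b x \<union> N g x))) = max 0 (int (card (N b (x + 1))) - int (card (N b x \<union> N g x)))"
      by (rule upset_card[OF fZ]) (use NZ N_up[OF nb s1(1)] N_up[OF ng s1(2)] in blast)+
    then show ?thesis
      using B'_eq[of x] B'_eq[of "x + 1"] xq step A'_W[of x] ruleB NF_card[of x] unfolding D by linarith
  qed
qed

subsection \<open>An arc diagram with prescribed counts\<close>

text \<open>The earliest end, in slot \<open>e\<close>, is matched to the last start before it.\<close>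

lemma ex_matching:
  fixes \<sigma> :: "int \<Rightarrow> int" and B :: "int \<Rightarrow> int"
  assumes "finite S" and "\<And>x y. x \<le> y \<Longrightarrow> B x \<le> B y" and "\<And>x. x \<le> 0 \<Longrightarrow> B x = 0"
    and "\<And>x. B (x + 1) \<le> int (card {p \<in> S. \<sigma> p < x})" and "\<And>x. Q \<le> x \<Longrightarrow> B x = int (card S)"
  shows "\<exists>m. (\<forall>x. int (card {p \<in> S. m p < x}) = B x) \<and> (\<forall>p\<in>S. \<sigma> p < (m p :: int)) \<and>
    (\<forall>p\<in>S. \<forall>p'\<in>S. p < p' \<longrightarrow> \<sigma> p' < m p \<longrightarrow> m p' \<le> m p)"
  using assms
proof (induction "card S" arbitrary: S B)
  case 0
  then have S: "S = {}" by simp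
  have "B x = 0" for x
    using 0(4)[of "min x 0"] 0(5)[of "x - 1"] 0(3)[of x] 0(3)[of "min x 0" x] 0(4)[of "min x 0"] S by force
  then show ?case using S by simp
next
  case (Suc k)
  note mono = Suc.prems(2) and zero = Suc.prems(3) and bound = Suc.prems(4) and top = Suc.prems(5)
  have cS: "card S = Suc k" using Suc by simp
  have Q: "0 < Q" using zero[of Q] top[of Q] cS by force
  define E where "E = {x. 0 \<le> x \<and> x \<le> Q \<and> B x = 0}"
  \<comment> \<open>\<open>B e = 0\<close> and \<open>B (e + 1) > 0\<close>: the earliest required
    end lies in slot \<open>e\<close>.\<close>
  define e where "e = Max E"
  have fE: "finite E" by (rule finite_subset[of _ "{0..Q}"]) (auto simp: E_def)
  have "0 \<in> E" using zero[of 0] Q by (simp add: E_def)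
  then have "e \<in> E" unfolding e_def using fE by (intro Max_in) auto
  then have e: "0 \<le> e" "e \<le> Q" "B e = 0" by (auto simp: E_def)
  have eQ: "e < Q" using e top[of Q] cS by (cases "e = Q") auto
  have "e + 1 \<notin> E"
  proof
    assume "e + 1 \<in> E"
    then have "e + 1 \<le> e" unfolding e_def using fE by (intro Max_ge)
    then show False by simp
  qed
  then have "B (e + 1) \<noteq> 0" using e eQ by (auto simp: E_def)
  then have Be: "1 \<le> B (e + 1)" using mono[of e "e + 1"] e by simp
  define C where "C = {p \<in> S. \<sigma> p < e}"
  have "card C \<noteq> 0" using bound[of e] Be by (simp add: C_def)
  then have "C \<noteq> {}" by auto
  \<comment> \<open>The last start in a slot before \<open>e\<close>. Starts after \<open>z\<close>
    lie in slot \<open>e\<close> or later, so no start is enclosed by the new arc and nesting is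
    automatic.\<close>
  define z where "z = Max C"
  have fC: "finite C" using Suc.prems(1) by (simp add: C_def)
  have zC: "z \<in> C" unfolding z_def using fC \<open>C \<noteq> {}\<close> by (intro Max_in)
  have z: "z \<in> S" "\<sigma> z < e" and z_max: "\<And>p. p \<in> S \<Longrightarrow> \<sigma> p < e \<Longrightarrow> p \<le> z"
    using zC fC by (auto simp: C_def z_def)
  \<comment> \<open>The counts that remain after removing one end from slot \<open>e\<close>; the
    bound survives because \<open>z\<close> lies in a slot before \<open>e\<close>.\<close>
  define B' where "B' = (\<lambda>x. if x \<le> e then 0 else B x - 1)"
  have card': "card (S - {z}) = k" using cS z(1) by simp
  have big: "1 \<le> B x" if "e < x" for x using mono[of "e + 1" x] that Be by simp
  have "\<exists>m. (\<forall>x. int (card {p \<in> S - {z}. m p < x}) = B' x) \<and> (\<forall>p\<in>S - {z}. \<sigma> p < (m p :: int)) \<and>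
    (\<forall>p\<in>S - {z}. \<forall>p'\<in>S - {z}. p < p' \<longrightarrow> \<sigma> p' < m p \<longrightarrow> m p' \<le> m p)"
  proof (rule Suc.hyps(1))
    show "k = card (S - {z})" "finite (S - {z})" using card' Suc.prems(1) by auto
    show "B' x \<le> B' y" if "x \<le> y" for x y
      using that mono[of x y] big[of y] by (auto simp: B'_def)
    show "B' x = 0" if "x \<le> 0" for x using that e by (simp add: B'_def)
    show "B' x = int (card (S - {z}))" if "Q \<le> x" for x
      using that eQ top[of x] cS card' by (simp add: B'_def)
    show "B' (x + 1) \<le> int (card {p \<in> S - {z}. \<sigma> p < x})" for x
    proof (cases "x + 1 \<le> e")
      case False
      have zin: "z \<in> {p \<in> S. \<sigma> p < x}" using False z by simp
      have "{p \<in> S - {z}. \<sigma> p < x} = {p \<in> S. \<sigma> p < x} - {z}" by auto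
      then have "Suc (card {p \<in> S - {z}. \<sigma> p < x}) = card {p \<in> S. \<sigma> p < x}"
        using card_Suc_Diff1[OF _ zin] Suc.prems(1) by simp
      then show ?thesis using bound[of x] False by (simp add: B'_def)
    qed (simp add: B'_def)
  qed
  then obtain m where m1: "\<And>x. int (card {p \<in> S - {z}. m p < x}) = B' x"
    and m2: "\<And>p. p \<in> S - {z} \<Longrightarrow> \<sigma> p < m p"
    and m3: "\<And>p p'. p \<in> S - {z} \<Longrightarrow> p' \<in> S - {z} \<Longrightarrow> p < p' \<Longrightarrow> \<sigma> p' < m p \<Longrightarrow> m p' \<le> m p" by blast
  have "card {p \<in> S - {z}. m p < e} = 0" using m1[of e] by (simp add: B'_def)
  then have "{p \<in> S - {z}. m p < e} = {}" using Suc.prems(1) by (subst (asm) card_0_eq) auto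
  then have me: "e \<le> m p" if "p \<in> S - {z}" for p using that by force
  let ?m = "m(z := e)"
  show ?case
  proof (intro exI[of _ ?m] conjI allI ballI impI)
    fix x
    show "int (card {p \<in> S. ?m p < x}) = B x"
    proof (cases "e < x")
      case True
      have "{p \<in> S. ?m p < x} = insert z {p \<in> S - {z}. m p < x}" using z True by auto
      then have "card {p \<in> S. ?m p < x} = Suc (card {p \<in> S - {z}. m p < x})" using Suc.prems(1) by simp
      then show ?thesis using m1[of x] True by (simp add: B'_def)
    next
      case False
      have "{p \<in> S. ?m p < x} = {}" using me False by force
      then have "card {p \<in> S. ?m p < x} = 0" by (simp only: card.empty)
      moreover have "B x = 0" using mono[of x e] zero[of "min x 0"] mono[of "min x 0" x] e False by simp
      ultimately show ?thesis by simp
    qed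
  next
    fix p assume "p \<in> S"
    then show "\<sigma> p < ?m p" using m2 z by auto
  next
    fix p p' assume p: "p \<in> S" "p' \<in> S" "p < p'" "\<sigma> p' < ?m p"
    show "?m p' \<le> ?m p"
    proof (cases "p = z")
      case True
      then show ?thesis using p z_max[of p'] by simp
    next
      case False
      then have pS: "p \<in> S - {z}" "\<sigma> p' < m p" "?m p = m p" using p by auto
      show ?thesis
      proof (cases "p' = z")
        case True
        then show ?thesis using me[OF pS(1)] pS(3) by simp
      next
        case False
        then have "m p' \<le> m p" using m3[OF pS(1) _ p(3) pS(2)] p(2) by simp
        then show ?thesis using False pS(3) by simp
      qed
    qed
  qed
qed

text \<open>
  Within a slot, the ends come first, ordered oppositely to the starts of their arcs.
\<close>

lemma ex_start:
  fixes N q :: int and a b c :: "int \<Rightarrow> int"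
  defines "K \<equiv> 2 * N + 1"
  assumes N: "0 \<le> N" and q: "2 \<le> q"
    and a0: "a 0 = 0" and aq: "a (q - 1) = N" and am: "\<And>x y. 0 \<le> x \<Longrightarrow> x \<le> y \<Longrightarrow> y \<le> q - 1 \<Longrightarrow> a x \<le> a y"
    and b: "\<And>x. x \<le> 0 \<Longrightarrow> b x = 0" "\<And>x y. x \<le> y \<Longrightarrow> b x \<le> b y" "\<And>x. q \<le> x \<Longrightarrow> b x = N"
      "\<And>x. 0 \<le> x \<Longrightarrow> x \<le> q - 1 \<Longrightarrow> b (x + 1) \<le> a x"
    and c: "\<And>x. x \<le> 0 \<Longrightarrow> c x = 0" "\<And>x y. x \<le> y \<Longrightarrow> c x \<le> c y" "\<And>x. q \<le> x \<Longrightarrow> c x = N"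
      "\<And>x. 0 \<le> x \<Longrightarrow> x \<le> q - 1 \<Longrightarrow> c (x + 1) \<le> a x"
  shows "\<exists>S e f. web (q * K) 0 S e f \<and> slotted K q S e f \<and> int (card S) = N \<and>
    (\<forall>x. 0 \<le> x \<longrightarrow> x \<le> q - 1 \<longrightarrow> int (card {p \<in> S. p div K < x}) = a x) \<and>
    (\<forall>x. int (card {p \<in> e ` S. p div K < x}) = b x) \<and> (\<forall>x. int (card {p \<in> f ` S. p div K < x}) = c x)"
proof -
  \<comment> \<open>In a slot the offsets below \<open>N\<close> serve for ends and those from
    \<open>N\<close> to \<open>2 * N - 1\<close> for starts; the \<open>+ 1\<close> keeps
    \<open>K\<close> positive for \<open>N = 0\<close>.\<close>
  have K: "0 < K" using N by (simp add: K_def)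
  \<comment> \<open>The starts are numbered consecutively through all slots and the number
    \<open>j\<close> is used as offset. So offsets increase along the whole of \<open>S\<close>, not
    only within a slot.\<close>
  define R where "R = (\<lambda>s. (\<lambda>j. s * K + (N + j)) ` {a s..<a (s + 1)})"
  define S where "S = (\<Union>s\<in>{0..<q - 1}. R s)"
  have fR: "finite (R s)" for s by (simp add: R_def)
  have fS: "finite S" unfolding S_def using fR by blast
  have a_range: "0 \<le> a s" "a s \<le> N" if "0 \<le> s" "s \<le> q - 1" for s
    using am[of 0 s] am[of s "q - 1"] a0 aq that by auto
  have off: "(s * K + d) div K = s" "(s * K + d) mod K = d" if "0 \<le> d" "d < K" for s d
    using that K by (simp_all add: div_pos_pos_trivial mod_pos_pos_trivial)
  have R: "p div K = s" "\<exists>j. a s \<le> j \<and> j < a (s + 1) \<and> p mod K = N + j" if p: "p \<in> R s" "0 \<le> s" "s < q - 1" for p s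
  proof -
    obtain j where j: "p = s * K + (N + j)" "a s \<le> j" "j < a (s + 1)"
      using p(1) by (auto simp: R_def)
    have "0 \<le> N + j" "N + j < K" using j a_range[of s] a_range[of "s + 1"] p N by (auto simp: K_def)
    then show "p div K = s" "\<exists>j. a s \<le> j \<and> j < a (s + 1) \<and> p mod K = N + j" using off j by auto
  qed
  have S_slot: "0 \<le> p div K" "p div K < q - 1" "N \<le> p mod K" "p mod K < 2 * N" if "p \<in> S" for p
  proof -
    obtain s where s: "0 \<le> s" "s < q - 1" "p \<in> R s" using \<open>p \<in> S\<close> by (auto simp: S_def)
    then obtain j where "a s \<le> j" "j < a (s + 1)" "p mod K = N + j" using R(2) by blast
    then show "0 \<le> p div K" "p div K < q - 1" "N \<le> p mod K" "p mod K < 2 * N"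
      using R(1)[OF s(3)] s a_range[of s] a_range[of "s + 1"] by auto
  qed
  have S_mod: "p mod K < p' mod K" if p: "p \<in> S" "p' \<in> S" "p < p'" for p p'
  proof -
    obtain s where s: "0 \<le> s" "s < q - 1" "p \<in> R s" using p by (auto simp: S_def)
    obtain s' where s': "0 \<le> s'" "s' < q - 1" "p' \<in> R s'" using p by (auto simp: S_def)
    obtain j where j: "j < a (s + 1)" "p mod K = N + j" using R(2)[OF s(3,1,2)] by blast
    obtain j' where j': "a s' \<le> j'" "p' mod K = N + j'" using R(2)[OF s'(3,1,2)] by blast
    have d: "p div K = s" "p' div K = s'" using R(1) s s' by auto
    have "s \<le> s'" using zdiv_mono1[of p p' K] p(3) K d by simp
    show ?thesis
    proof (cases "s = s'")
      case True
      have "p = K * s + p mod K" "p' = K * s + p' mod K"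
        using mult_div_mod_eq[of K p] mult_div_mod_eq[of K p'] d True by simp_all
      then show ?thesis using p(3) by linarith
    next
      case False
      then have "a (s + 1) \<le> a s'" using \<open>s \<le> s'\<close> s s' by (intro am) auto
      then show ?thesis using j j' by simp
    qed
  qed
  have count_nat: "int n \<le> q - 1 \<Longrightarrow> int (card {p \<in> S. p div K < int n}) = a (int n)" for n
  proof (induction n)
    case 0
    have "{p \<in> S. p div K < int 0} = {}" using S_slot(1) by force
    then have "card {p \<in> S. p div K < int 0} = 0" by (simp only: card.empty)
    then show ?case using a0 by simp
  next
    case (Suc n)
    let ?n = "int n"
    have Rn: "{p \<in> S. p div K = ?n} = R ?n"
    proof (intro equalityI subsetI)
      fix p assume "p \<in> {p \<in> S. p div K = ?n}"
      then show "p \<in> R ?n" using R(1) by (auto simp: S_def)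
    next
      fix p assume "p \<in> R ?n"
      then show "p \<in> {p \<in> S. p div K = ?n}" using R(1)[of p ?n] Suc.prems by (auto simp: S_def)
    qed
    have "inj_on (\<lambda>j. ?n * K + (N + j)) {a ?n..<a (?n + 1)}" by (simp add: inj_on_def)
    then have cR: "int (card (R ?n)) = a (?n + 1) - a ?n"
      using am[of ?n "?n + 1"] Suc.prems by (simp add: R_def card_image)
    have "{p \<in> S. p div K < int (Suc n)} = {p \<in> S. p div K < ?n} \<union> R ?n" unfolding Rn[symmetric] by auto
    moreover have "card ({p \<in> S. p div K < ?n} \<union> R ?n) = card {p \<in> S. p div K < ?n} + card (R ?n)"
      by (intro card_Un_disjoint) (use fS fR in \<open>auto simp: Rn[symmetric]\<close>)
    ultimately have "int (card {p \<in> S. p div K < int (Suc n)}) = a ?n + (a (?n + 1) - a ?n)"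
      using Suc cR by simp
    then show ?case by (simp add: add.commute)
  qed
  have count: "int (card {p \<in> S. p div K < x}) = a x" if "0 \<le> x" "x \<le> q - 1" for x
    using count_nat[of "nat x"] that by simp
  have "{p \<in> S. p div K < q - 1} = S" using S_slot by blast
  then have cS: "int (card S) = N" using count[of "q - 1"] aq q by simp
  \<comment> \<open>The offset of an end depends only on its start and reverses the order of the
    starts. Hence the two arcs of one start that go to the same slot share their end, and arcs into
    one slot are nested, within each system and between the two.\<close>
  define pos where "pos = (\<lambda>m (p::int). m p * K + (2 * N - 1 - p mod K))"
  have pos: "pos m p div K = m p" "pos m p mod K = 2 * N - 1 - p mod K" if "p \<in> S" for m p
    unfolding pos_def using S_slot[OF that] by (intro off; simp add: K_def)+
  have half: "\<exists>m. (\<forall>x. int (card {p \<in> pos m ` S. p div K < x}) = b x) \<and> (\<forall>p\<in>S. p div K < m p \<and> m p < q) \<and> noncrossing S (pos m)"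
    if b: "\<And>x. x \<le> 0 \<Longrightarrow> b x = 0" "\<And>x y. x \<le> y \<Longrightarrow> b x \<le> b y" "\<And>x. q \<le> x \<Longrightarrow> b x = N"
      "\<And>x. 0 \<le> x \<Longrightarrow> x \<le> q - 1 \<Longrightarrow> b (x + 1) \<le> a x" for b
  proof -
    have bound: "b (x + 1) \<le> int (card {p \<in> S. p div K < x})" for x
    proof -
      consider "x < 0" | "0 \<le> x" "x \<le> q - 1" | "q \<le> x" by linarith
      then show ?thesis
      proof cases
        case 3
        then have "{p \<in> S. p div K < x} = S" using S_slot(2) by force
        then show ?thesis using b(3)[of "x + 1"] 3 cS by simp
      qed (use b(1)[of "x + 1"] b(4)[of x] count[of x] in auto)
    qed
    have "b x = int (card S)" if "q \<le> x" for x using b(3)[OF that] cS by simp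
    note ex_matching[of S b "\<lambda>p. p div K" q, OF fS b(2) b(1) bound this]
    then obtain m where m1: "\<And>x. int (card {p \<in> S. m p < x}) = b x" and m2: "\<And>p. p \<in> S \<Longrightarrow> p div K < m p"
      and m3: "\<And>p p'. p \<in> S \<Longrightarrow> p' \<in> S \<Longrightarrow> p < p' \<Longrightarrow> p' div K < m p \<Longrightarrow> m p' \<le> m p"
      by blast
    have "card {p \<in> S. m p < q} = card S" using m1[of q] b(3)[of q] cS by simp
    then have "{p \<in> S. m p < q} = S" using fS by (intro card_subset_eq) auto
    then have mq: "m p < q" if "p \<in> S" for p using that by blast
    have nc: "noncrossing S (pos m)" unfolding noncrossing_def
    proof (intro ballI conjI impI)
      fix p assume p: "p \<in> S"
      show "p < pos m p"
      proof (rule ccontr)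
        assume "\<not> p < pos m p"
        then show False using zdiv_mono1[of "pos m p" p K] K m2[OF p] pos(1)[OF p, of m] by simp
      qed
      fix p' assume p': "p' \<in> S" "p < p'" "p' \<le> pos m p"
      have le: "p' div K \<le> m p" using zdiv_mono1[OF p'(3) K] pos(1)[OF p, of m] by simp
      have "p' div K \<noteq> m p"
      proof
        assume e: "p' div K = m p"
        have "p' = K * m p + p' mod K" using mult_div_mod_eq[of K p'] e by simp
        moreover have "pos m p = K * m p + (2 * N - 1 - p mod K)" by (simp add: pos_def)
        ultimately show False using p'(3) S_slot(3)[OF p] S_slot(3)[OF p'(1)] by linarith
      qed
      then have "m p' \<le> m p" using m3[OF p p'(1,2)] le by simp
      then have "m p' * K \<le> m p * K" using K by simp
      moreover have "p mod K < p' mod K" using S_mod[OF p p'(1,2)] .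
      ultimately show "pos m p' < pos m p" unfolding pos_def by linarith
    qed
    have "{p \<in> pos m ` S. p div K < x} = pos m ` {p \<in> S. m p < x}" for x using pos(1)[of _ m] by auto
    then have "card {p \<in> pos m ` S. p div K < x} = card {p \<in> S. m p < x}" for x
      using noncrossing_inj_on[OF nc] by (simp add: card_image inj_on_def)
    then show ?thesis using m1 m2 mq nc by metis
  qed
  obtain m where m: "\<And>x. int (card {p \<in> pos m ` S. p div K < x}) = b x" "\<And>p. p \<in> S \<Longrightarrow> p div K < m p \<and> m p < q" "noncrossing S (pos m)"
    using half[OF b] by blast
  obtain m' where m': "\<And>x. int (card {p \<in> pos m' ` S. p div K < x}) = c x" "\<And>p. p \<in> S \<Longrightarrow> p div K < m' p \<and> m' p < q" "noncrossing S (pos m')"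
    using half[OF c] by blast
  have sl: "slotted K q S (pos m) (pos m')"
    unfolding slotted_def
  proof (intro conjI ballI impI)
    fix p assume p: "p \<in> S"
    show "p div K < pos m p div K" "p div K < pos m' p div K"
      "pos m p div K < p div K + q" "pos m' p div K < p div K + q"
      unfolding pos(1)[OF p] using m(2)[OF p] m'(2)[OF p] S_slot(1)[OF p] by auto
  next
    fix p p' assume p: "p \<in> S" "p' \<in> S" and "pos m p div K = pos m' p' div K"
    then have "m p = m' p'" using pos(1)[OF p(1), of m] pos(1)[OF p(2), of m'] by simp
    then have e: "pos m p = m' p' * K + (2 * N - 1 - p mod K)" "pos m' p' = m' p' * K + (2 * N - 1 - p' mod K)"
      by (simp_all add: pos_def)
    show "p = p' \<Longrightarrow> pos m p = pos m' p'" unfolding e by simp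
    show "p' < p \<Longrightarrow> pos m p < pos m' p'" "p < p' \<Longrightarrow> pos m' p' < pos m p"
      unfolding e using S_mod[OF p] S_mod[OF p(2,1)] by simp_all
  next
    fix p s assume p: "p \<in> S" "s \<in> S" "s div K + q \<le> pos m p div K \<or> s div K + q \<le> pos m' p div K"
    then show "min (pos m s) (pos m' s) < p"
      using m(2)[OF p(1)] m'(2)[OF p(1)] S_slot(1)[OF p(2)] pos(1)[OF p(1), of m] pos(1)[OF p(1), of m'] by simp
  qed
  have "0 \<le> p \<and> pos m p < 0 + q * K \<and> pos m' p < 0 + q * K" if p: "p \<in> S" for p
  proof -
    have "0 \<le> p" using S_slot(1)[OF p] K by (simp add: pos_imp_zdiv_nonneg_iff)
    moreover have "pos m p < q * K" "pos m' p < q * K"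
      using div_le_iff_less[OF K, of "pos m p" "q - 1"] div_le_iff_less[OF K, of "pos m' p" "q - 1"]
        pos(1)[OF p] m(2)[OF p] m'(2)[OF p] by simp_all
    ultimately show ?thesis by simp
  qed
  then have "web (q * K) 0 S (pos m) (pos m')"
    by (intro slotted_web[OF K fS m(3) m'(3) _ sl])
  then show ?thesis using sl cS count m(1) m'(1) by blast
qed

section \<open>Token counts along an orbit\<close>

definition count_before :: "int \<Rightarrow> int set \<Rightarrow> int \<Rightarrow> int" where
  "count_before K X s = int (card {p \<in> X. p div K < s})"

lemma state_bounds:
  assumes K: "K > 0" and w: "web (q * K) (T * K) S b g" and s: "slotted K q S b g" and cS: "int (card S) = N"
  shows "count_before K S T = 0" "T + q - 1 \<le> x \<Longrightarrow> count_before K S x = N"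
    "x \<le> T + 1 \<Longrightarrow> count_before K (b ` S) x = 0" "T + q \<le> x \<Longrightarrow> count_before K (b ` S) x = N"
    "x \<le> T + 1 \<Longrightarrow> count_before K (g ` S) x = 0" "T + q \<le> x \<Longrightarrow> count_before K (g ` S) x = N"
proof -
  have nb: "noncrossing S b" "noncrossing S g" using w by (auto simp: web_def)
  have S: "T \<le> p div K" "p div K < T + q - 1" "T + 1 \<le> b p div K" "b p div K < T + q"
    "T + 1 \<le> g p div K" "g p div K < T + q" if p: "p \<in> S" for p
  proof -
    have r: "T * K \<le> p" "b p < T * K + q * K" "g p < T * K + q * K" using w p by (auto simp: web_def)
    have s1: "p div K < b p div K" "p div K < g p div K" using s p unfolding slotted_def by blast+
    show a: "T \<le> p div K" using zdiv_mono1[OF r(1) K] K by simp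
    have e: "(T + q - 1 + 1) * K = T * K + q * K" by (simp add: algebra_simps)
    have "b p div K \<le> T + q - 1" "g p div K \<le> T + q - 1"
      using r(2,3) unfolding div_le_iff_less[OF K] e by simp_all
    then show "p div K < T + q - 1" "T + 1 \<le> b p div K" "b p div K < T + q"
      "T + 1 \<le> g p div K" "g p div K < T + q"
      using a s1 by simp_all
  qed
  have cb: "card (b ` S) = card S" "card (g ` S) = card S"
    using noncrossing_inj_on nb by (auto intro: card_image)
  have none: "count_before K X x = 0" if "\<And>p. p \<in> X \<Longrightarrow> x \<le> p div K" for X x
  proof -
    have "{p \<in> X. p div K < x} = {}" using that by force
    then show ?thesis by (simp only: count_before_def card.empty of_nat_0)
  qed
  have all: "count_before K X x = int (card X)" if "\<And>p. p \<in> X \<Longrightarrow> p div K < x" for X x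
  proof -
    have "{p \<in> X. p div K < x} = X" using that by blast
    then show ?thesis by (simp only: count_before_def)
  qed
  show "count_before K S T = 0" using S(1) by (rule none)
  show "count_before K S x = N" if "T + q - 1 \<le> x"
    unfolding cS[symmetric] by (rule all) (use S(2) that in force)
  show "count_before K (b ` S) x = 0" "count_before K (g ` S) x = 0" if "x \<le> T + 1"
    using S(3,5) that by (force intro!: none)+
  have "count_before K (b ` S) x = int (card (b ` S))" "count_before K (g ` S) x = int (card (g ` S))" if "T + q \<le> x"
    using S(4,6) that by (force intro!: all)+
  then show "count_before K (b ` S) x = N" "count_before K (g ` S) x = N" if "T + q \<le> x"
    using that cb cS by simp_all
qed

text \<open>Every arc ends in a later slot than it starts, so a whole slot is a block in the sense
  of \<open>block_run\<close>. The rule for the third letter is the rule for the second one applied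
  to the flipped web.\<close>

lemma block_rules:
  fixes K :: nat and q :: int and T :: nat
  assumes K: "K > 0" and w: "web (q * int K) 0 S0 b0 g0" and s: "slotted (int K) q S0 b0 g0"
    and r: "run (q * int K) (S0, b0, g0) (T * K) = (S, b, g)"
    and r': "run (q * int K) (S0, b0, g0) (Suc T * K) = (S', b', g')"
    and x: "int T < x"
  shows "count_before K S' (x + 1) + count_before K S x =
      count_before K S (x + 1) + max (count_before K S' x) (max (count_before K (b ` S) (x + 1)) (count_before K (g ` S) (x + 1)))"
    "x + 1 \<le> int T + q \<Longrightarrow> count_before K (b' ` S') (x + 1) + count_before K (b ` S) x =
      count_before K (b' ` S') x + min (count_before K (b ` S) (x + 1)) (count_before K S' x)"
    "x + 1 \<le> int T + q \<Longrightarrow> count_before K (g' ` S') (x + 1) + count_before K (g ` S) x =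
      count_before K (g' ` S') x + min (count_before K (g ` S) (x + 1)) (count_before K S' x)"
proof -
  have Kp: "0 < int K" using K by simp
  have w1: "web (q * int K) (int T * int K) S b g" using web_run[OF w r] by simp
  have s1: "slotted (int K) q S b g" by (rule slotted_run[OF Kp w s r])
  have e: "Suc T * K = T * K + K" "int (T * K + K) = (int T + 1) * int K" by (simp_all add: algebra_simps)
  have far: "int (T * K + K) \<le> b p \<and> int (T * K + K) \<le> g p" if "p \<in> S" "p < int (T * K + K)" for p
  proof -
    have "p div int K < b p div int K" "p div int K < g p div int K" using s1 that(1) unfolding slotted_def by blast+
    moreover have "int T \<le> p div int K"
      using w1 that(1) zdiv_mono1[of "int T * int K" p "int K"] Kp by (auto simp: web_def)
    ultimately have "\<not> b p div int K \<le> int T" "\<not> g p div int K \<le> int T" by simp_all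
    then show ?thesis unfolding div_le_iff_less[OF Kp] e(2) by simp
  qed
  note B = block_run[OF w r far order_refl r'[unfolded e(1)], unfolded e(2)]
  let ?Z = "{p \<in> S. p < (int T + 1) * int K}"
  have diff: "{p \<in> S. (int T + 1) * int K \<le> p} = S - ?Z" by auto
  have H: "{p \<in> S. p < (int T + 1) * int K \<and> Q p} = {p \<in> ?Z. Q p}" for Q by auto
  have S': "S' = (S - ?Z) \<union> (\<lambda>p. min (b p) (g p)) ` ?Z"
    using B[THEN conjunct1] unfolding diff .
  have b': "b' ` S' = (b ` S - (\<lambda>p. min (b p) (g p)) ` {p \<in> ?Z. b p \<le> g p}) \<union> (\<lambda>p. p + q * int K) ` {p \<in> ?Z. b p \<le> g p}"
    using B[THEN conjunct2, THEN conjunct1] unfolding H .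
  have g': "g' ` S' = (g ` S - (\<lambda>p. min (g p) (b p)) ` {p \<in> ?Z. g p \<le> b p}) \<union> (\<lambda>p. p + q * int K) ` {p \<in> ?Z. g p \<le> b p}"
    using B[THEN conjunct2, THEN conjunct2, THEN conjunct1] unfolding H by (simp only: min.commute)
  have S'2: "S' = (S - ?Z) \<union> (\<lambda>p. min (g p) (b p)) ` ?Z" using S' by (simp only: min.commute)
  note c = count_before_def
  note rules = slot_rules[OF Kp w1 s1 S' b' c c c c c x]
  note rules' = slot_rules[OF Kp web_flip[OF w1] slotted_flip[OF s1] S'2 g' c c c c c x]
  show "count_before K S' (x + 1) + count_before K S x =
      count_before K S (x + 1) + max (count_before K S' x) (max (count_before K (b ` S) (x + 1)) (count_before K (g ` S) (x + 1)))"
    by (rule rules(1))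
  show "x + 1 \<le> int T + q \<Longrightarrow> count_before K (b' ` S') (x + 1) + count_before K (b ` S) x =
      count_before K (b' ` S') x + min (count_before K (b ` S) (x + 1)) (count_before K S' x)"
    by (rule rules(2))
  show "x + 1 \<le> int T + q \<Longrightarrow> count_before K (g' ` S') (x + 1) + count_before K (g ` S) x =
      count_before K (g' ` S') x + min (count_before K (g ` S) (x + 1)) (count_before K S' x)"
    by (rule rules'(2))
qed

text \<open>
  The arrays count the A-, B- and C-tokens in the first \<open>n\<close> slots of the window at time \<open>t\<close>.
\<close>

lemma orbit:
  fixes a b c :: "nat \<Rightarrow> nat \<Rightarrow> int" and q :: nat and N :: int
  assumes q: "2 \<le> q" and N: "0 \<le> N"
    and a_ends: "\<And>t. a t 0 = 0" "\<And>t. a t (q - 1) = N"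
    and b_ends: "\<And>t. b t 0 = 0" "\<And>t. b t 1 = 0" "\<And>t. b t q = N"
    and c_ends: "\<And>t. c t 0 = 0" "\<And>t. c t 1 = 0" "\<And>t. c t q = N"
    and a_rule: "\<And>t n. 1 \<le> n \<Longrightarrow> n + 1 < q \<Longrightarrow>
      a (Suc t) n + a t n = a t (n + 1) + max (a (Suc t) (n - 1)) (max (b t (n + 1)) (c t (n + 1)))"
    and b_rule: "\<And>t n. 2 \<le> n \<Longrightarrow> n < q \<Longrightarrow>
      b (Suc t) n + b t n = b (Suc t) (n - 1) + min (b t (n + 1)) (a (Suc t) (n - 1))"
    and c_rule: "\<And>t n. 2 \<le> n \<Longrightarrow> n < q \<Longrightarrow>
      c (Suc t) n + c t n = c (Suc t) (n - 1) + min (c t (n + 1)) (a (Suc t) (n - 1))"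
    and a_mono: "\<And>x y. x \<le> y \<Longrightarrow> y \<le> q - 1 \<Longrightarrow> a 0 x \<le> a 0 y"
    and b_mono: "\<And>x y. x \<le> y \<Longrightarrow> y \<le> q \<Longrightarrow> b 0 x \<le> b 0 y"
    and c_mono: "\<And>x y. x \<le> y \<Longrightarrow> y \<le> q \<Longrightarrow> c 0 x \<le> c 0 y"
    and ba: "\<And>n. n < q \<Longrightarrow> b 0 (n + 1) \<le> a 0 n" and ca: "\<And>n. n < q \<Longrightarrow> c 0 (n + 1) \<le> a 0 n"
  shows "n \<le> q - 1 \<Longrightarrow> a q n = a 0 n" "n \<le> q \<Longrightarrow> b q n = c 0 n" "n \<le> q \<Longrightarrow> c q n = b 0 n"
proof -
  define K where "K = nat (2 * N + 1)"
  have K: "K > 0" and Kp: "0 < int K" and KN: "2 * N + 1 = int K" using N by (simp_all add: K_def)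
  \<comment> \<open>The arc diagram is built from counts indexed by all integers, so a row is
    continued by \<open>0\<close> on the left and by \<open>N\<close> on the right.\<close>
  define ext where "ext = (\<lambda>h :: nat \<Rightarrow> int. \<lambda>x :: int. if x \<le> 0 then 0 else if int q \<le> x then N else h (nat x))"
  have ext: "ext h x = 0" if "x \<le> 0" for h x using that by (simp add: ext_def)
  have ext_top: "ext h x = N" if "int q \<le> x" for h x using that q by (simp add: ext_def)
  have ext_eq: "ext h (int n) = h n" if "h 0 = 0" "h q = N" "n \<le> q" for h n
    using that by (cases "n = 0"; cases "n = q") (auto simp: ext_def)
  have ext_mono: "ext h x \<le> ext h y"
    if h: "h 0 = 0" "h q = N" "\<And>x y. x \<le> y \<Longrightarrow> y \<le> q \<Longrightarrow> h x \<le> h y" and xy: "x \<le> y" for h x y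
  proof -
    have "0 \<le> h (nat z)" "h (nat z) \<le> N" if "z < int q" for z
      using h(3)[of 0 "nat z"] h(3)[of "nat z" q] h(1,2) that by auto
    then show ?thesis using xy N h(3)[of "nat x" "nat y"] by (auto simp: ext_def)
  qed
  have ext_le: "ext h (x + 1) \<le> a 0 (nat x)"
    if h: "h 0 = 0" "h q = N" "\<And>n. n < q \<Longrightarrow> h (n + 1) \<le> a 0 n" and x: "0 \<le> x" "x \<le> int q - 1" for h x
  proof -
    have "ext h (int (nat x + 1)) = h (nat x + 1)" by (rule ext_eq[OF h(1,2)]) (use x q in auto)
    moreover have "int (nat x + 1) = x + 1" "nat x < q" using x by simp_all
    ultimately show ?thesis using h(3)[of "nat x"] by metis
  qed
  have q1: "nat (int q - 1) = q - 1" using q by simp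
  have "\<exists>S e f. web (int q * int K) 0 S e f \<and> slotted (int K) (int q) S e f \<and> int (card S) = N \<and>
    (\<forall>x. 0 \<le> x \<longrightarrow> x \<le> int q - 1 \<longrightarrow> int (card {p \<in> S. p div int K < x}) = a 0 (nat x)) \<and>
    (\<forall>x. int (card {p \<in> e ` S. p div int K < x}) = ext (b 0) x) \<and>
    (\<forall>x. int (card {p \<in> f ` S. p div int K < x}) = ext (c 0) x)"
  proof (rule ex_start[where N = N, unfolded KN])
    show "a 0 (nat (int q - 1)) = N" unfolding q1 by (rule a_ends)
    show "a 0 (nat x) \<le> a 0 (nat y)" if "0 \<le> x" "x \<le> y" "y \<le> int q - 1" for x y
      using that by (intro a_mono) auto
    show "ext (b 0) x \<le> ext (b 0) y" "ext (c 0) x \<le> ext (c 0) y" if "x \<le> y" for x y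
      using that by (auto intro!: ext_mono b_ends c_ends b_mono c_mono)
    show "ext (b 0) (x + 1) \<le> a 0 (nat x)" "ext (c 0) (x + 1) \<le> a 0 (nat x)" if "0 \<le> x" "x \<le> int q - 1" for x
      using that by (auto intro!: ext_le b_ends c_ends ba ca)
  qed (use N q a_ends ext ext_top in auto)
  then obtain S e f where w: "web (int q * int K) 0 S e f" and s: "slotted (int K) (int q) S e f"
    and cS: "int (card S) = N"
    and cA: "\<And>x. 0 \<le> x \<Longrightarrow> x \<le> int q - 1 \<Longrightarrow> count_before K S x = a 0 (nat x)"
    and cB: "\<And>x. count_before K (e ` S) x = ext (b 0) x" and cC: "\<And>x. count_before K (f ` S) x = ext (c 0) x"
    unfolding count_before_def by blast
  let ?st = "\<lambda>t. run (int q * int K) (S, e, f) (t * K)"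
  have state: "web (int q * int K) (int t * int K) S1 e1 f1" "slotted (int K) (int q) S1 e1 f1" "int (card S1) = N"
    if "t \<le> q" "?st t = (S1, e1, f1)" for t S1 e1 f1
  proof -
    show "web (int q * int K) (int t * int K) S1 e1 f1" using web_run[OF w that(2)] by simp
    show "slotted (int K) (int q) S1 e1 f1" by (rule slotted_run[OF Kp w s that(2)])
    have "turned_upto (q * K) S e f (t * K) S1 e1 f1"
      using w that by (intro turned_upto_run) simp_all
    then have "card S1 = card S" unfolding turned_upto_def by blast
    then show "int (card S1) = N" using cS by simp
  qed
  \<comment> \<open>Arrays and diagram obey the same recurrences with the same boundary values.
    Entry \<open>n\<close> of a new row needs entry \<open>n - 1\<close> of that row, hence the
    inner induction. The bound \<open>t \<le> q\<close> is due to the number of tokens, which is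
    tracked through one full turn only.\<close>
  have counts: "(n \<le> q - 1 \<longrightarrow> count_before K S1 (int t + int n) = a t n) \<and>
      (n \<le> q \<longrightarrow> count_before K (e1 ` S1) (int t + int n) = b t n \<and> count_before K (f1 ` S1) (int t + int n) = c t n)"
    if "t \<le> q" "?st t = (S1, e1, f1)" for t S1 e1 f1 n
    using that
  proof (induction t arbitrary: S1 e1 f1 n)
    case 0
    then have "S1 = S" "e1 = e" "f1 = f" by auto
    moreover have "n \<le> q - 1 \<Longrightarrow> count_before K S (int n) = a 0 n" using cA[of "int n"] q by simp
    moreover have "ext (b 0) (int n) = b 0 n" "ext (c 0) (int n) = c 0 n" if "n \<le> q"
      using ext_eq that b_ends c_ends by auto
    ultimately show ?case using cB[of "int n"] cC[of "int n"] by simp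
  next
    case (Suc t)
    obtain S0 e0 f0 where 0: "?st t = (S0, e0, f0)" by (metis prod_cases3)
    have tq: "t \<le> q" using Suc.prems by simp
    note IH = Suc.IH[OF tq 0]
    note rules = block_rules[OF K w s 0 Suc.prems(2)]
    note st = state[OF Suc.prems]
    note bounds = state_bounds[OF Kp st]
    show ?case
    proof (induction n)
      case 0
      show ?case using bounds(1) bounds(3)[of "int (Suc t)"] bounds(5)[of "int (Suc t)"] a_ends b_ends c_ends by simp
    next
      case (Suc m)
      let ?n = "Suc m" and ?x = "int t + int (Suc m)"
      \<comment> \<open>The window moves by one slot per step, so entry \<open>Suc m\<close> of row
        \<open>Suc t\<close> refers to slot \<open>?x + 1\<close> whereas entry \<open>Suc m\<close>
        of row \<open>t\<close> refers to slot \<open>?x\<close>.\<close>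
      have idx: "int (Suc t) + int ?n = ?x + 1" "int (Suc t) + int m = ?x" "int t + int (?n + 1) = ?x + 1" by simp_all
      have x: "int t < ?x" by simp
      have A: "count_before K S1 (?x + 1) = a (Suc t) ?n" if "?n \<le> q - 1"
      proof (cases "?n = q - 1")
        case True
        then show ?thesis using bounds(2)[of "?x + 1"] a_ends(2) q by simp
      next
        case False
        then have n: "1 \<le> ?n" "?n + 1 < q" using that by auto
        then have m: "m \<le> q - 1" by simp
        show ?thesis
          using rules(1)[OF x] a_rule[OF n, of t] Suc m IH[of ?n] IH[of "?n + 1"] n unfolding idx by simp
      qed
      have B: "count_before K (e1 ` S1) (?x + 1) = b (Suc t) ?n \<and> count_before K (f1 ` S1) (?x + 1) = c (Suc t) ?n" if "?n \<le> q"
      proof -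
        consider "m = 0" | "?n = q" | "2 \<le> ?n" "?n < q" using \<open>?n \<le> q\<close> by linarith
        then show ?thesis
        proof cases
          case 1
          then show ?thesis using bounds(3)[of "?x + 1"] bounds(5)[of "?x + 1"] b_ends c_ends by simp
        next
          case 2
          then have "int (Suc t) + int q \<le> ?x + 1" by simp
          then show ?thesis using bounds(4)[of "?x + 1"] bounds(6)[of "?x + 1"] 2 b_ends(3) c_ends(3) by simp
        next
          case 3
          then have m: "m \<le> q - 1" "m \<le> q" "?x + 1 \<le> int t + int q" by simp_all
          show ?thesis
            using rules(2,3)[OF x m(3)] b_rule[OF 3, of t] c_rule[OF 3, of t] Suc m IH[of ?n] IH[of "?n + 1"] 3
            unfolding idx by simp
        qed
      qed
      show ?case unfolding idx using A B by blast
    qed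
  qed
  obtain S1 e1 f1 where 1: "?st q = (S1, e1, f1)" by (metis prod_cases3)
  have full: "S1 = (\<lambda>p. p + int (q * K)) ` S" "e1 ` S1 = (\<lambda>p. p + int (q * K)) ` f ` S" "f1 ` S1 = (\<lambda>p. p + int (q * K)) ` e ` S"
    using full_turn[of "q * K" S e f S1 e1 f1] w 1 by simp_all
  have shift: "count_before K ((\<lambda>p. p + int (q * K)) ` X) (int q + y) = count_before K X y" for X y
  proof -
    have "{p \<in> (\<lambda>p. p + int (q * K)) ` X. p div int K < int q + y} = (\<lambda>p. p + int (q * K)) ` {p \<in> X. p div int K < y}"
      using K by auto
    then show ?thesis by (simp add: count_before_def card_image)
  qed
  note C = counts[OF order_refl 1, of n]
  show "a q n = a 0 n" if "n \<le> q - 1"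
  proof -
    have "count_before K S1 (int q + int n) = count_before K S (int n)" unfolding full(1) by (rule shift)
    then show ?thesis using C that cA[of "int n"] q by simp
  qed
  have "count_before K (e1 ` S1) (int q + int n) = count_before K (f ` S) (int n)"
    "count_before K (f1 ` S1) (int q + int n) = count_before K (e ` S) (int n)"
    unfolding full(2,3) by (rule shift)+
  then show "n \<le> q \<Longrightarrow> b q n = c 0 n" "n \<le> q \<Longrightarrow> c q n = b 0 n"
    using C cB[of "int n"] cC[of "int n"] ext_eq b_ends c_ends by simp_all
qed

subsection \<open>Toggles\<close>

context
  fixes P :: "'a::order set"
  assumes finite_P: "finite P"
begin

definition upper_covers :: "'a \<Rightarrow> 'a extended set" where "upper_covers p = {r. covered_by (hat P) (Fin p) r}"
definition lower_covers :: "'a \<Rightarrow> 'a extended set" where "lower_covers p = {r. covered_by (hat P) r (Fin p)}"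

lemma finite_hat: "finite (hat P)" using finite_P by (simp add: hat_def)

lemma Fin_in_hat: "p \<in> P \<Longrightarrow> Fin p \<in> hat P" and Minf_in_hat: "Minf \<in> hat P" and Pinf_in_hat: "Pinf \<in> hat P"
  by (simp_all add: hat_def)

lemma toggle_eq: "toggle P p f = f(Fin p := Min (f ` upper_covers p) + Max (f ` lower_covers p) - f (Fin p))"
  unfolding toggle_def upper_covers_def lower_covers_def setcompr_eq_image ..

lemma above_sub: "r \<in> upper_covers p \<Longrightarrow> r \<in> hat P \<and> Fin p < r"
  and below_sub: "r \<in> lower_covers p \<Longrightarrow> r \<in> hat P \<and> r < Fin p"
  by (auto simp: upper_covers_def lower_covers_def covered_by_def)

lemma finite_above: "finite (upper_covers p)"
  by (rule finite_subset[OF _ finite_hat]) (use above_sub in blast)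

lemma finite_below: "finite (lower_covers p)"
  by (rule finite_subset[OF _ finite_hat]) (use below_sub in blast)

lemma above_exists:
  assumes "p \<in> P" "x \<in> hat P" "Fin p < x"
  shows "\<exists>r\<in>upper_covers p. r \<le> x"
proof -
  let ?A = "{z \<in> hat P. Fin p < z \<and> z \<le> x}"
  have "x \<in> ?A" using assms by simp
  then have "finite ?A" "?A \<noteq> {}" using finite_hat by (simp, blast)
  from finite_has_minimal[OF this] obtain r where r: "r \<in> ?A" "\<forall>z\<in>?A. z \<le> r \<longrightarrow> r = z" by (rule bexE)
  have "\<not> (\<exists>z\<in>hat P. Fin p < z \<and> z < r)"
  proof
    assume "\<exists>z\<in>hat P. Fin p < z \<and> z < r"
    then obtain z where "z \<in> hat P" "Fin p < z" "z < r" by blast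
    moreover from r(1) have "r \<le> x" by simp
    ultimately have "z \<in> ?A" "z \<le> r" "r \<noteq> z" by simp_all
    then show False using r(2) by blast
  qed
  then have "r \<in> upper_covers p"
    unfolding upper_covers_def covered_by_def using r(1) Fin_in_hat[OF assms(1)] by blast
  then show ?thesis using r(1) by blast
qed

lemma below_exists:
  assumes "p \<in> P" "x \<in> hat P" "x < Fin p"
  shows "\<exists>r\<in>lower_covers p. x \<le> r"
proof -
  let ?A = "{z \<in> hat P. z < Fin p \<and> x \<le> z}"
  have "x \<in> ?A" using assms by simp
  then have "finite ?A" "?A \<noteq> {}" using finite_hat by (simp, blast)
  from finite_has_maximal[OF this] obtain r where r: "r \<in> ?A" "\<forall>z\<in>?A. r \<le> z \<longrightarrow> r = z" by (rule bexE)
  have "\<not> (\<exists>z\<in>hat P. r < z \<and> z < Fin p)"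
  proof
    assume "\<exists>z\<in>hat P. r < z \<and> z < Fin p"
    then obtain z where "z \<in> hat P" "z < Fin p" "r < z" by blast
    moreover from r(1) have "x \<le> r" by simp
    ultimately have "z \<in> ?A" "r \<le> z" "r \<noteq> z" by simp_all
    then show False using r(2) by blast
  qed
  then have "r \<in> lower_covers p"
    unfolding lower_covers_def covered_by_def using r(1) Fin_in_hat[OF assms(1)] by blast
  then show ?thesis using r(1) by blast
qed

lemma above_nonempty: "p \<in> P \<Longrightarrow> upper_covers p \<noteq> {}"
  using above_exists[of p Pinf, OF _ Pinf_in_hat] by auto

lemma below_nonempty: "p \<in> P \<Longrightarrow> lower_covers p \<noteq> {}"
  using below_exists[of p Minf, OF _ Minf_in_hat] by auto

lemma toggle_involution: "toggle P p (toggle P p f) = f"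
proof -
  have "Fin p \<notin> upper_covers p" "Fin p \<notin> lower_covers p" using above_sub[of "Fin p" p] below_sub[of "Fin p" p] by auto
  then have "f(Fin p := v) ` upper_covers p = f ` upper_covers p"
    "f(Fin p := v) ` lower_covers p = f ` lower_covers p" for v
    by (auto intro!: image_cong)
  note img = this
  show ?thesis unfolding toggle_eq fun_upd_upd fun_upd_same img by simp
qed

lemma polytope_mono: "f \<in> order_polytope P \<Longrightarrow> x \<in> hat P \<Longrightarrow> y \<in> hat P \<Longrightarrow> x \<le> y \<Longrightarrow> f x \<le> f y"
  by (auto simp: order_polytope_def)

lemma toggle_polytope:
  assumes p: "p \<in> P" and f: "f \<in> order_polytope P"
  shows "toggle P p f \<in> order_polytope P"
proof -
  have ph: "Fin p \<in> hat P" using p by (simp add: hat_def)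
  have Mf: "f (Fin p) \<le> Min (f ` upper_covers p)"
    using above_nonempty[OF p] finite_above above_sub polytope_mono[OF f ph] by (auto simp: less_imp_le)
  have mf: "Max (f ` lower_covers p) \<le> f (Fin p)"
    using below_nonempty[OF p] finite_below below_sub polytope_mono[OF f _ ph] by (auto simp: less_imp_le)
  define v where "v = Min (f ` upper_covers p) + Max (f ` lower_covers p) - f (Fin p)"
  have up: "v \<le> f x" if x: "x \<in> hat P" "Fin p < x" for x
  proof -
    obtain r where r: "r \<in> upper_covers p" "r \<le> x" using above_exists[OF p x] by blast
    have "Min (f ` upper_covers p) \<le> f r" using finite_above r by simp
    also have "\<dots> \<le> f x" using polytope_mono[OF f _ x(1) r(2)] above_sub[OF r(1)] by simp
    finally show ?thesis using mf by (simp add: v_def)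
  qed
  have down: "f x \<le> v" if x: "x \<in> hat P" "x < Fin p" for x
  proof -
    obtain r where r: "r \<in> lower_covers p" "x \<le> r" using below_exists[OF p x] by blast
    have "f x \<le> f r" using polytope_mono[OF f x(1) _ r(2)] below_sub[OF r(1)] by simp
    also have "\<dots> \<le> Max (f ` lower_covers p)" using finite_below r by simp
    finally show ?thesis using Mf by (simp add: v_def)
  qed
  have t: "toggle P p f = f(Fin p := v)" unfolding toggle_eq v_def ..
  have "0 \<le> v" "v \<le> 1"
    using down[of Minf] up[of Pinf] f by (auto simp: order_polytope_def hat_def)
  then have "f(Fin p := v) \<in> hat P \<rightarrow>\<^sub>E {0..1}" using f ph by (auto simp: order_polytope_def PiE_def extensional_def)
  moreover have "(f(Fin p := v)) x \<le> (f(Fin p := v)) y" if "x \<in> hat P" "y \<in> hat P" "x \<le> y" for x y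
    using that up[of y] down[of x] polytope_mono[OF f that] by (auto simp: order_le_less)
  ultimately show ?thesis unfolding t using f by (auto simp: order_polytope_def)
qed

lemma foldr_toggle_polytope:
  "set xs \<subseteq> P \<Longrightarrow> f \<in> order_polytope P \<Longrightarrow> foldr (toggle P) xs f \<in> order_polytope P"
  by (induction xs) (auto intro: toggle_polytope)

lemma foldr_toggle_other: "x \<notin> Fin ` set xs \<Longrightarrow> foldr (toggle P) xs f x = f x"
  by (induction xs) (auto simp: toggle_eq)

lemma foldr_toggle_rev: "foldr (toggle P) xs (foldr (toggle P) (rev xs) f) = f"
  by (induction xs arbitrary: f) (auto simp: toggle_involution)

lemma foldr_toggle_rev': "foldr (toggle P) (rev xs) (foldr (toggle P) xs f) = f"
  using foldr_toggle_rev[of "rev xs"] by simp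

text \<open>By monotonicity the minimum over the covers is the minimum over everything above
  \<open>p\<close>. This spares an enumeration of the covers in \<open>hat P\<close>.\<close>

lemma Min_above:
  assumes f: "f \<in> order_polytope P" and p: "p \<in> P"
    and lb: "\<And>x. x \<in> hat P \<Longrightarrow> Fin p < x \<Longrightarrow> m \<le> f x" and "x0 \<in> hat P" "Fin p < x0" "f x0 = m"
  shows "Min (f ` upper_covers p) = m"
proof (rule Min_eqI)
  show "finite (f ` upper_covers p)" using finite_above by simp
  show "m \<le> y" if "y \<in> f ` upper_covers p" for y using that lb above_sub by auto
  obtain r where r: "r \<in> upper_covers p" "r \<le> x0" using above_exists assms by blast
  then have "f r \<le> m" using polytope_mono[OF f _ _ r(2)] above_sub[OF r(1)] assms by auto
  then have "f r = m" using lb[of r] above_sub[OF r(1)] by simp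
  then show "m \<in> f ` upper_covers p" using r by auto
qed

lemma Max_below:
  assumes f: "f \<in> order_polytope P" and p: "p \<in> P"
    and ub: "\<And>x. x \<in> hat P \<Longrightarrow> x < Fin p \<Longrightarrow> f x \<le> m" and "x0 \<in> hat P" "x0 < Fin p" "f x0 = m"
  shows "Max (f ` lower_covers p) = m"
proof (rule Max_eqI)
  show "finite (f ` lower_covers p)" using finite_below by simp
  show "y \<le> m" if "y \<in> f ` lower_covers p" for y using that ub below_sub by auto
  obtain r where r: "r \<in> lower_covers p" "x0 \<le> r" using below_exists assms by blast
  then have "m \<le> f r" using polytope_mono[OF f _ _ r(2)] below_sub[OF r(1)] assms by auto
  then have "f r = m" using ub[of r] below_sub[OF r(1)] by simp
  then show "m \<in> f ` lower_covers p" using r by auto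
qed

lemma Min_close:
  assumes "finite R" "R \<noteq> {}" "\<And>x. \<bar>f x - g x\<bar> \<le> (e::real)"
  shows "\<bar>Min (f ` R) - Min (g ` R)\<bar> \<le> e"
proof -
  have *: "Min (f ` R) \<le> Min (g ` R) + e" if fg: "\<And>x. \<bar>f x - g x\<bar> \<le> e" for f g :: "'b \<Rightarrow> real"
  proof -
    have "Min (g ` R) \<in> g ` R" using assms by (intro Min_in) auto
    then obtain r where r: "r \<in> R" "Min (g ` R) = g r" by blast
    have "Min (f ` R) \<le> f r" using assms r by (intro Min_le) auto
    then show ?thesis using fg[of r] r by simp
  qed
  have e: "\<bar>g x - f x\<bar> \<le> e" for x using assms(3)[of x] by simp
  show ?thesis using *[of f g, OF assms(3)] *[of g f, OF e] by simp
qed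

lemma Max_close:
  assumes "finite R" "R \<noteq> {}" "\<And>x. \<bar>f x - g x\<bar> \<le> (e::real)"
  shows "\<bar>Max (f ` R) - Max (g ` R)\<bar> \<le> e"
proof -
  have *: "Max (g ` R) \<le> Max (f ` R) + e" if fg: "\<And>x. \<bar>f x - g x\<bar> \<le> e" for f g :: "'b \<Rightarrow> real"
  proof -
    have "Max (g ` R) \<in> g ` R" using assms by (intro Max_in) auto
    then obtain r where r: "r \<in> R" "Max (g ` R) = g r" by blast
    have "f r \<le> Max (f ` R)" using assms r by (intro Max_ge) auto
    then show ?thesis using fg[of r] r by simp
  qed
  have e: "\<bar>g x - f x\<bar> \<le> e" for x using assms(3)[of x] by simp
  show ?thesis using *[of f g, OF assms(3)] *[of g f, OF e] by simp
qed

text \<open>A toggled value is a combination of three terms, each of which moves by at most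
  \<open>e\<close>.\<close>

lemma toggle_close:
  assumes "p \<in> P" "\<And>x. \<bar>f x - g x\<bar> \<le> e"
  shows "\<bar>toggle P p f x - toggle P p g x\<bar> \<le> 3 * e"
proof -
  have e: "0 \<le> e" using assms(2)[of undefined] by linarith
  have "\<bar>Min (f ` upper_covers p) - Min (g ` upper_covers p)\<bar> \<le> e"
    by (rule Min_close[OF finite_above above_nonempty[OF assms(1)] assms(2)])
  moreover have "\<bar>Max (f ` lower_covers p) - Max (g ` lower_covers p)\<bar> \<le> e"
    by (rule Max_close[OF finite_below below_nonempty[OF assms(1)] assms(2)])
  moreover note assms(2)[of "Fin p"] assms(2)[of x] e
  ultimately show ?thesis unfolding toggle_eq fun_upd_apply by (cases "x = Fin p") auto
qed

lemma foldr_toggle_close: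
  assumes "set xs \<subseteq> P" "\<And>x. \<bar>f x - g x\<bar> \<le> e"
  shows "\<bar>foldr (toggle P) xs f x - foldr (toggle P) xs g x\<bar> \<le> 3 ^ length xs * e"
  using assms(1)
proof (induction xs arbitrary: x)
  case (Cons p xs)
  then show ?case
    using toggle_close[of p "foldr (toggle P) xs f" "foldr (toggle P) xs g" "3 ^ length xs * e" x] by simp
qed (use assms in simp)

lemma toggle_lattice:
  assumes "p \<in> P" "\<And>x. x \<in> hat P \<Longrightarrow> N * f x \<in> \<int>" "x \<in> hat P"
  shows "N * toggle P p f x \<in> \<int>"
proof (cases "x = Fin p")
  case True
  have "Min (f ` upper_covers p) \<in> f ` upper_covers p" "Max (f ` lower_covers p) \<in> f ` lower_covers p"
    using assms finite_above finite_below above_nonempty below_nonempty by (auto intro!: Min_in Max_in)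
  then have "N * Min (f ` upper_covers p) \<in> \<int>" "N * Max (f ` lower_covers p) \<in> \<int>"
    using assms(2) above_sub below_sub by force+
  moreover have "N * f (Fin p) \<in> \<int>" using assms(2)[OF Fin_in_hat[OF assms(1)]] .
  ultimately show ?thesis unfolding True toggle_eq fun_upd_same right_diff_distrib distrib_left
    by (intro Ints_diff Ints_add)
qed (use assms in \<open>simp add: toggle_eq\<close>)

lemma foldr_toggle_lattice:
  assumes "set xs \<subseteq> P" "\<And>x. x \<in> hat P \<Longrightarrow> N * f x \<in> \<int>" "x \<in> hat P"
  shows "N * foldr (toggle P) xs f x \<in> \<int>"
  using assms(1,3)
proof (induction xs arbitrary: x)
  case (Cons p xs)
  have "N * toggle P p (foldr (toggle P) xs f) x \<in> \<int>"
    by (rule toggle_lattice) (use Cons in auto)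
  then show ?case by simp
qed (use assms(2) in simp)

text \<open>Toggling goes from the end of the list to its front. When \<open>p\<close> is toggled,
  everything above it already has its final value and everything below it still has its old
  one.\<close>

lemma foldr_toggle_linear_extension:
  assumes ps: "linear_extension P ps" and p: "p \<in> P" and g_def: "g = foldr (toggle P) ps f"
  shows "g (Fin p) = Min (g ` upper_covers p) + Max (f ` lower_covers p) - f (Fin p)"
proof -
  have d: "distinct ps" "set ps = P"
    and l: "\<And>i j. i < length ps \<Longrightarrow> j < length ps \<Longrightarrow> ps ! i < ps ! j \<Longrightarrow> i < j"
    using ps unfolding linear_extension_def by blast+
  have "p \<in> set ps" using p d(2) by simp
  from split_list[OF this] obtain xs ys where e: "ps = xs @ p # ys" by blast
  let ?f1 = "foldr (toggle P) ys f"
  have xs: "p' \<in> set xs" if p': "p' \<in> P" "p' < p" for p'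
  proof -
    have "p' \<in> set ps" using p'(1) d(2) by simp
    then obtain i where i: "i < length ps" "ps ! i = p'" unfolding in_set_conv_nth by blast
    then have "i < length xs" using l[of i "length xs"] p'(2) e by simp
    then show ?thesis using i e by (auto simp: nth_append)
  qed
  have ys: "p' \<in> set ys" if p': "p' \<in> P" "p < p'" for p'
  proof -
    have "p' \<in> set ps" using p'(1) d(2) by simp
    then obtain i where i: "i < length ps" "ps ! i = p'" unfolding in_set_conv_nth by blast
    then have "length xs < i" using l[of "length xs" i] p'(2) e by simp
    then have "i - length xs = Suc (i - length xs - 1)" by simp
    then have "ps ! i = ys ! (i - length xs - 1)" unfolding e using \<open>length xs < i\<close> by (simp add: nth_append nth_Cons')
    moreover have "i - length xs - 1 < length ys" using i e \<open>length xs < i\<close> by simp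
    ultimately show ?thesis using i nth_mem by metis
  qed
  have g: "g = foldr (toggle P) xs (toggle P p ?f1)" unfolding g_def e by simp
  have "g r = ?f1 r" if r: "r \<in> upper_covers p" for r
  proof -
    have "r \<noteq> Fin p" using above_sub[OF r] by auto
    moreover have "r \<notin> Fin ` set xs"
    proof
      assume "r \<in> Fin ` set xs"
      then obtain p' where p': "p' \<in> set xs" "r = Fin p'" by blast
      then have "p' \<in> P" "p < p'" using d(2) e above_sub[OF r] by auto
      then have "p' \<in> set ys" by (rule ys)
      then show False using p'(1) d(1) e by auto
    qed
    ultimately show ?thesis unfolding g by (simp add: foldr_toggle_other toggle_eq)
  qed
  then have "g ` upper_covers p = ?f1 ` upper_covers p" by (rule image_cong[OF refl])
  moreover have "?f1 r = f r" if r: "r \<in> lower_covers p" for r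
  proof -
    have "r \<notin> Fin ` set ys"
    proof
      assume "r \<in> Fin ` set ys"
      then obtain p' where p': "p' \<in> set ys" "r = Fin p'" by blast
      then have "p' \<in> P" "p' < p" using d(2) e below_sub[OF r] by auto
      then have "p' \<in> set xs" by (rule xs)
      then show False using p'(1) d(1) e by auto
    qed
    then show ?thesis by (simp add: foldr_toggle_other)
  qed
  then have "?f1 ` lower_covers p = f ` lower_covers p" by (rule image_cong[OF refl])
  moreover have "?f1 (Fin p) = f (Fin p)" using d(1) e by (intro foldr_toggle_other) auto
  moreover have "g (Fin p) = toggle P p ?f1 (Fin p)" unfolding g using d(1) e by (intro foldr_toggle_other) auto
  ultimately show ?thesis by (simp add: toggle_eq)
qed

lemma rowmotion_Bij:
  assumes "set ps = P"
  shows "rowmotion P ps \<in> carrier (BijGroup (order_polytope P))"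
proof -
  have "bij_betw (foldr (toggle P) ps) (order_polytope P) (order_polytope P)"
    by (rule bij_betw_byWitness[where f' = "foldr (toggle P) (rev ps)"])
      (use assms foldr_toggle_polytope foldr_toggle_rev foldr_toggle_rev' in auto)
  then show ?thesis
    by (simp add: BijGroup_def Bij_def rowmotion_def bij_betw_restrict_eq)
qed

lemma rowmotion_pow:
  assumes "set ps = P" "f \<in> order_polytope P"
  shows "(rowmotion P ps [^]\<^bsub>BijGroup (order_polytope P)\<^esub> (n::nat)) f = (foldr (toggle P) ps ^^ n) f"
  using assms(2)
proof (induction n arbitrary: f)
  case 0
  then show ?case by (simp add: nat_pow_def BijGroup_def)
next
  case (Suc n)
  let ?S = "order_polytope P"
  let ?G = "BijGroup ?S" and ?r = "rowmotion P ps"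
  have c: "?r \<in> carrier ?G" by (rule rowmotion_Bij[OF assms(1)])
  have cn: "?r [^]\<^bsub>?G\<^esub> n \<in> carrier ?G"
    by (rule monoid.nat_pow_closed[OF group.is_monoid[OF group_BijGroup] c])
  have "g \<otimes>\<^bsub>?G\<^esub> h = compose ?S g h" if "g \<in> carrier ?G" "h \<in> carrier ?G" for g h
    using that unfolding BijGroup_def by simp
  from this[OF cn c] have "(?r [^]\<^bsub>?G\<^esub> Suc n) f = compose ?S (?r [^]\<^bsub>?G\<^esub> n) ?r f"
    by (simp only: monoid.nat_pow_Suc[OF group.is_monoid[OF group_BijGroup]])
  also have "\<dots> = (?r [^]\<^bsub>?G\<^esub> n) (foldr (toggle P) ps f)"
    using Suc.prems unfolding compose_def rowmotion_def by simp
  also have "\<dots> = (foldr (toggle P) ps ^^ n) (foldr (toggle P) ps f)"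
    by (rule Suc.IH, rule foldr_toggle_polytope) (use assms(1) Suc.prems in simp_all)
  finally show ?case by (simp add: funpow_swap1)
qed

end

subsection \<open>Rowmotion on the product of the vee and a chain\<close>

lemma UNIV_vee: "(UNIV :: vee set) = {VA, VB, VC}"
  using vee.exhaust by auto

lemma finite_vee_times_chain: "finite (vee_times_chain k)"
  unfolding vee_times_chain_def UNIV_vee by simp

lemma scaled_min:
  fixes N x y :: real
  assumes "0 \<le> N" "of_int l = N * x" "of_int m = N * y"
  shows "of_int (min l m) = N * min x y"
proof (cases "x \<le> y")
  case True
  then have "N * x \<le> N * y" using assms by (simp add: mult_left_mono)
  then have "l \<le> m" unfolding assms(2,3)[symmetric] by simp
  then show ?thesis using True assms by simp
next
  case False
  then have "N * y \<le> N * x" using assms by (simp add: mult_left_mono)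
  then have "m \<le> l" unfolding assms(2,3)[symmetric] by simp
  then show ?thesis using False assms by (simp add: min_def)
qed

lemma scaled_max:
  fixes N x y :: real
  assumes "0 \<le> N" "of_int l = N * x" "of_int m = N * y"
  shows "of_int (max l m) = N * max x y"
proof (cases "x \<le> y")
  case True
  then have "N * x \<le> N * y" using assms by (simp add: mult_left_mono)
  then have "l \<le> m" unfolding assms(2,3)[symmetric] by simp
  then show ?thesis using True assms by simp
next
  case False
  then have "N * y \<le> N * x" using assms by (simp add: mult_left_mono)
  then have "m \<le> l" unfolding assms(2,3)[symmetric] by simp
  then show ?thesis using False assms by (simp add: max_def)
qed

locale vee_rowmotion =
  fixes q :: nat and P :: "(vee \<times> nat) set" and ps :: "(vee \<times> nat) list"
  assumes q: "3 \<le> q" and P: "P = vee_times_chain (q - 2)" and ps: "linear_extension P ps"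
begin

abbreviation "OP \<equiv> order_polytope P"
abbreviation "R \<equiv> foldr (toggle P) ps"

text \<open>The chain index is continued by \<open>Minf\<close> at \<open>0\<close> and by
  \<open>Pinf\<close> beyond \<open>q - 2\<close>, so the recurrences hold at the boundary without
  special cases.\<close>

definition node :: "vee \<Rightarrow> nat \<Rightarrow> (vee \<times> nat) extended" where
  "node v j = (if j = 0 then Minf else if j \<le> q - 2 then Fin (v, j) else Pinf)"

lemma finP: "finite P" unfolding P by (rule finite_vee_times_chain)

lemma set_ps: "set ps = P" using ps by (simp add: linear_extension_def)

lemma in_P: "(v, j) \<in> P \<longleftrightarrow> 1 \<le> j \<and> j \<le> q - 2" by (auto simp: P vee_times_chain_def)

lemma node_hat: "node v j \<in> hat P"
  using in_P[of v j] by (simp add: node_def hat_def)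

lemma hat_node:
  assumes "x \<in> hat P"
  shows "\<exists>v j. x = node v j"
proof -
  from assms have "x = Minf \<or> x = Pinf \<or> x \<in> Fin ` P" unfolding hat_def by blast
  then show ?thesis
  proof (elim disjE)
    assume "x = Minf"
    then have "x = node VA 0" by (simp add: node_def)
    then show ?thesis by blast
  next
    assume "x = Pinf"
    then have "x = node VA (q - 1)" using q by (simp add: node_def)
    then show ?thesis by blast
  next
    assume "x \<in> Fin ` P"
    then obtain p where p: "p \<in> P" "x = Fin p" by (rule imageE)
    obtain v j where vj: "p = (v, j)" by (rule prod.exhaust)
    then have "x = node v j" using p in_P[of v j] by (simp add: node_def)
    then show ?thesis by blast
  qed
qed

lemma node_le: "v \<le> w \<Longrightarrow> i \<le> j \<Longrightarrow> node v i \<le> node w j"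
  by (simp add: node_def)

lemma node_Fin: "1 \<le> j \<Longrightarrow> j \<le> q - 2 \<Longrightarrow> node v j = Fin (v, j)"
  by (simp add: node_def)

lemma vee_le: "v \<le> w \<longleftrightarrow> v = w \<or> v = VA" by (simp add: less_eq_vee_def)

lemma vee_pair_less:
  "((v, j) :: vee \<times> nat) < (w, i) \<longleftrightarrow> (v = w \<or> v = VA) \<and> j \<le> i \<and> (v, j) \<noteq> (w, i)"
proof -
  have "(v, j) < (w, i) \<longleftrightarrow> (v, j) \<le> (w, i) \<and> (v, j) \<noteq> (w, i)" by (rule order_less_le)
  also have "(v, j) \<le> (w, i) \<longleftrightarrow> v \<le> w \<and> j \<le> i" by simp
  finally show ?thesis unfolding vee_le by blast
qed

lemma above_VA:
  assumes j: "1 \<le> j" "j \<le> q - 2" and x: "x \<in> hat P" "Fin (VA, j) < x"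
  shows "node VA (j + 1) \<le> x \<or> node VB j \<le> x \<or> node VC j \<le> x"
proof -
  obtain w i where w: "x = node w i" using hat_node[OF x(1)] by blast
  show ?thesis
  proof (cases "1 \<le> i \<and> i \<le> q - 2")
    case True
    then have "x = Fin (w, i)" using w node_Fin by simp
    then have "j \<le> i" "w = VA \<longrightarrow> j + 1 \<le> i" using x(2) by (auto simp: vee_pair_less)
    then show ?thesis unfolding w by (cases w) (auto intro!: node_le)
  next
    case False
    then have "x = Pinf \<or> x = Minf" using w by (auto simp: node_def)
    then show ?thesis using x(2) by auto
  qed
qed

lemma above_w:
  assumes j: "1 \<le> j" "j \<le> q - 2" and v: "v \<noteq> VA" and x: "x \<in> hat P" "Fin (v, j) < x"
  shows "node v (j + 1) \<le> x"
proof -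
  obtain w i where w: "x = node w i" using hat_node[OF x(1)] by blast
  show ?thesis
  proof (cases "1 \<le> i \<and> i \<le> q - 2")
    case True
    then have "x = Fin (w, i)" using w node_Fin by simp
    then have "w = v" "j + 1 \<le> i" using x(2) v by (auto simp: vee_pair_less)
    then show ?thesis unfolding w by (auto intro!: node_le)
  next
    case False
    then have "x = Pinf \<or> x = Minf" using w by (auto simp: node_def)
    then show ?thesis using x(2) by auto
  qed
qed

lemma below_VA:
  assumes j: "1 \<le> j" "j \<le> q - 2" and x: "x \<in> hat P" "x < Fin (VA, j)"
  shows "x \<le> node VA (j - 1)"
proof -
  obtain w i where w: "x = node w i" using hat_node[OF x(1)] by blast
  show ?thesis
  proof (cases "1 \<le> i \<and> i \<le> q - 2")
    case True
    then have "x = Fin (w, i)" using w node_Fin by simp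
    then have "w = VA" "i \<le> j - 1" using x(2) by (auto simp: vee_pair_less)
    then show ?thesis unfolding w by (auto intro!: node_le)
  next
    case False
    then have "x = Pinf \<or> x = Minf" using w by (auto simp: node_def)
    then show ?thesis using x(2) by auto
  qed
qed

lemma below_w:
  assumes j: "1 \<le> j" "j \<le> q - 2" and v: "v \<noteq> VA" and x: "x \<in> hat P" "x < Fin (v, j)"
  shows "x \<le> node VA j \<or> x \<le> node v (j - 1)"
proof -
  obtain w i where w: "x = node w i" using hat_node[OF x(1)] by blast
  show ?thesis
  proof (cases "1 \<le> i \<and> i \<le> q - 2")
    case True
    then have "x = Fin (w, i)" using w node_Fin by simp
    then have "(w = VA \<and> i \<le> j) \<or> (w = v \<and> i \<le> j - 1)" using x(2) by (auto simp: vee_pair_less)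
    then show ?thesis unfolding w by (auto intro!: node_le)
  next
    case False
    then have "x = Pinf \<or> x = Minf" using w by (auto simp: node_def)
    then show ?thesis using x(2) by auto
  qed
qed

lemma node_mono: "f \<in> OP \<Longrightarrow> v \<le> w \<Longrightarrow> i \<le> j \<Longrightarrow> f (node v i) \<le> f (node w j)"
  by (rule polytope_mono[OF finP _ node_hat node_hat node_le])

lemma node_bot: "f \<in> OP \<Longrightarrow> f (node v 0) = 0"
  by (simp add: node_def order_polytope_def)

lemma node_top: "f \<in> OP \<Longrightarrow> q - 1 \<le> j \<Longrightarrow> f (node v j) = 1"
proof -
  assume "f \<in> OP" "q - 1 \<le> j"
  moreover from this have "j \<noteq> 0" "\<not> j \<le> q - 2" using q by simp_all
  ultimately show ?thesis by (simp add: node_def order_polytope_def)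
qed

lemma R_polytope: "f \<in> OP \<Longrightarrow> R f \<in> OP"
  by (rule foldr_toggle_polytope[OF finP]) (use set_ps in simp_all)

lemma R_pow_polytope: "f \<in> OP \<Longrightarrow> (R ^^ n) f \<in> OP"
  by (induction n) (simp_all add: R_polytope)

lemma R_VA:
  assumes f: "f \<in> OP" and j: "1 \<le> j" "j \<le> q - 2"
  shows "R f (node VA j) + f (node VA j) =
    min (R f (node VA (j + 1))) (min (R f (node VB j)) (R f (node VC j))) + f (node VA (j - 1))"
proof -
  let ?m = "min (R f (node VA (j + 1))) (min (R f (node VB j)) (R f (node VC j)))"
  note g = R_polytope[OF f]
  have p: "(VA, j) \<in> P" using j in_P by simp
  have less: "Fin (VA, j) < node VA (j + 1)" "Fin (VA, j) < node VB j" "Fin (VA, j) < node VC j"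
    using j by (auto simp: node_def vee_pair_less)
  have lb: "?m \<le> R f x" if x: "x \<in> hat P" "Fin (VA, j) < x" for x
    using above_VA[OF j x]
  proof (elim disjE)
    assume "node VA (j + 1) \<le> x"
    from polytope_mono[OF finP g node_hat x(1) this] show ?thesis by simp
  next
    assume "node VB j \<le> x"
    from polytope_mono[OF finP g node_hat x(1) this] show ?thesis by simp
  next
    assume "node VC j \<le> x"
    from polytope_mono[OF finP g node_hat x(1) this] show ?thesis by simp
  qed
  have "\<exists>x0\<in>{node VA (j + 1), node VB j, node VC j}. R f x0 = ?m" by (auto simp: min_def)
  then obtain x0 where x0: "x0 \<in> hat P" "Fin (VA, j) < x0" "R f x0 = ?m"
    using less node_hat by blast
  have Min: "Min (R f ` upper_covers P (VA, j)) = ?m" by (rule Min_above[OF finP g p lb x0])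
  have "Max (f ` lower_covers P (VA, j)) = f (node VA (j - 1))"
  proof (rule Max_below[OF finP f p _ node_hat _ refl])
    show "node VA (j - 1) < Fin (VA, j)" using j by (auto simp: node_def vee_pair_less)
    show "f x \<le> f (node VA (j - 1))" if x: "x \<in> hat P" "x < Fin (VA, j)" for x
      using polytope_mono[OF finP f x(1) node_hat below_VA[OF j x]] .
  qed
  then show ?thesis using foldr_toggle_linear_extension[OF finP ps p refl, of f] Min
    unfolding node_Fin[OF j] by simp
qed

lemma R_w:
  assumes f: "f \<in> OP" and j: "1 \<le> j" "j \<le> q - 2" and v: "v \<noteq> VA"
  shows "R f (node v j) + f (node v j) = R f (node v (j + 1)) + max (f (node VA j)) (f (node v (j - 1)))"
proof -
  let ?m = "max (f (node VA j)) (f (node v (j - 1)))"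
  note g = R_polytope[OF f]
  have p: "(v, j) \<in> P" using j in_P by simp
  have less: "node VA j < Fin (v, j)" "node v (j - 1) < Fin (v, j)"
    using j v by (auto simp: node_def vee_pair_less)
  have ub: "f x \<le> ?m" if x: "x \<in> hat P" "x < Fin (v, j)" for x
    using below_w[OF j v x]
  proof (elim disjE)
    assume "x \<le> node VA j"
    from polytope_mono[OF finP f x(1) node_hat this] show ?thesis by simp
  next
    assume "x \<le> node v (j - 1)"
    from polytope_mono[OF finP f x(1) node_hat this] show ?thesis by simp
  qed
  have "\<exists>x0\<in>{node VA j, node v (j - 1)}. f x0 = ?m" by (auto simp: max_def)
  then obtain x0 where x0: "x0 \<in> hat P" "x0 < Fin (v, j)" "f x0 = ?m"
    using less node_hat by blast
  have Max: "Max (f ` lower_covers P (v, j)) = ?m" by (rule Max_below[OF finP f p ub x0])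
  have "Min (R f ` upper_covers P (v, j)) = R f (node v (j + 1))"
  proof (rule Min_above[OF finP g p _ node_hat _ refl])
    show "Fin (v, j) < node v (j + 1)" using j by (auto simp: node_def vee_pair_less)
    show "R f (node v (j + 1)) \<le> R f x" if x: "x \<in> hat P" "Fin (v, j) < x" for x
      using polytope_mono[OF finP g node_hat x(1) above_w[OF j v x]] .
  qed
  then show ?thesis using foldr_toggle_linear_extension[OF finP ps p refl, of f] Max
    unfolding node_Fin[OF j] by simp
qed

text \<open>Downward induction on \<open>j\<close>: in \<open>R_w\<close> the bound one step higher
  cancels \<open>f (node v j)\<close> against \<open>R f (node v (j + 1))\<close>, and the maximum
  leaves the next bound.\<close>

lemma R_above:
  assumes f: "f \<in> OP" and v: "v \<noteq> VA"
  shows "f (node v j) \<le> R f (node v (j + 1))"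
proof (cases "j \<le> q - 2")
  case True
  then show ?thesis
  proof (induction j rule: inc_induct)
    case base
    have "R f (node v (q - 2 + 1)) = 1" using q by (intro node_top R_polytope f) simp
    moreover have "f (node v (q - 2)) \<le> f (node v (q - 1))" by (rule node_mono[OF f]) auto
    ultimately show ?case using node_top[OF f, of "q - 1" v] by simp
  next
    case (step j)
    then show ?case using R_w[OF f, of "j + 1" v] v by simp
  qed
next
  case False
  then have "q - 1 \<le> j" "q - 1 \<le> j + 1" by simp_all
  then show ?thesis using node_top[OF f] node_top[OF R_polytope[OF f]] by simp
qed

text \<open>This is the ballot condition: in terms of tokens, the B's in the first
  \<open>n + 1\<close> slots, and likewise the C's, are at most as many as the A's in the first
  \<open>n\<close>.\<close>

lemma R_above_VA:
  assumes f: "f \<in> OP" and v: "v \<noteq> VA"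
  shows "f (node VA j) \<le> R f (node v j)"
proof -
  consider "j = 0" | "1 \<le> j" "j \<le> q - 2" | "q - 1 \<le> j" by linarith
  then show ?thesis
  proof cases
    case 1
    then show ?thesis using node_bot[OF f] node_bot[OF R_polytope[OF f]] by simp
  next
    case 2
    then show ?thesis using R_w[OF f 2 v] R_above[OF f v, of j] by simp
  next
    case 3
    then show ?thesis using node_top[OF f] node_top[OF R_polytope[OF f]] by simp
  qed
qed

section \<open>The half period on lattice points and the passage to all points\<close>

definition lattice :: "nat \<Rightarrow> ((vee \<times> nat) extended \<Rightarrow> real) \<Rightarrow> bool" where
  "lattice N f \<longleftrightarrow> (\<forall>x\<in>hat P. real N * f x \<in> \<int>)"

lemma lattice_R_pow: "lattice N f \<Longrightarrow> lattice N ((R ^^ n) f)"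
proof (induction n)
  case (Suc n)
  then have l: "\<And>x. x \<in> hat P \<Longrightarrow> real N * (R ^^ n) f x \<in> \<int>" by (simp add: lattice_def)
  have sub: "set ps \<subseteq> P" using set_ps by simp
  show ?case unfolding lattice_def using foldr_toggle_lattice[OF finP sub l] by simp
qed simp

text \<open>The branches are compared one application of \<open>R\<close> later than the stem,
  because the token arrays take A from \<open>f\<close> but B and C from \<open>R f\<close>.\<close>

lemma half_period:
  assumes f: "f \<in> OP" and l: "lattice N f" and N: "0 < N"
  shows "(R ^^ q) f (node VA j) = f (node VA j) \<and>
    (R ^^ Suc q) f (node VB j) = R f (node VC j) \<and> (R ^^ Suc q) f (node VC j) = R f (node VB j)"
proof (cases "q \<le> j")
  case True
  then have "q - 1 \<le> j" by simp
  note top = node_top[OF R_pow_polytope[OF f] this] node_top[OF f this]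
  show ?thesis using top(1)[of q] top(1)[of "Suc q"] top(1)[of "Suc 0"] top(2) by simp
next
  case False
  then have jq: "j < q" by simp
  define L where "L = (\<lambda>t v j. \<lfloor>real N * (R ^^ t) f (node v j)\<rfloor>)"
  have L: "real_of_int (L t v j) = real N * (R ^^ t) f (node v j)" for t v j
  proof -
    have "real N * (R ^^ t) f (node v j) \<in> \<int>"
      using lattice_R_pow[OF l, of t] node_hat unfolding lattice_def by blast
    then show ?thesis unfolding L_def by (auto elim: Ints_cases)
  qed
  note ft = R_pow_polytope[OF f]
  have L_bot: "L t v 0 = 0" for t v using node_bot[OF ft] by (simp add: L_def)
  have L_top: "L t v j = int N" if "q - 1 \<le> j" for t v j using node_top[OF ft that] by (simp add: L_def)
  have L_mono: "L t v i \<le> L t v j" if "i \<le> j" for t v i j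
    unfolding L_def by (intro floor_mono mult_left_mono node_mono[OF ft order_refl that]) simp
  have L_VA: "L (Suc t) VA j + L t VA j =
      min (L (Suc t) VA (j + 1)) (min (L (Suc t) VB j) (L (Suc t) VC j)) + L t VA (j - 1)"
    if j: "1 \<le> j" "j \<le> q - 2" for t j
  proof -
    have "real_of_int (min (L (Suc t) VA (j + 1)) (min (L (Suc t) VB j) (L (Suc t) VC j))) =
      real N * min ((R ^^ Suc t) f (node VA (j + 1))) (min ((R ^^ Suc t) f (node VB j)) ((R ^^ Suc t) f (node VC j)))"
      by (intro scaled_min L of_nat_0_le_iff)
    moreover have "(R ^^ Suc t) f (node VA j) + (R ^^ t) f (node VA j) =
      min ((R ^^ Suc t) f (node VA (j + 1))) (min ((R ^^ Suc t) f (node VB j)) ((R ^^ Suc t) f (node VC j)))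
        + (R ^^ t) f (node VA (j - 1))"
      using R_VA[OF ft[of t] j] by (simp only: funpow.simps comp_apply)
    ultimately have "real_of_int (L (Suc t) VA j + L t VA j) =
      real_of_int (min (L (Suc t) VA (j + 1)) (min (L (Suc t) VB j) (L (Suc t) VC j)) + L t VA (j - 1))"
      unfolding of_int_add L by (simp only: distrib_left[symmetric])
    then show ?thesis by (simp only: of_int_eq_iff)
  qed
  have L_w: "L (Suc t) v j + L t v j = L (Suc t) v (j + 1) + max (L t VA j) (L t v (j - 1))"
    if j: "1 \<le> j" "j \<le> q - 2" and v: "v \<noteq> VA" for t v j
  proof -
    have "real_of_int (max (L t VA j) (L t v (j - 1))) =
      real N * max ((R ^^ t) f (node VA j)) ((R ^^ t) f (node v (j - 1)))"
      by (intro scaled_max L of_nat_0_le_iff)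
    moreover have "(R ^^ Suc t) f (node v j) + (R ^^ t) f (node v j) =
      (R ^^ Suc t) f (node v (j + 1)) + max ((R ^^ t) f (node VA j)) ((R ^^ t) f (node v (j - 1)))"
      using R_w[OF ft[of t] j v] by (simp only: funpow.simps comp_apply)
    ultimately have "real_of_int (L (Suc t) v j + L t v j) =
      real_of_int (L (Suc t) v (j + 1) + max (L t VA j) (L t v (j - 1)))"
      unfolding of_int_add L by (simp only: distrib_left[symmetric])
    then show ?thesis by (simp only: of_int_eq_iff)
  qed
  have L_above: "L 0 VA j \<le> L (Suc 0) v j" if "v \<noteq> VA" for v j
    unfolding L_def using R_above_VA[OF f that, of j]
    by (intro floor_mono mult_left_mono) simp_all
  \<comment> \<open>The complement \<open>int N - L\<close>, read downwards from the top of the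
    chain, turns the values of a monotone function into increasing counts from \<open>0\<close> to
    \<open>N\<close>.\<close>
  define a where "a = (\<lambda>t n. int N - L t VA (q - 1 - n))"
  \<comment> \<open>Compared with \<open>a\<close> there are two shifts: one application of
    \<open>R\<close> and one slot, as a letter lies at least one slot after its A. With them
    \<open>L_VA\<close> and \<open>L_w\<close> become the recurrences required by
    \<open>orbit\<close>.\<close>
  define e where "e = (\<lambda>v t n. if n = 0 then 0 else int N - L (Suc t) v (q - n))"
  have a_ends: "a t 0 = 0" "a t (q - 1) = int N" for t
    unfolding a_def using L_top[of "q - 1" t VA] L_bot[of t VA] by simp_all
  have e_ends: "e v t 0 = 0" "e v t 1 = 0" "e v t q = int N" for v t
    unfolding e_def using L_top[of "q - 1" "Suc t" v] L_bot[of "Suc t" v] q by simp_all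
  have a_rule: "a (Suc t) n + a t n = a t (n + 1) + max (a (Suc t) (n - 1)) (max (e VB t (n + 1)) (e VC t (n + 1)))"
    if n: "1 \<le> n" "n + 1 < q" for t n
  proof -
    define j where "j = q - 1 - n"
    have j: "1 \<le> j" "j \<le> q - 2" using n by (simp_all add: j_def)
    have idx: "q - 1 - n = j" "q - 1 - (n + 1) = j - 1" "q - 1 - (n - 1) = j + 1" "q - (n + 1) = j"
      using n by (simp_all add: j_def)
    show ?thesis unfolding a_def e_def idx using L_VA[OF j, of t] by simp
  qed
  have e_rule: "e v (Suc t) n + e v t n = e v (Suc t) (n - 1) + min (e v t (n + 1)) (a (Suc t) (n - 1))"
    if n: "2 \<le> n" "n < q" and v: "v \<noteq> VA" for t n v
  proof -
    define j where "j = q - n"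
    have j: "1 \<le> j" "j \<le> q - 2" using n by (simp_all add: j_def)
    have idx: "q - n = j" "q - (n + 1) = j - 1" "q - (n - 1) = j + 1" "q - 1 - (n - 1) = j"
      using n by (simp_all add: j_def)
    have nz: "n \<noteq> 0" "n - 1 \<noteq> 0" "n + 1 \<noteq> 0" using n by simp_all
    show ?thesis unfolding a_def e_def idx if_not_P[OF nz(1)] if_not_P[OF nz(2)] if_not_P[OF nz(3)]
      using L_w[OF j v, of "Suc t"] by simp
  qed
  have a_mono: "a 0 x \<le> a 0 y" if "x \<le> y" for x y
    unfolding a_def using L_mono[of "q - 1 - y" "q - 1 - x"] that by simp
  have le_N: "L t v j \<le> int N" for t v j
    using L_mono[of j "max j (q - 1)" t v] L_top[of "max j (q - 1)" t v] by simp
  have e_mono: "e v 0 x \<le> e v 0 y" if "x \<le> y" for x y v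
    unfolding e_def using L_mono[of "q - y" "q - x" "Suc 0" v] le_N[of "Suc 0" v "q - y"] that by simp
  have e_a: "e v 0 (n + 1) \<le> a 0 n" if "v \<noteq> VA" for v n
    unfolding a_def e_def using L_above[OF that, of "q - 1 - n"] by simp
  have q2: "2 \<le> q" using q by simp
  have nA: "VB \<noteq> VA" "VC \<noteq> VA" by simp_all
  note orb = orbit[of q "int N" a "e VB" "e VC", OF q2 of_nat_0_le_iff a_ends e_ends e_ends a_rule
      e_rule[OF _ _ nA(1)] e_rule[OF _ _ nA(2)] a_mono e_mono e_mono e_a[OF nA(1)] e_a[OF nA(2)]]
  have "L q VA j = L 0 VA j"
    using orb(1)[of "q - 1 - j"] jq by (simp add: a_def)
  moreover have "L (Suc q) VB j = L (Suc 0) VC j" "L (Suc q) VC j = L (Suc 0) VB j"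
    using orb(2,3)[of "q - j"] jq by (simp_all add: e_def)
  moreover have "(R ^^ t) f (node v j) = (R ^^ t') f (node v' j)" if "L t v j = L t' v' j" for t t' v v'
    using L[of t v j] L[of t' v' j] that N by simp
  ultimately have "(R ^^ q) f (node VA j) = (R ^^ 0) f (node VA j)"
    "(R ^^ Suc q) f (node VB j) = (R ^^ Suc 0) f (node VC j)"
    "(R ^^ Suc q) f (node VC j) = (R ^^ Suc 0) f (node VB j)"
    by blast+
  then show ?thesis by simp
qed

lemma R_inj:
  assumes "R f = R g"
  shows "f = g"
proof -
  have "f = foldr (toggle P) (rev ps) (R f)" by (rule foldr_toggle_rev'[OF finP, symmetric])
  also have "\<dots> = g" unfolding assms by (rule foldr_toggle_rev'[OF finP])
  finally show ?thesis .
qed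

text \<open>Two half periods exchange the branches twice. As the exchange is known for the branches
  of \<open>R f\<close> only, the period is first shown for \<open>R f\<close> and then transferred
  by injectivity of \<open>R\<close>.\<close>

lemma lattice_period:
  assumes f: "f \<in> OP" and l: "lattice N f" and N: "0 < N"
  shows "(R ^^ (2 * q)) f = f"
proof -
  have pow: "(R ^^ m) ((R ^^ n) h) = (R ^^ (m + n)) h" for m n h by (simp add: funpow_add)
  note H = half_period[OF R_pow_polytope[OF f] lattice_R_pow[OF l] N, unfolded pow]
  note H1 = H[THEN conjunct1] and H2 = H[THEN conjunct2, THEN conjunct1] and H3 = H[THEN conjunct2, THEN conjunct2]
  have "(R ^^ Suc (2 * q)) f (node v j) = (R ^^ Suc 0) f (node v j)" for v j
  proof (cases v)
    case VA
    have e: "Suc (2 * q) = q + (q + Suc 0)" by simp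
    show ?thesis unfolding VA e H1 ..
  next
    case VB
    have e: "Suc (2 * q) = Suc q + q" "R ((R ^^ q) f) = (R ^^ (Suc q + 0)) f" by simp_all
    show ?thesis unfolding VB e(1) H2 unfolding e(2) H3 by (simp only: funpow.simps comp_apply id_apply)
  next
    case VC
    have e: "Suc (2 * q) = Suc q + q" "R ((R ^^ q) f) = (R ^^ (Suc q + 0)) f" by simp_all
    show ?thesis unfolding VC e(1) H3 unfolding e(2) H2 by (simp only: funpow.simps comp_apply id_apply)
  qed
  then have on: "(R ^^ Suc (2 * q)) f x = (R ^^ Suc 0) f x" if "x \<in> hat P" for x
    using hat_node[OF that] by blast
  have ext: "(R ^^ n) f \<in> extensional (hat P)" for n
    using R_pow_polytope[OF f, of n] unfolding order_polytope_def by (simp add: PiE_def)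
  have "(R ^^ Suc (2 * q)) f = (R ^^ Suc 0) f" by (rule extensionalityI[OF ext ext on])
  then have "R ((R ^^ (2 * q)) f) = R f" by (simp only: funpow.simps comp_apply id_apply)
  then show ?thesis by (rule R_inj)
qed

lemma R_pow_close:
  assumes "\<And>x. \<bar>f x - g x\<bar> \<le> e"
  shows "\<bar>(R ^^ n) f x - (R ^^ n) g x\<bar> \<le> (3 ^ length ps) ^ n * e"
proof (induction n arbitrary: x)
  case (Suc n)
  have sub: "set ps \<subseteq> P" using set_ps by simp
  show ?case using foldr_toggle_close[where x = x, OF finP sub Suc] by (simp add: mult.assoc)
qed (use assms in simp)

text \<open>Rounding down to a lattice point moves \<open>f\<close> by at most \<open>1 / N\<close>, and toggles are Lipschitz.\<close>

lemma period:
  assumes f: "f \<in> OP"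
  shows "(R ^^ (2 * q)) f = f"
proof (rule ext)
  fix x
  \<comment> \<open>A Lipschitz constant of \<open>R ^^ (2 * q)\<close>, plus \<open>1\<close> for
    the distance between \<open>f\<close> and the rounded point.\<close>
  define C where "C = (3 ^ length ps) ^ (2 * q) + (1 :: real)"
  have bound: "\<bar>(R ^^ (2 * q)) f x - f x\<bar> * real N \<le> C" if N: "0 < N" for N :: nat
  proof -
    \<comment> \<open>Rounding down is monotone and fixes the values \<open>0\<close> and
      \<open>1\<close>, so the result stays in the order polytope.\<close>
    define g where "g = (\<lambda>x. if x \<in> hat P then real_of_int \<lfloor>real N * f x\<rfloor> / real N else undefined)"
    have g: "g \<in> OP"
    proof -
      have range: "0 \<le> f y" "f y \<le> 1" if "y \<in> hat P" for y
        using f that unfolding order_polytope_def PiE_def Pi_def by auto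
      have ends: "f Minf = 0" "f Pinf = 1" using f by (auto simp: order_polytope_def)
      have "0 \<le> g y \<and> g y \<le> 1" if "y \<in> hat P" for y
      proof -
        have "real N * f y \<le> real N" using range(2)[OF that] N by (simp add: mult_left_le)
        then have "\<lfloor>real N * f y\<rfloor> \<le> int N" by (simp add: floor_le_iff)
        then have "real_of_int \<lfloor>real N * f y\<rfloor> \<le> real N" by linarith
        moreover have "0 \<le> \<lfloor>real N * f y\<rfloor>" using range(1)[OF that] by simp
        ultimately show ?thesis using that N by (simp add: g_def)
      qed
      moreover have "g y \<le> g z" if yz: "y \<in> hat P" "z \<in> hat P" "y \<le> z" for y z
      proof -
        have "\<lfloor>real N * f y\<rfloor> \<le> \<lfloor>real N * f z\<rfloor>"
          by (intro floor_mono mult_left_mono polytope_mono[OF finP f yz]) simp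
        then show ?thesis using yz N by (simp add: g_def divide_right_mono)
      qed
      moreover have "g Minf = 0" "g Pinf = 1"
        using ends N Minf_in_hat[OF finP] Pinf_in_hat[OF finP] by (simp_all add: g_def)
      moreover have "g \<in> extensional (hat P)" by (simp add: g_def extensional_def)
      ultimately show ?thesis unfolding order_polytope_def PiE_def by simp
    qed
    have close: "\<bar>f y - g y\<bar> \<le> 1 / real N" for y
    proof (cases "y \<in> hat P")
      case True
      have "\<bar>real N * f y - real_of_int \<lfloor>real N * f y\<rfloor>\<bar> \<le> 1" by linarith
      then have "\<bar>real N * f y - real_of_int \<lfloor>real N * f y\<rfloor>\<bar> / real N \<le> 1 / real N"
        by (rule divide_right_mono) simp
      moreover have "f y - g y = (real N * f y - real_of_int \<lfloor>real N * f y\<rfloor>) / real N"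
        using True N by (simp add: g_def field_simps)
      ultimately show ?thesis by (simp add: abs_divide)
    next
      case False
      then have "f y = g y" using f by (auto simp: g_def order_polytope_def PiE_def extensional_def)
      then show ?thesis by simp
    qed
    have "lattice N g" using N by (simp add: lattice_def g_def)
    then have "(R ^^ (2 * q)) g = g" by (rule lattice_period[OF g _ N])
    then have "\<bar>(R ^^ (2 * q)) f x - f x\<bar> \<le> (3 ^ length ps) ^ (2 * q) * (1 / real N) + 1 / real N"
      using R_pow_close[where f = f and g = g and n = "2 * q" and x = x, OF close] close[of x] by simp
    also have "\<dots> = C / real N" by (simp add: C_def add_divide_distrib)
    finally show ?thesis using N by (simp add: pos_le_divide_eq)
  qed
  define D where "D = \<bar>(R ^^ (2 * q)) f x - f x\<bar>"
  \<comment> \<open>The bound \<open>D * real N \<le> C\<close> holds for every positive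
    \<open>N\<close> while \<open>C\<close> does not depend on \<open>N\<close>.\<close>
  have "D \<le> 0"
  proof (rule ccontr)
    assume "\<not> D \<le> 0"
    then have d: "0 < D" by simp
    obtain N :: nat where "C / D < real N" using reals_Archimedean2 by blast
    then have "C < real N * D" using d by (simp only: pos_divide_less_eq)
    also have "\<dots> \<le> real (Suc N) * D" using d by simp
    also have "\<dots> \<le> C" using bound[of "Suc N", folded D_def] by (simp only: mult.commute zero_less_Suc)
    finally show False by simp
  qed
  then show "(R ^^ (2 * q)) f x = f x" unfolding D_def by linarith
qed

end

theorem mainTheorem2:
  fixes q :: nat and P :: "(vee \<times> nat) set" and ps :: "(vee \<times> nat) list"
  assumes "q \<ge> 3"
    and "P = vee_times_chain (q - 2)"
    and "linear_extension P ps"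
  shows "rowmotion P ps \<in> carrier (BijGroup (order_polytope P)) \<and>
         group.ord (BijGroup (order_polytope P)) (rowmotion P ps) dvd 2 * q"
proof -
  interpret vee_rowmotion q P ps using assms by unfold_locales
  let ?G = "BijGroup OP" and ?r = "rowmotion P ps"
  have c: "?r \<in> carrier ?G" by (rule rowmotion_Bij[OF finP set_ps])
  have "?r [^]\<^bsub>?G\<^esub> (2 * q) \<in> carrier ?G"
    by (rule monoid.nat_pow_closed[OF group.is_monoid[OF group_BijGroup] c])
  moreover have "carrier ?G \<subseteq> extensional OP" by (simp add: BijGroup_def Bij_def)
  ultimately have "?r [^]\<^bsub>?G\<^esub> (2 * q) \<in> extensional OP" by blast
  moreover have "(\<lambda>f\<in>OP. f) \<in> extensional OP" by simp
  moreover have "(?r [^]\<^bsub>?G\<^esub> (2 * q)) f = (\<lambda>f\<in>OP. f) f" if f: "f \<in> OP" for f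
    unfolding rowmotion_pow[OF finP set_ps f] period[OF f] restrict_apply'[OF f] ..
  ultimately have "?r [^]\<^bsub>?G\<^esub> (2 * q) = (\<lambda>f\<in>OP. f)" by (rule extensionalityI)
  also have "\<dots> = \<one>\<^bsub>?G\<^esub>" by (simp add: BijGroup_def)
  finally show ?thesis using c group.pow_eq_id[OF group_BijGroup c] by blast
qed

end
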